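(* Let $\sigma$ and $\tau$ be homotopy strings or bands, with associated complexes $Q^\bullet_\sigma$, $Q^\bullet_\tau$, and suppose $\varphi \colon Q^\bullet_\sigma \rightsquigarrow \Sigma^{-1}Q^\bullet_\tau$ is a quasi-graph map determined by a maximal common homotopy substring $\rho$. Assume further that $\sigma$ and $\tau$ are compatibly oriented for $\varphi$. Suppose $f^\bullet \colon Q^\bullet_\sigma \to Q^\bullet_\tau$ is a representative of the homotopy set determined by $\varphi$, and let $M^\bullet_{f^\bullet}$ be its mapping cone. (1) Suppose that $(\sigma,\lambda)$ is a homotopy band and $\tau$ is a homotopy string. (1)(a) Suppose $\rho$ is a proper subword of $\sigma$. Then, after suitable rotation, there is a decomposition $\sigma = \rho\alpha$ and a decomposition $\tau = \delta\rho\gamma$. Then $M^\bullet_{f^\bullet} \cong P^\bullet_c$, where $c = \delta\rho\alpha\rho\gamma$. (1)(b) Suppose there is an integer $m \geq 1$ such that $\rho$ is a proper subword of $\sigma^{m+1}$ and $\sigma^m$ is a (not necessarily proper) subword of $\rho$. Then, after suitable rotation of $\sigma$, there is a decomposition $\sigma = \beta\alpha$ such that $\tau = \delta\sigma^m\beta\gamma$, i.e. $\rho = \sigma^m\beta$. Then $M^\bullet_{f^\bullet} \cong P^\bullet_c$, where $c = \delta\sigma^{m+1}\beta\gamma$. (2) Suppose that $\sigma$ is a homotopy string and $(\tau,\mu)$ is a homotopy band. (2)(a) Suppose $\rho$ is a proper subword of $\tau$. Then, after suitable rotation, there is a decomposition $\tau = \rho\gamma$ and a decomposition $\sigma = \beta\rho\alpha$.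 Then $M^\bullet_{f^\bullet} \cong P^\bullet_c$, where $c = \beta\rho\gamma\rho\alpha$. (2)(b) Suppose there is an integer $n \geq 1$ such that $\rho$ is a proper subword of $\tau^{n+1}$ and $\tau^n$ is a (not necessarily proper) subword of $\rho$. Then, after suitable rotation of $\tau$, there is a decomposition $\tau = \delta\gamma$ such that $\sigma = \beta\tau^n\delta\alpha$, i.e. $\rho = \tau^n\delta$. Then $M^\bullet_{f^\bullet} \cong P^\bullet_c$, where $c = \beta\tau^{n+1}\delta\alpha$.
   Context: **Gentle algebras.** $\mathbf{k}$ is a field and $\Lambda=\mathbf{k}Q/I$ is a gentle algebra: a finite-dimensional algebra, with $Q$ a finite quiver, $I$ generated by paths of length 2, at most two arrows starting and at most two arrows ending at each vertex, and for each arrow $b$: at most one arrow $a$ with $ba$ a path not in $I$, at most one $a$ with $ba$ a path in $I$, at most one arrow $c$ with $cb$ a path not in $I$, and at most one $c$ with $cb$ a path in $I$. For a path or arrow $p$, $s(p)$ and $e(p)$ are its start and end; paths compose right to left ($qp$ is $p$ followed by $q$). $P(x)$ is the indecomposable projective at $x$; a path $p$ nonzero in $\Lambda$ induces a map $P(e(p))\to P(s(p))$, also denoted $p$; the path $qp$ induces the map "first $q$, then $p$", and products of maps below are written in this path order. **Homotopy strings and bands.** All homotopy strings and bands are over $\Lambda$. A direct homotopy letter is a nontrivial path $p$ nonzero in $\Lambda$; an inverse homotopy letter is a formal inverse $\overline p$, with $s(\overline p)=e(p)$, $e(\overline p)=s(p)$. A (finite) homotopy string is a trivial word at a vertex, or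 a word $\sigma=\sigma_n\cdots\sigma_1$ of homotopy letters with $s(\sigma_{i+1})=e(\sigma_i)$ such that for consecutive letters: if $\sigma_{i+1},\sigma_i$ are both direct, then $\sigma_{i+1}\sigma_i$ is zero because the length two path at the junction is in $I$; if both are inverse, the same holds for $\overline{\sigma_i}\,\overline{\sigma_{i+1}}$; if $\sigma_{i+1}=p$, $\sigma_i=\overline q$, then $p,q$ have different first arrows; if $\sigma_{i+1}=\overline p$, $\sigma_i=q$, then $p,q$ have different last arrows. Infinite homotopy strings are defined in the same way, restricted to those whose complex below is a right bounded complex with bounded cohomology. $\sigma$ is drawn as a diagram labelled from left to right by $\sigma_n,\dots,\sigma_1$, a direct letter being an arrow $\rightarrow$ and an inverse letter an arrow $\leftarrow$; vertices carry cohomological degrees, arrows raising degree by one. Words are considered up to inversion. A homotopy band is a nontrivial finite homotopy string $\sigma$ starting and ending at the same vertex and in the same degree (equally many direct and inverse letters), such that $\sigma^2$ is a homotopy string whose letters are the letters of the two copies of $\sigma$ (no merging), and $\sigma$ is not a proper power; bands are considered up to rotation (cyclic permutation) and inversion. ${}^\infty\sigma^\infty$ is the infinite concatenation of copies of $\sigma$. A pair $(\sigma,\lambda)$ with $\lambda\in\mathbf{k}^*$ is also called a homotopy band. In decompositions into factors, factors are subwords of the underlying walk, may be trivial, and letters at a junction of factors may merge. **Complexes.** The string complex $P^\bullet_\sigma$ is the complex of projectives given by the direct sum of the $P(x)$ over the vertices $x$ of the diagram, placed in their degrees, with differential given by the letters. For a band $\sigma$ and $\lambda\in\mathbf{k}^*$,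 the band complex $B^\bullet_{\sigma,\lambda}$ is defined in the same way from the cyclic diagram of $\sigma$ (first and last vertex identified), the scalar $\lambda$ multiplying one direct letter. $Q^\bullet_\sigma$ denotes $P^\bullet_\sigma$ or $B^\bullet_{\sigma,\lambda}$ accordingly. The cohomological grading is suppressed in the notation: a complex attached to a word describing a mapping cone has the degrees inherited from the cone. The mapping cone $M^\bullet_{f^\bullet}$ of $f^\bullet\colon P^\bullet\to Q^\bullet$ is $\Sigma P^\bullet\oplus Q^\bullet$ with differential $\left[\begin{smallmatrix}-d_P&0\\ f&d_Q\end{smallmatrix}\right]$; isomorphisms are in the bounded derived category $\mathsf{D}^b(\Lambda)$. **Quasi-graph maps.** Let $\rho$ be a maximal common homotopy substring (the overlap, possibly trivial) of $\sigma$ and $\tau$ (of ${}^\infty\sigma^\infty$ if $\sigma$ is a band, likewise for $\tau$), with degrees matching in $Q^\bullet_\sigma$ and $\Sigma^{-1}Q^\bullet_\tau$. Let $\sigma_L,\sigma_R$ (resp. $\tau_L,\tau_R$) be the homotopy letters, possibly empty, immediately to the left and right of $\rho$ in $\sigma$ (resp. $\tau$). $\rho$ determines a quasi-graph map $\varphi\colon Q^\bullet_\sigma\rightsquigarrow\Sigma^{-1}Q^\bullet_\tau$ if: at the left end, $\sigma_L,\tau_L$ are both direct with $\tau_L=g\sigma_L$, or both inverse with $\overline{\sigma_L}=\overline{\tau_L}g$, for a nontrivial path $g$; or $\sigma_L$ is empty or direct and $\tau_L$ is empty or inverse, not both empty; and at the right end, $\sigma_R,\tau_R$ are both direct with $\sigma_R=\tau_Rh$,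 or both inverse with $\overline{\tau_R}=h\overline{\sigma_R}$, for a nontrivial path $h$; or $\sigma_R$ is empty or inverse and $\tau_R$ is empty or direct, not both empty. (There is no condition at an end at which $\rho$ is infinite.) A quasi-graph map is not itself a cochain map; it determines a homotopy class (up to nonzero scalars) of maps $Q^\bullet_\sigma\to Q^\bullet_\tau$, called its homotopy set, as follows. Let $x$ be the left end vertex of $\rho$. The class is that of the cochain map whose only nonzero components are: $\sigma_L$ from the left neighbour of $x$ in $\sigma$ to $x$ in $\tau$, if $\sigma_L$ is direct; and $\overline{\tau_L}$ from $x$ in $\sigma$ to the left neighbour of $x$ in $\tau$, if $\tau_L$ is inverse (with the scalars coming from band parameters). The analogous maps at the right end of $\rho$, and the maps with single component a letter of $\rho$, represent the same class up to nonzero scalar. $\sigma$ and $\tau$ are compatibly oriented for $\varphi$ if they are written so that $\rho$ is read in the same direction in both. *)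

theory Defs
  imports
    "Graph_Theory.Arc_Walk"
    "HOL-Library.Function_Algebras"
    "HOL-Library.Product_Plus"
begin

section \<open>Gentle algebras\<close>

text \<open>
  A pair \<open>(b, a)\<close> in \<open>rels\<close> stands for the length two path \<open>ba\<close> (first \<open>a\<close>, then \<open>b\<close>); the
  ideal \<open>I\<close> is generated by these paths.
\<close>

record ('v, 'a) bound_quiver =
  quiver :: "('v, 'a) pre_digraph"
  rels :: "('a \<times> 'a) set"

text \<open>
  A path is given by its start and by its arrows in the order in which they are traversed, so the
  path written \<open>a\<^sub>n\<dots>a\<^sub>1\<close> is \<open>(tail a\<^sub>1, [a\<^sub>1, \<dots>, a\<^sub>n])\<close>.
\<close>

type_synonym ('v, 'a) qpath = "'v \<times> 'a list"

definition pstart :: "('v, 'a) qpath \<Rightarrow> 'v" where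
  "pstart p = fst p"

definition pend :: "('v, 'a) bound_quiver \<Rightarrow> ('v, 'a) qpath \<Rightarrow> 'v" where
  "pend A p = pre_digraph.awlast (quiver A) (fst p) (snd p)"

definition is_path :: "('v, 'a) bound_quiver \<Rightarrow> ('v, 'a) qpath \<Rightarrow> bool" where
  "is_path A p \<longleftrightarrow> pre_digraph.awalk (quiver A) (pstart p) (snd p) (pend A p)"

definition nontrivial :: "('v, 'a) qpath \<Rightarrow> bool" where
  "nontrivial p \<longleftrightarrow> snd p \<noteq> []"

text \<open>\<open>pcomp q p\<close> is the path \<open>qp\<close>, i.e. \<open>p\<close> followed by \<open>q\<close>.\<close>

definition pcomp :: "('v, 'a) qpath \<Rightarrow> ('v, 'a) qpath \<Rightarrow> ('v, 'a) qpath" where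
  "pcomp q p = (fst p, snd p @ snd q)"

text \<open>
  Since \<open>I\<close> is a monomial ideal, a path is nonzero in \<open>kQ/I\<close> iff it does not run through a
  relation, and the classes of these paths form a basis of \<open>kQ/I\<close>.
\<close>

definition nzpaths :: "('v, 'a) bound_quiver \<Rightarrow> ('v, 'a) qpath set" where
  "nzpaths A = {p. is_path A p \<and> successively (\<lambda>a b. (b, a) \<notin> rels A) (snd p)}"

definition gentle :: "('v, 'a) bound_quiver \<Rightarrow> bool" where
  "gentle A \<longleftrightarrow>
     (let Q = quiver A; R = rels A in
       fin_digraph Q \<and>
       R \<subseteq> {(b, a). b \<in> arcs Q \<and> a \<in> arcs Q \<and> tail Q b = head Q a} \<and>
       (\<forall>v \<in> verts Q. out_degree Q v \<le> 2 \<and> in_degree Q v \<le> 2) \<and>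
       (\<forall>b \<in> arcs Q.
          card {a \<in> arcs Q. tail Q b = head Q a \<and> (b, a) \<notin> R} \<le> 1 \<and>
          card {a \<in> arcs Q. tail Q b = head Q a \<and> (b, a) \<in> R} \<le> 1 \<and>
          card {c \<in> arcs Q. tail Q c = head Q b \<and> (c, b) \<notin> R} \<le> 1 \<and>
          card {c \<in> arcs Q. tail Q c = head Q b \<and> (c, b) \<in> R} \<le> 1) \<and>
       finite (nzpaths A))"

text \<open>
  The algebra \<open>\<Lambda> = kQ/I\<close>: an element is its coefficient function with respect to the basis of
  nonzero paths; the sum is the pointwise one.
\<close>

type_synonym ('v, 'a, 'k) algelt = "('v, 'a) qpath \<Rightarrow> 'k"

definition alg :: "('v, 'a) bound_quiver \<Rightarrow> ('v, 'a, 'k::field) algelt set" where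
  "alg A = {u. \<forall>p. p \<notin> nzpaths A \<longrightarrow> u p = 0}"

definition amult :: "('v, 'a) bound_quiver \<Rightarrow> ('v, 'a, 'k::field) algelt \<Rightarrow>
    ('v, 'a, 'k) algelt \<Rightarrow> ('v, 'a, 'k) algelt" where
  "amult A u v = (\<lambda>r. if r \<in> nzpaths A
     then \<Sum>(q, p) \<in> {(q, p). q \<in> nzpaths A \<and> p \<in> nzpaths A \<and>
                          pstart q = pend A p \<and> pcomp q p = r}. u q * v p
     else 0)"

definition aone :: "('v, 'a) bound_quiver \<Rightarrow> ('v, 'a, 'k::field) algelt" where
  "aone A = (\<lambda>p. if p \<in> nzpaths A \<and> \<not> nontrivial p then 1 else 0)"

definition path_elt :: "('v, 'a) qpath \<Rightarrow> ('v, 'a, 'k::field) algelt" where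
  "path_elt p = (\<lambda>r. if r = p then 1 else 0)"

section \<open>Modules, complexes and the bounded derived category\<close>

text \<open>Left \<open>\<Lambda>\<close>-modules whose underlying group is a subgroup of the group \<open>'m\<close>.\<close>

record ('l, 'm) lmod =
  mcar :: "'m set"
  mact :: "'l \<Rightarrow> 'm \<Rightarrow> 'm"

definition is_module :: "('v, 'a) bound_quiver \<Rightarrow>
    (('v, 'a, 'k::field) algelt, 'm::ab_group_add) lmod \<Rightarrow> bool" where
  "is_module A M \<longleftrightarrow>
     0 \<in> mcar M \<and>
     (\<forall>x \<in> mcar M. \<forall>y \<in> mcar M. x + y \<in> mcar M) \<and>
     (\<forall>x \<in> mcar M. - x \<in> mcar M) \<and>
     (\<forall>a \<in> alg A. \<forall>x \<in> mcar M. mact M a x \<in> mcar M) \<and>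
     (\<forall>a \<in> alg A. \<forall>x \<in> mcar M. \<forall>y \<in> mcar M. mact M a (x + y) = mact M a x + mact M a y) \<and>
     (\<forall>a \<in> alg A. \<forall>b \<in> alg A. \<forall>x \<in> mcar M. mact M (a + b) x = mact M a x + mact M b x) \<and>
     (\<forall>a \<in> alg A. \<forall>b \<in> alg A. \<forall>x \<in> mcar M. mact M (amult A a b) x = mact M a (mact M b x)) \<and>
     (\<forall>x \<in> mcar M. mact M (aone A) x = x)"

definition fin_gen :: "('v, 'a) bound_quiver \<Rightarrow>
    (('v, 'a, 'k::field) algelt, 'm::ab_group_add) lmod \<Rightarrow> bool" where
  "fin_gen A M \<longleftrightarrow> (\<exists>G. finite G \<and> G \<subseteq> mcar M \<and>
     (\<forall>x \<in> mcar M. \<exists>c. (\<forall>g \<in> G. c g \<in> alg A) \<and> x = (\<Sum>g \<in> G. mact M (c g) g)))"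

definition mod_hom :: "('v, 'a) bound_quiver \<Rightarrow>
    (('v, 'a, 'k::field) algelt, 'm::ab_group_add) lmod \<Rightarrow>
    (('v, 'a, 'k) algelt, 'n::ab_group_add) lmod \<Rightarrow> ('m \<Rightarrow> 'n) \<Rightarrow> bool" where
  "mod_hom A M N h \<longleftrightarrow>
     (\<forall>x \<in> mcar M. h x \<in> mcar N) \<and>
     (\<forall>x \<in> mcar M. \<forall>y \<in> mcar M. h (x + y) = h x + h y) \<and>
     (\<forall>a \<in> alg A. \<forall>x \<in> mcar M. h (mact M a x) = mact N a (h x))"

record ('l, 'm) cplx =
  cobj :: "int \<Rightarrow> ('l, 'm) lmod"
  cdif :: "int \<Rightarrow> 'm \<Rightarrow> 'm"

definition is_complex :: "('v, 'a) bound_quiver \<Rightarrow>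
    (('v, 'a, 'k::field) algelt, 'm::ab_group_add) cplx \<Rightarrow> bool" where
  "is_complex A C \<longleftrightarrow> (\<forall>i.
     is_module A (cobj C i) \<and> mod_hom A (cobj C i) (cobj C (i + 1)) (cdif C i) \<and>
     (\<forall>x \<in> mcar (cobj C i). cdif C (i + 1) (cdif C i x) = 0))"

definition cocycles :: "('l, 'm::ab_group_add) cplx \<Rightarrow> int \<Rightarrow> 'm set" where
  "cocycles C i = {x \<in> mcar (cobj C i). cdif C i x = 0}"

definition coboundaries :: "('l, 'm::ab_group_add) cplx \<Rightarrow> int \<Rightarrow> 'm set" where
  "coboundaries C i = cdif C (i - 1) ` mcar (cobj C (i - 1))"

definition bounded_cohomology :: "('l, 'm::ab_group_add) cplx \<Rightarrow> bool" where
  "bounded_cohomology C \<longleftrightarrow> (\<exists>n. \<forall>i. \<bar>i\<bar> > n \<longrightarrow> cocycles C i \<subseteq> coboundaries C i)"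

definition chain_map :: "('v, 'a) bound_quiver \<Rightarrow>
    (('v, 'a, 'k::field) algelt, 'm::ab_group_add) cplx \<Rightarrow>
    (('v, 'a, 'k) algelt, 'n::ab_group_add) cplx \<Rightarrow> (int \<Rightarrow> 'm \<Rightarrow> 'n) \<Rightarrow> bool" where
  "chain_map A C D f \<longleftrightarrow> (\<forall>i. mod_hom A (cobj C i) (cobj D i) (f i) \<and>
     (\<forall>x \<in> mcar (cobj C i). f (i + 1) (cdif C i x) = cdif D i (f i x)))"

definition homotopic :: "('v, 'a) bound_quiver \<Rightarrow>
    (('v, 'a, 'k::field) algelt, 'm::ab_group_add) cplx \<Rightarrow>
    (('v, 'a, 'k) algelt, 'n::ab_group_add) cplx \<Rightarrow>
    (int \<Rightarrow> 'm \<Rightarrow> 'n) \<Rightarrow> (int \<Rightarrow> 'm \<Rightarrow> 'n) \<Rightarrow> bool" where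
  "homotopic A C D f g \<longleftrightarrow> (\<exists>h. (\<forall>i. mod_hom A (cobj C i) (cobj D (i - 1)) (h i)) \<and>
     (\<forall>i. \<forall>x \<in> mcar (cobj C i).
        f i x - g i x = cdif D (i - 1) (h i x) + h (i + 1) (cdif C i x)))"

text \<open>The two conditions say that \<open>H\<^sup>i(f)\<close> is injective and surjective.\<close>

definition quasi_iso :: "('v, 'a) bound_quiver \<Rightarrow>
    (('v, 'a, 'k::field) algelt, 'm::ab_group_add) cplx \<Rightarrow>
    (('v, 'a, 'k) algelt, 'n::ab_group_add) cplx \<Rightarrow> (int \<Rightarrow> 'm \<Rightarrow> 'n) \<Rightarrow> bool" where
  "quasi_iso A C D f \<longleftrightarrow> chain_map A C D f \<and> (\<forall>i.
     (\<forall>x \<in> cocycles C i. f i x \<in> coboundaries D i \<longrightarrow> x \<in> coboundaries C i) \<and>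
     (\<forall>y \<in> cocycles D i. \<exists>x \<in> cocycles C i. y - f i x \<in> coboundaries D i))"

text \<open>
  The bounded derived category as the full subcategory of the derived category of finitely
  generated \<open>\<Lambda>\<close>-modules given by the complexes with bounded cohomology; it contains the complexes
  of infinite homotopy strings.
\<close>

definition in_Db :: "('v, 'a) bound_quiver \<Rightarrow>
    (('v, 'a, 'k::field) algelt, 'm::ab_group_add) cplx \<Rightarrow> bool" where
  "in_Db A C \<longleftrightarrow> is_complex A C \<and> (\<forall>i. fin_gen A (cobj C i)) \<and> bounded_cohomology C"

text \<open>
  Isomorphisms in the derived category are the roofs of two quasi-isomorphisms. The modules of the
  apex \<open>Z\<close> live in the group \<open>'m\<close> of \<open>C\<close>, with an action that need not be related to that of \<open>C\<close>.
  This is no restriction in the uses below: there \<open>'m\<close> carries an infinite-dimensional vector space,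
  so every finitely generated \<open>\<Lambda>\<close>-module is isomorphic to one with carrier in \<open>'m\<close>.
\<close>

definition Db_iso :: "('v, 'a) bound_quiver \<Rightarrow>
    (('v, 'a, 'k::field) algelt, 'm::ab_group_add) cplx \<Rightarrow>
    (('v, 'a, 'k) algelt, 'n::ab_group_add) cplx \<Rightarrow> bool" where
  "Db_iso A C D \<longleftrightarrow> in_Db A C \<and> in_Db A D \<and>
     (\<exists>(Z :: (('v, 'a, 'k) algelt, 'm) cplx) f g.
        in_Db A Z \<and> quasi_iso A Z C f \<and> quasi_iso A Z D g)"

definition cone :: "('l, 'm::ab_group_add) cplx \<Rightarrow> ('l, 'n::ab_group_add) cplx \<Rightarrow>
    (int \<Rightarrow> 'm \<Rightarrow> 'n) \<Rightarrow> ('l, 'm \<times> 'n) cplx" where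
  "cone C D f = \<lparr>
     cobj = (\<lambda>i. \<lparr>mcar = mcar (cobj C (i + 1)) \<times> mcar (cobj D i),
                  mact = (\<lambda>a (x, y). (mact (cobj C (i + 1)) a x, mact (cobj D i) a y))\<rparr>),
     cdif = (\<lambda>i (x, y). (- cdif C (i + 1) x, f (i + 1) x + cdif D i y))\<rparr>"

section \<open>Words\<close>

text \<open>\<open>Inv p\<close> is the formal inverse of the path \<open>p\<close>.\<close>

datatype ('v, 'a) letter = Dir "('v, 'a) qpath" | Inv "('v, 'a) qpath"

text \<open>
  A word is given by its diagram. The vertices, from left to right, are indexed by an interval
  \<open>wpos\<close> of integers, and \<open>wltr w k\<close> is the letter between the vertices \<open>k\<close> and \<open>k + 1\<close>; the values
  of \<open>wvtx\<close> and \<open>wltr\<close> outside the diagram are irrelevant. So a word \<open>\<sigma>\<^sub>n\<dots>\<sigma>\<^sub>1\<close> has \<open>n + 1\<close> vertices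
  and its leftmost letter \<open>\<sigma>\<^sub>n\<close> has the smallest index. A word does not depend on the numbering:
  \<open>wsame\<close> is equality of words.
\<close>

record ('v, 'a) word =
  wpos :: "int set"
  wvtx :: "int \<Rightarrow> 'v"
  wltr :: "int \<Rightarrow> ('v, 'a) letter"

definition interval :: "int set \<Rightarrow> bool" where
  "interval S \<longleftrightarrow> S \<noteq> {} \<and> (\<forall>a \<in> S. \<forall>b \<in> S. {a..b} \<subseteq> S)"

definition wsame :: "('v, 'a) word \<Rightarrow> ('v, 'a) word \<Rightarrow> bool" where
  "wsame w w' \<longleftrightarrow> (\<exists>s. wpos w' = (\<lambda>k. k + s) ` wpos w \<and>
     (\<forall>k \<in> wpos w. wvtx w' (k + s) = wvtx w k) \<and>
     (\<forall>k. k \<in> wpos w \<and> k + 1 \<in> wpos w \<longrightarrow> wltr w' (k + s) = wltr w k))"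

text \<open>The number of letters of a finite word.\<close>

definition wlen :: "('v, 'a) word \<Rightarrow> int" where
  "wlen w = Sup (wpos w) - Inf (wpos w)"

definition wsub :: "('v, 'a) word \<Rightarrow> int set \<Rightarrow> ('v, 'a) word" where
  "wsub w S = w\<lparr>wpos := wpos w \<inter> S\<rparr>"

definition subword :: "('v, 'a) word \<Rightarrow> ('v, 'a) word \<Rightarrow> bool" where
  "subword u w \<longleftrightarrow> (\<exists>S. interval S \<and> S \<subseteq> wpos w \<and> wsame u (wsub w S))"

definition proper_subword :: "('v, 'a) word \<Rightarrow> ('v, 'a) word \<Rightarrow> bool" where
  "proper_subword u w \<longleftrightarrow> subword u w \<and> \<not> wsame u w"

text \<open>
  Concatenation, for \<open>u\<close> finite on the right and \<open>v\<close> finite on the left: the last vertex of \<open>u\<close> is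
  identified with the first vertex of \<open>v\<close>. The vertices coming from \<open>u\<close> keep their numbers. Letters
  at the junction are not merged; where a concatenation is claimed to be a homotopy string,
  this includes the claim that there is nothing to merge.
\<close>

definition wcat :: "('v, 'a) word \<Rightarrow> ('v, 'a) word \<Rightarrow> ('v, 'a) word" (infixr \<open>\<cdot>\<close> 65) where
  "u \<cdot> v = (let s = Sup (wpos u) - Inf (wpos v) in \<lparr>
     wpos = wpos u \<union> (\<lambda>k. k + s) ` wpos v,
     wvtx = (\<lambda>k. if k \<in> wpos u then wvtx u k else wvtx v (k - s)),
     wltr = (\<lambda>k. if k \<in> wpos u \<and> k + 1 \<in> wpos u then wltr u k else wltr v (k - s))\<rparr>)"

text \<open>
  For a closed word \<open>w\<close> with vertices \<open>{0..n}\<close>, where the vertices \<open>0\<close> and \<open>n\<close> agree: the infinite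
  concatenation of copies of \<open>w\<close>, the power \<open>w\<^sup>m\<close>, and the rotation of \<open>w\<close> that starts at the
  vertex \<open>r\<close>.
\<close>

definition unroll :: "('v, 'a) word \<Rightarrow> ('v, 'a) word" where
  "unroll w = \<lparr>wpos = UNIV, wvtx = (\<lambda>k. wvtx w (k mod wlen w)), wltr = (\<lambda>k. wltr w (k mod wlen w))\<rparr>"

definition wpow :: "('v, 'a) word \<Rightarrow> nat \<Rightarrow> ('v, 'a) word" where
  "wpow w m = wsub (unroll w) {0..int m * wlen w}"

definition wrot :: "int \<Rightarrow> ('v, 'a) word \<Rightarrow> ('v, 'a) word" where
  "wrot r w = \<lparr>wpos = {0..wlen w},
     wvtx = (\<lambda>k. wvtx (unroll w) (k + r)), wltr = (\<lambda>k. wltr (unroll w) (k + r))\<rparr>"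

section \<open>Homotopy strings and bands\<close>

text \<open>
  A letter \<open>\<sigma>\<close> has its end \<open>e(\<sigma>)\<close> on the left and its start \<open>s(\<sigma>)\<close> on the right.
\<close>

fun letter_ok :: "('v, 'a) bound_quiver \<Rightarrow> 'v \<Rightarrow> ('v, 'a) letter \<Rightarrow> 'v \<Rightarrow> bool" where
  "letter_ok A x (Dir p) y \<longleftrightarrow> p \<in> nzpaths A \<and> nontrivial p \<and> pend A p = x \<and> pstart p = y"
| "letter_ok A x (Inv p) y \<longleftrightarrow> p \<in> nzpaths A \<and> nontrivial p \<and> pstart p = x \<and> pend A p = y"

text \<open>
  The first and the last arrow of a path are \<open>hd\<close> and \<open>last\<close> of its arrow list. The first letter is
  the left one.
\<close>

fun junction_ok :: "('v, 'a) bound_quiver \<Rightarrow> ('v, 'a) letter \<Rightarrow> ('v, 'a) letter \<Rightarrow> bool" where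
  "junction_ok A (Dir p) (Dir q) \<longleftrightarrow> (hd (snd p), last (snd q)) \<in> rels A"
| "junction_ok A (Inv p) (Inv q) \<longleftrightarrow> (hd (snd q), last (snd p)) \<in> rels A"
| "junction_ok A (Dir p) (Inv q) \<longleftrightarrow> hd (snd p) \<noteq> hd (snd q)"
| "junction_ok A (Inv p) (Dir q) \<longleftrightarrow> last (snd p) \<noteq> last (snd q)"

definition is_hword :: "('v, 'a) bound_quiver \<Rightarrow> ('v, 'a) word \<Rightarrow> bool" where
  "is_hword A w \<longleftrightarrow>
     interval (wpos w) \<and>
     (\<forall>k \<in> wpos w. wvtx w k \<in> verts (quiver A)) \<and>
     (\<forall>k. {k, k + 1} \<subseteq> wpos w \<longrightarrow> letter_ok A (wvtx w k) (wltr w k) (wvtx w (k + 1))) \<and>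
     (\<forall>k. {k, k + 1, k + 2} \<subseteq> wpos w \<longrightarrow> junction_ok A (wltr w k) (wltr w (k + 1)))"

definition is_dir :: "('v, 'a) letter \<Rightarrow> bool" where
  "is_dir l \<longleftrightarrow> (\<exists>p. l = Dir p)"

definition grading :: "('v, 'a) word \<Rightarrow> (int \<Rightarrow> int) \<Rightarrow> bool" where
  "grading w d \<longleftrightarrow> (\<forall>k. {k, k + 1} \<subseteq> wpos w \<longrightarrow>
     (if is_dir (wltr w k) then d (k + 1) = d k + 1 else d k = d (k + 1) + 1))"

text \<open>The vertices of a band are numbered \<open>0, \<dots>, n\<close>, which is no loss of generality.\<close>

definition is_band :: "('v, 'a) bound_quiver \<Rightarrow> ('v, 'a) word \<Rightarrow> bool" where
  "is_band A w \<longleftrightarrow>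
     is_hword A w \<and> (\<exists>n > 0. wpos w = {0..n}) \<and>
     wvtx w 0 = wvtx w (wlen w) \<and>
     card {k \<in> {0..<wlen w}. is_dir (wltr w k)} = card {k \<in> {0..<wlen w}. \<not> is_dir (wltr w k)} \<and>
     is_hword A (w \<cdot> w) \<and>
     \<not> (\<exists>u m n. m \<ge> 2 \<and> n > 0 \<and> wpos u = {0..n} \<and> wvtx u 0 = wvtx u n \<and> wsame w (wpow u m))"

text \<open>
  Graded homotopy strings, and graded homotopy bands with their scalar. In \<open>HBnd w d l k\<close> the
  scalar \<open>l\<close> multiplies the letter with index \<open>k\<close>, which has to be a direct one.
\<close>

datatype ('v, 'a, 'k) hobj =
    HStr "('v, 'a) word" "int \<Rightarrow> int"
  | HBnd "('v, 'a) word" "int \<Rightarrow> int" 'k int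

text \<open>
  For a band, \<open>oword\<close> and \<open>odeg\<close> are the unrolled word and its degrees, whereas the diagram is
  cyclic; \<open>oix\<close> sends the vertices and letters of \<open>oword\<close> to those of the diagram, whose letter \<open>k\<close>
  joins the vertices \<open>oix k\<close> and \<open>oix (k + 1)\<close>.
\<close>

fun oword :: "('v, 'a, 'k) hobj \<Rightarrow> ('v, 'a) word" where
  "oword (HStr w d) = w"
| "oword (HBnd w d l k0) = unroll w"

fun oix :: "('v, 'a, 'k) hobj \<Rightarrow> int \<Rightarrow> int" where
  "oix (HStr w d) k = k"
| "oix (HBnd w d l k0) k = k mod wlen w"

fun odeg :: "('v, 'a, 'k) hobj \<Rightarrow> int \<Rightarrow> int" where
  "odeg (HStr w d) k = d k"
| "odeg (HBnd w d l k0) k = d (k mod wlen w)"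

fun overts :: "('v, 'a, 'k) hobj \<Rightarrow> int set" where
  "overts (HStr w d) = wpos w"
| "overts (HBnd w d l k0) = {0..<wlen w}"

fun oletters :: "('v, 'a, 'k) hobj \<Rightarrow> int set" where
  "oletters (HStr w d) = {k. {k, k + 1} \<subseteq> wpos w}"
| "oletters (HBnd w d l k0) = {0..<wlen w}"

fun ocoef :: "('v, 'a, 'k::field) hobj \<Rightarrow> int \<Rightarrow> 'k" where
  "ocoef (HStr w d) k = 1"
| "ocoef (HBnd w d l k0) k = (if k = k0 then l else 1)"

text \<open>\<open>P(x) = \<Lambda>e\<^sub>x\<close> is spanned by the nonzero paths starting at \<open>x\<close>.\<close>

definition proj :: "('v, 'a) bound_quiver \<Rightarrow> 'v \<Rightarrow> ('v, 'a, 'k::field) algelt set" where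
  "proj A x = {u \<in> alg A. \<forall>p. u p \<noteq> 0 \<longrightarrow> pstart p = x}"

text \<open>
  The map \<open>P(e(p)) \<rightarrow> P(s(p))\<close> induced by \<open>p\<close>, right multiplication with \<open>p\<close>, times a scalar.
\<close>

definition pmap :: "('v, 'a) bound_quiver \<Rightarrow> 'k::field \<Rightarrow> ('v, 'a) qpath \<Rightarrow>
    ('v, 'a, 'k) algelt \<Rightarrow> ('v, 'a, 'k) algelt" where
  "pmap A c p u = (\<lambda>r. c * amult A u (path_elt p) r)"

text \<open>
  The string or band complex. An element of degree \<open>i\<close> of the direct sum of the \<open>P(x)\<close> over the
  vertices of the diagram assigns to each vertex of degree \<open>i\<close> an element of \<open>P(x)\<close>, and \<open>0\<close> to all
  other integers. In the differential, the first sum collects what the vertex \<open>v\<close> receives from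
  its left through direct letters, the second what it receives from its right through inverse
  letters.
\<close>

type_synonym ('v, 'a, 'k) dsum = "int \<Rightarrow> ('v, 'a, 'k) algelt"

definition Qdif :: "('v, 'a) bound_quiver \<Rightarrow> ('v, 'a, 'k::field) hobj \<Rightarrow>
    ('v, 'a, 'k) dsum \<Rightarrow> ('v, 'a, 'k) dsum" where
  "Qdif A X u = (\<lambda>v.
     (\<Sum>k \<in> {k \<in> oletters X. oix X (k + 1) = v}.
        case wltr (oword X) k of Dir p \<Rightarrow> pmap A (ocoef X k) p (u (oix X k)) | Inv p \<Rightarrow> 0) +
     (\<Sum>k \<in> {k \<in> oletters X. oix X k = v}.
        case wltr (oword X) k of Dir p \<Rightarrow> 0 | Inv p \<Rightarrow> pmap A (ocoef X k) p (u (oix X (k + 1)))))"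

definition Qcx :: "('v, 'a) bound_quiver \<Rightarrow> ('v, 'a, 'k::field) hobj \<Rightarrow>
    (('v, 'a, 'k) algelt, ('v, 'a, 'k) dsum) cplx" where
  "Qcx A X = \<lparr>
     cobj = (\<lambda>i. \<lparr>
       mcar = {u. finite {v. u v \<noteq> 0} \<and>
                  (\<forall>v. if v \<in> overts X \<and> odeg X v = i
                       then u v \<in> proj A (wvtx (oword X) v) else u v = 0)},
       mact = (\<lambda>a u v. amult A a (u v))\<rparr>),
     cdif = (\<lambda>i. Qdif A X)\<rparr>"

text \<open>
  For an infinite word the complex has to be a right bounded complex of finitely generated
  projectives with bounded cohomology. For a finite word this is automatic.
\<close>

fun is_hobj :: "('v, 'a) bound_quiver \<Rightarrow> ('v, 'a, 'k::field) hobj \<Rightarrow> bool" where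
  "is_hobj A (HStr w d) \<longleftrightarrow>
     is_hword A w \<and> grading w d \<and>
     (infinite (wpos w) \<longrightarrow>
        (\<exists>n. \<forall>k \<in> wpos w. d k \<le> n) \<and> (\<forall>i. finite {k \<in> wpos w. d k = i}) \<and>
        bounded_cohomology (Qcx A (HStr w d :: ('v, 'a, 'k) hobj)))"
| "is_hobj A (HBnd w d l k0) \<longleftrightarrow>
     is_band A w \<and> grading w d \<and> l \<noteq> 0 \<and> 0 \<le> k0 \<and> k0 < wlen w \<and> is_dir (wltr w k0)"

section \<open>Quasi-graph maps\<close>

text \<open>
  An overlap of \<open>X\<close> and \<open>Y\<close> is given by its set \<open>S\<close> of vertices in \<open>X\<close> and the difference \<open>s\<close> to
  the numbers of the same vertices in \<open>Y\<close>. As it is read from left to right in both words, the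
  words are compatibly oriented.
\<close>

definition overlap :: "('v, 'a, 'k) hobj \<Rightarrow> ('v, 'a, 'k) hobj \<Rightarrow> int set \<Rightarrow> int \<Rightarrow> bool" where
  "overlap X Y S s \<longleftrightarrow>
     interval S \<and> S \<subseteq> wpos (oword X) \<and> (\<lambda>k. k + s) ` S \<subseteq> wpos (oword Y) \<and>
     (\<forall>k \<in> S. wvtx (oword Y) (k + s) = wvtx (oword X) k) \<and>
     (\<forall>k. {k, k + 1} \<subseteq> S \<longrightarrow> wltr (oword Y) (k + s) = wltr (oword X) k)"

definition maximal_overlap :: "('v, 'a, 'k) hobj \<Rightarrow> ('v, 'a, 'k) hobj \<Rightarrow> int set \<Rightarrow> int \<Rightarrow> bool" where
  "maximal_overlap X Y S s \<longleftrightarrow>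
     overlap X Y S s \<and> (\<forall>S'. overlap X Y S' s \<and> S \<subseteq> S' \<longrightarrow> S' = S)"

text \<open>The letters immediately to the left and to the right of the vertex \<open>k\<close>.\<close>

definition ltr_left :: "('v, 'a) word \<Rightarrow> int \<Rightarrow> ('v, 'a) letter option" where
  "ltr_left w k = (if k - 1 \<in> wpos w then Some (wltr w (k - 1)) else None)"

definition ltr_right :: "('v, 'a) word \<Rightarrow> int \<Rightarrow> ('v, 'a) letter option" where
  "ltr_right w k = (if k + 1 \<in> wpos w then Some (wltr w k) else None)"

definition empty_or_dir :: "('v, 'a) letter option \<Rightarrow> bool" where
  "empty_or_dir l \<longleftrightarrow> l = None \<or> (\<exists>p. l = Some (Dir p))"

definition empty_or_inv :: "('v, 'a) letter option \<Rightarrow> bool" where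
  "empty_or_inv l \<longleftrightarrow> l = None \<or> (\<exists>p. l = Some (Inv p))"

definition left_end_ok :: "('v, 'a) bound_quiver \<Rightarrow>
    ('v, 'a) letter option \<Rightarrow> ('v, 'a) letter option \<Rightarrow> bool" where
  "left_end_ok A sL tL \<longleftrightarrow>
     (\<exists>p g. is_path A g \<and> nontrivial g \<and> pstart g = pend A p \<and>
        sL = Some (Dir p) \<and> tL = Some (Dir (pcomp g p))) \<or>
     (\<exists>p g. is_path A g \<and> nontrivial g \<and> pend A g = pstart p \<and>
        sL = Some (Inv (pcomp p g)) \<and> tL = Some (Inv p)) \<or>
     (empty_or_dir sL \<and> empty_or_inv tL \<and> \<not> (sL = None \<and> tL = None))"

definition right_end_ok :: "('v, 'a) bound_quiver \<Rightarrow>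
    ('v, 'a) letter option \<Rightarrow> ('v, 'a) letter option \<Rightarrow> bool" where
  "right_end_ok A sR tR \<longleftrightarrow>
     (\<exists>p h. is_path A h \<and> nontrivial h \<and> pend A h = pstart p \<and>
        sR = Some (Dir (pcomp p h)) \<and> tR = Some (Dir p)) \<or>
     (\<exists>p h. is_path A h \<and> nontrivial h \<and> pstart h = pend A p \<and>
        sR = Some (Inv p) \<and> tR = Some (Inv (pcomp h p))) \<or>
     (empty_or_inv sR \<and> empty_or_dir tR \<and> \<not> (sR = None \<and> tR = None))"

text \<open>
  The overlap \<open>(S, s)\<close> determines a quasi-graph map from \<open>Q\<^sub>X\<close> to \<open>\<Sigma>\<^sup>-\<^sup>1Q\<^sub>Y\<close>. A vertex of degree \<open>i\<close>
  in \<open>\<Sigma>\<^sup>-\<^sup>1Q\<^sub>Y\<close> has degree \<open>i - 1\<close> in \<open>Q\<^sub>Y\<close>.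
\<close>

definition quasi_graph_map :: "('v, 'a) bound_quiver \<Rightarrow>
    ('v, 'a, 'k) hobj \<Rightarrow> ('v, 'a, 'k) hobj \<Rightarrow> int set \<Rightarrow> int \<Rightarrow> bool" where
  "quasi_graph_map A X Y S s \<longleftrightarrow>
     maximal_overlap X Y S s \<and>
     (\<forall>k \<in> S. odeg Y (k + s) = odeg X k - 1) \<and>
     (bdd_below S \<longrightarrow>
        left_end_ok A (ltr_left (oword X) (Inf S)) (ltr_left (oword Y) (Inf S + s))) \<and>
     (bdd_above S \<longrightarrow>
        right_end_ok A (ltr_right (oword X) (Sup S)) (ltr_right (oword Y) (Sup S + s)))"

text \<open>
  The map given by the left end \<open>x\<close> of the overlap, with number \<open>i\<close> in \<open>X\<close> and \<open>j\<close> in \<open>Y\<close>. Its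
  components are components of the differentials of \<open>Q\<^sub>X\<close> and \<open>Q\<^sub>Y\<close>, including their scalars.
\<close>

definition left_end_map :: "('v, 'a) bound_quiver \<Rightarrow>
    ('v, 'a, 'k::field) hobj \<Rightarrow> ('v, 'a, 'k) hobj \<Rightarrow> int \<Rightarrow> int \<Rightarrow>
    ('v, 'a, 'k) dsum \<Rightarrow> ('v, 'a, 'k) dsum" where
  "left_end_map A X Y i j u = (\<lambda>v.
     (case ltr_left (oword X) i of
        Some (Dir p) \<Rightarrow>
          (if v = oix Y j then pmap A (ocoef X (oix X (i - 1))) p (u (oix X (i - 1))) else 0)
      | _ \<Rightarrow> 0) +
     (case ltr_left (oword Y) j of
        Some (Inv p) \<Rightarrow>
          (if v = oix Y (j - 1) then pmap A (ocoef Y (oix Y (j - 1))) p (u (oix X i)) else 0)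
      | _ \<Rightarrow> 0))"

text \<open>
  \<open>f\<close> is a representative of the homotopy set: a cochain map homotopic to a nonzero multiple of the
  map above, for an overlap with a left end (the overlaps in a cone formula are finite). If the
  overlap is a single vertex, it can be read in both directions, and the conditions of
  \<open>quasi_graph_map\<close> can hold for an orientation for which the map above is not a cochain map;
  then there is no \<open>f\<close> as required here.
\<close>

definition represents :: "('v, 'a) bound_quiver \<Rightarrow>
    ('v, 'a, 'k::field) hobj \<Rightarrow> ('v, 'a, 'k) hobj \<Rightarrow> int set \<Rightarrow> int \<Rightarrow>
    (int \<Rightarrow> ('v, 'a, 'k) dsum \<Rightarrow> ('v, 'a, 'k) dsum) \<Rightarrow> bool" where
  "represents A X Y S s f \<longleftrightarrow>
     bdd_below S \<and> chain_map A (Qcx A X) (Qcx A Y) f \<and>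
     (\<exists>c. c \<noteq> 0 \<and> homotopic A (Qcx A X) (Qcx A Y) f
        (\<lambda>i u v p. c * left_end_map A X Y (Inf S) (Inf S + s) u v p))"

end

theory Submission
  imports Defs
begin

text \<open>
  One of the two objects is a homotopy string, with word \<open>t\<close>, the other is a band; let \<open>b\<close> be the
  unrolled band, of period \<open>L\<close>. Along the overlap \<open>\<rho>\<close>, \<open>t\<close> and \<open>b\<close> have the same letters. The word
  \<open>c\<close> of the cone is \<open>t\<close> with one turn of the band inserted at the left end of \<open>\<rho>\<close>; this description
  does not depend on whether \<open>\<rho>\<close> is shorter or longer than a turn, so the cases (a) and (b) differ
  only in the way in which \<open>c\<close> is cut into factors (\<open>ins_words\<close>). Reading \<open>c\<close> from the left, it agrees
  with \<open>t\<close> up to the right end of a first copy of \<open>\<rho>\<close>, with \<open>b\<close> from the beginning of this copy to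
  the end of a second copy, and from the beginning of the second copy onwards with \<open>t\<close> shifted
  by \<open>L\<close>. The two copies overlap if \<open>\<rho>\<close> is longer than a turn.

  Hence there are two partial identifications of \<open>t\<close> with \<open>c\<close>. The end conditions of a quasi-graph
  map say precisely that each of them extends, by the path \<open>h\<close> at the right end and by the path \<open>g\<close>
  at the left end, to a cochain map of the string complexes (\<open>right_graph_map\<close>, \<open>left_graph_map\<close>).

  Let \<open>\<tau> = t\<close> be the string, and let \<open>V\<^sub>1, V\<^sub>2\<close> be these two maps from \<open>P\<^sub>\<tau>\<close> to \<open>P\<^sub>c\<close>. The combination
  \<open>V = q V\<^sub>2 - V\<^sub>1\<close> is injective, and a graded complement of its image is the copy of the band
  complex on the inserted turn. The embedding \<open>T\<close> of this copy fails to commute with the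
  differentials only where the cyclic diagram has been cut open, and there the defect is exactly
  \<open>V f\<^sub>0\<close>, where \<open>f\<^sub>0\<close> is the map given by the left end of \<open>\<rho>\<close>. So \<open>(x, y) \<mapsto> T x + V y\<close> is a cochain
  map from the cone of \<open>f\<^sub>0\<close> to \<open>P\<^sub>c\<close>, and it is bijective because it is triangular with respect to
  the position in \<open>c\<close> (\<open>band_to_string_iso\<close>). If \<open>\<sigma> = t\<close> is the string, the same happens with all
  arrows reversed: two graph maps from \<open>P\<^sub>c\<close> to the shift of \<open>P\<^sub>\<sigma>\<close>, together with the restriction to the inserted
  turn, give a bijective cochain map from \<open>P\<^sub>c\<close> to the cone (\<open>string_to_band_iso\<close>). In both cases
  the parameter of the band and the sign in the differential of the cone are absorbed into
  rescalings \<open>\<theta>\<close> of the vertices of \<open>b\<close>; the factor \<open>q\<close> is the change of \<open>\<theta>\<close> over one turn.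

  It remains to see that \<open>c\<close> is a homotopy string. If \<open>\<rho>\<close> has at least one letter, any two
  consecutive letters of \<open>c\<close> are consecutive in \<open>t\<close> or in \<open>b\<close>. If \<open>\<rho>\<close> is a single vertex, letters
  of \<open>t\<close> and of \<open>b\<close> meet at it; they fit together because of the end conditions, or because
  \<open>f\<^sub>0\<close> is a cochain map, as a nonzero multiple of it is homotopic to \<open>f\<close> (\<open>crossed_junctions\<close>).
  Finally, homotopic maps have isomorphic cones (\<open>cone_homotopic\<close>), and the bounded cohomology of
  \<open>P\<^sub>c\<close>, which is part of the claim if \<open>c\<close> is infinite, is inherited from the cone.
\<close>

section \<open>Multiplication in the algebra of a gentle quiver\<close>

locale gentle_algebra =
  fixes A :: "('v, 'a) bound_quiver"
  assumes gentle: "gentle A"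
begin

lemma fin_digraph_quiver: "fin_digraph (quiver A)"
  using gentle by (simp add: gentle_def Let_def)

sublocale fin_digraph "quiver A"
  by (rule fin_digraph_quiver)

lemma card_le_1_eq: "finite S \<Longrightarrow> card S \<le> 1 \<Longrightarrow> x \<in> S \<Longrightarrow> y \<in> S \<Longrightarrow> x = y"
  using card_le_Suc0_iff_eq[of S] by auto

lemma gentle_cards:
  assumes "b \<in> arcs (quiver A)"
  shows "card {a \<in> arcs (quiver A). tail (quiver A) b = head (quiver A) a \<and> (b, a) \<notin> rels A} \<le> 1"
    and "card {a \<in> arcs (quiver A). tail (quiver A) b = head (quiver A) a \<and> (b, a) \<in> rels A} \<le> 1"
    and "card {c \<in> arcs (quiver A). tail (quiver A) c = head (quiver A) b \<and> (c, b) \<notin> rels A} \<le> 1"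
    and "card {c \<in> arcs (quiver A). tail (quiver A) c = head (quiver A) b \<and> (c, b) \<in> rels A} \<le> 1"
  using gentle assms unfolding gentle_def Let_def by blast+

text \<open>
  Gentleness in the form in which it is used: of two different arrows that can precede (follow) a
  given arrow, exactly one forms a relation with it.
\<close>

lemma relation_before:
  assumes "b \<in> arcs (quiver A)" "a \<in> arcs (quiver A)" "a' \<in> arcs (quiver A)"
    "tail (quiver A) b = head (quiver A) a" "tail (quiver A) b = head (quiver A) a'" "a \<noteq> a'"
  shows "(b, a) \<in> rels A \<longleftrightarrow> (b, a') \<notin> rels A"
  using card_le_1_eq[OF _ gentle_cards(1)[OF assms(1)], of a a']
    card_le_1_eq[OF _ gentle_cards(2)[OF assms(1)], of a a'] assms by auto

lemma relation_after:
  assumes "b \<in> arcs (quiver A)" "c \<in> arcs (quiver A)" "c' \<in> arcs (quiver A)"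
    "tail (quiver A) c = head (quiver A) b" "tail (quiver A) c' = head (quiver A) b" "c \<noteq> c'"
  shows "(c, b) \<in> rels A \<longleftrightarrow> (c', b) \<notin> rels A"
  using card_le_1_eq[OF _ gentle_cards(3)[OF assms(1)], of c c']
    card_le_1_eq[OF _ gentle_cards(4)[OF assms(1)], of c c'] assms by auto

lemma nzpaths_append:
  "(x, as @ bs) \<in> nzpaths A \<longleftrightarrow> (x, as) \<in> nzpaths A \<and> (awlast x as, bs) \<in> nzpaths A \<and>
     (as \<noteq> [] \<longrightarrow> bs \<noteq> [] \<longrightarrow> (hd bs, last as) \<notin> rels A)"
  unfolding nzpaths_def is_path_def pstart_def pend_def
  by (auto simp: successively_append_iff awlast_append)

lemma trivial_path_nz: "x \<in> verts (quiver A) \<Longrightarrow> (x, []) \<in> nzpaths A"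
  by (simp add: nzpaths_def is_path_def pstart_def pend_def awalk_Nil_iff)

lemma nzpaths_end: "p \<in> nzpaths A \<Longrightarrow> pend A p \<in> verts (quiver A)"
  by (auto simp: nzpaths_def is_path_def intro: awalk_last_in_verts)

lemma nzpaths_hd_last:
  assumes "p \<in> nzpaths A" "nontrivial p"
  shows "hd (snd p) \<in> arcs (quiver A)" "last (snd p) \<in> arcs (quiver A)"
    "tail (quiver A) (hd (snd p)) = pstart p" "head (quiver A) (last (snd p)) = pend A p"
proof -
  obtain x as where p: "p = (x, as)" by (cases p)
  have *: "awalk x as (awlast x as)" "as \<noteq> []"
    using assms unfolding p nzpaths_def is_path_def pstart_def pend_def nontrivial_def by auto
  then show "hd (snd p) \<in> arcs (quiver A)" "last (snd p) \<in> arcs (quiver A)"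
    unfolding p awalk_def by auto
  show "tail (quiver A) (hd (snd p)) = pstart p"
    using * by (cases as) (auto simp: p pstart_def awalk_def)
  show "head (quiver A) (last (snd p)) = pend A p"
    using * by (auto simp: p pend_def awalk_verts_conv)
qed

text \<open>
  The factorizations of a path correspond to the points at which its list of arrows can be cut;
  with this indexing, associativity is an exchange of two summations.
\<close>

lemma amult_splits:
  assumes "(x, as) \<in> nzpaths A"
  shows "amult A u v (x, as) =
    (\<Sum>n\<le>length as. u (awlast x (take n as), drop n as) * v (x, take n as))"
proof -
  let ?D = "{(q, p). q \<in> nzpaths A \<and> p \<in> nzpaths A \<and> pstart q = pend A p \<and> pcomp q p = (x, as)}"
  let ?f = "\<lambda>n. ((awlast x (take n as), drop n as), (x, take n as))"
  have "?D = ?f ` {..length as}"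
  proof (intro equalityI subsetI)
    fix d assume "d \<in> ?D"
    then obtain q p where d: "d = (q, p)" "pstart q = pend A p" "pcomp q p = (x, as)" by auto
    then have "fst p = x" "as = snd p @ snd q" "fst q = awlast x (snd p)"
      by (auto simp: pcomp_def pstart_def pend_def)
    then have "d = ?f (length (snd p))" unfolding d by (cases q, cases p) auto
    moreover have "length (snd p) \<le> length as" using \<open>as = snd p @ snd q\<close> by simp
    ultimately show "d \<in> ?f ` {..length as}" by blast
  next
    fix d assume "d \<in> ?f ` {..length as}"
    then obtain n where d: "d = ?f n" by auto
    have "(x, take n as) \<in> nzpaths A" "(awlast x (take n as), drop n as) \<in> nzpaths A"
      using assms nzpaths_append[of x "take n as" "drop n as"] by auto
    then show "d \<in> ?D" by (auto simp: d pcomp_def pstart_def pend_def)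
  qed
  moreover have "inj_on ?f {..length as}"
  proof (rule inj_onI)
    fix n m assume nm: "n \<in> {..length as}" "m \<in> {..length as}" and "?f n = ?f m"
    then have "length (take n as) = length (take m as)" by simp
    then show "n = m" using nm by simp
  qed
  ultimately show ?thesis
    using assms by (simp add: amult_def sum.reindex)
qed

lemma amult_outside: "p \<notin> nzpaths A \<Longrightarrow> amult A u v p = 0"
  by (simp add: amult_def)

lemma amult_eqI:
  assumes "\<And>x as. (x, as) \<in> nzpaths A \<Longrightarrow> amult A u v (x, as) = amult A u' v' (x, as)"
  shows "amult A u v = amult A u' v'"
proof
  fix p show "amult A u v p = amult A u' v' p"
    using assms by (cases p, cases "p \<in> nzpaths A") (auto simp: amult_outside)
qed

lemma amult_assoc:
  fixes u v w :: "('v, 'a, 'k::field) algelt"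
  shows "amult A (amult A u v) w = amult A u (amult A v w)"
proof (rule amult_eqI)
  fix x as assume nz: "(x, as) \<in> nzpaths A"
  let ?N = "length as"
  define g where "g n m = u (awlast x (take m as), drop m as) *
      v (awlast x (take n as), drop n (take m as)) * w (x, take n as)" for n m
  have 1: "amult A (amult A u v) w (x, as) = (\<Sum>n\<le>?N. \<Sum>m\<le>?N - n. g n (n + m))"
  proof -
    have "amult A u v (awlast x (take n as), drop n as) * w (x, take n as) = (\<Sum>m\<le>?N - n. g n (n + m))"
      if "n \<le> ?N" for n
    proof -
      have nz': "(awlast x (take n as), drop n as) \<in> nzpaths A"
        using nz nzpaths_append[of x "take n as" "drop n as"] by auto
      have t: "take (n + m) as = take n as @ take m (drop n as)" for m by (rule take_add)
      have "awlast x (take (n + m) as) = awlast (awlast x (take n as)) (take m (drop n as))" for m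
        unfolding t by (simp add: awlast_append)
      then show ?thesis
        unfolding amult_splits[OF nz'] sum_distrib_right g_def
        by (intro sum.cong) (auto simp: drop_take add.commute)
    qed
    then show ?thesis unfolding amult_splits[OF nz] by (intro sum.cong) auto
  qed
  have 2: "amult A u (amult A v w) (x, as) = (\<Sum>m\<le>?N. \<Sum>n\<le>m. g n m)"
  proof -
    have "u (awlast x (take m as), drop m as) * amult A v w (x, take m as) = (\<Sum>n\<le>m. g n m)"
      if "m \<le> ?N" for m
    proof -
      have nz': "(x, take m as) \<in> nzpaths A"
        using nz nzpaths_append[of x "take m as" "drop m as"] by auto
      have "min n m = n" if "n \<le> m" for n using that by simp
      then show ?thesis
        unfolding amult_splits[OF nz'] sum_distrib_left g_def using that
        by (intro sum.cong) (auto simp: mult.assoc min.absorb1 min.absorb2 take_take)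
    qed
    then show ?thesis unfolding amult_splits[OF nz] by (intro sum.cong) auto
  qed
  have "(\<Sum>n\<le>?N. \<Sum>m\<le>?N - n. g n (n + m)) = (\<Sum>m\<le>?N. \<Sum>n\<le>m. g n m)"
    unfolding sum.Sigma[OF finite_atMost ballI[OF finite_atMost]]
      sum.Sigma[OF finite_atMost ballI[OF finite_atMost]]
    by (rule sum.reindex_bij_witness[where j = "\<lambda>(n, m). (n + m, n)" and i = "\<lambda>(m, n). (n, m - n)"]) auto
  then show "amult A (amult A u v) w (x, as) = amult A u (amult A v w) (x, as)"
    unfolding 1 2 .
qed

end

text \<open>
  Multiplication by scalars is written as a function of its own, so that it takes part in rewriting
  with the additive structure of function spaces.
\<close>

definition scl :: "'k::field \<Rightarrow> ('v, 'a, 'k) algelt \<Rightarrow> ('v, 'a, 'k) algelt" where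
  "scl c u = (\<lambda>r. c * u r)"

lemma scl_add: "scl c (u + v) = scl c u + scl c v"
  by (auto simp: scl_def fun_eq_iff algebra_simps)
lemma scl_scl [simp]: "scl c (scl d u) = scl (c * d) u"
  by (auto simp: scl_def fun_eq_iff algebra_simps)
lemma scl_1 [simp]: "scl 1 u = u" by (simp add: scl_def)
lemma scl_0 [simp]: "scl 0 u = 0" by (auto simp: scl_def)
lemma scl_zero [simp]: "scl c 0 = 0" by (auto simp: scl_def)
lemma scl_minus: "scl (- c) u = - scl c u" by (auto simp: scl_def)
lemma scl_uminus: "scl c (- u) = - scl c u" by (auto simp: scl_def)
lemma scl_minus_1: "scl (- 1) u = - u" by (auto simp: scl_def)
lemma scl_diff: "scl c (u - v) = scl c u - scl c v"
  by (auto simp: scl_def fun_eq_iff algebra_simps)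
lemma scl_eq_0_iff [simp]: "scl c u = 0 \<longleftrightarrow> c = 0 \<or> u = 0"
  by (auto simp: scl_def fun_eq_iff)

context gentle_algebra begin

lemma amult_add_left: "amult A (u + v) w = amult A u w + amult A v w"
  by (auto simp: amult_def fun_eq_iff sum.distrib algebra_simps case_prod_unfold)
lemma amult_add_right: "amult A u (v + w) = amult A u v + amult A u w"
  by (auto simp: amult_def fun_eq_iff sum.distrib algebra_simps case_prod_unfold)
lemma amult_scl_left: "amult A (scl c u) v = scl c (amult A u v)"
  by (auto simp: amult_def scl_def fun_eq_iff sum_distrib_left algebra_simps case_prod_unfold)
lemma amult_scl_right: "amult A u (scl c v) = scl c (amult A u v)"
  by (auto simp: amult_def scl_def fun_eq_iff sum_distrib_left algebra_simps case_prod_unfold)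
lemma amult_zero [simp]: "amult A u 0 = 0" "amult A 0 u = 0"
  by (auto simp: amult_def fun_eq_iff)
lemma amult_alg: "amult A u v \<in> alg A"
  by (auto simp: alg_def amult_outside)

lemma amult_one: 
  fixes u :: "('v, 'a, 'k::field) algelt"
  assumes "u \<in> alg A"
  shows "amult A (aone A) u = u"
proof
  fix p :: "('v, 'a) qpath" obtain x as where p: "p = (x, as)" by (cases p)
  show "amult A (aone A) u p = u p"
  proof (cases "p \<in> nzpaths A")
    case True
    then have nz: "(x, as) \<in> nzpaths A" by (simp add: p)
    have "aone A (awlast x (take n as), drop n as) = (if n = length as then 1 else (0::'k))" if "n \<le> length as" for n
      using that nz nzpaths_append[of x "take n as" "drop n as"] by (auto simp: aone_def nontrivial_def)
    then have "amult A (aone A) u (x, as) = (\<Sum>n\<le>length as. if n = length as then u (x, as) else 0)"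
      unfolding amult_splits[OF nz] by (intro sum.cong) auto
    then show ?thesis by (simp add: p)
  next
    case False
    then have "u p = 0" using assms unfolding alg_def by blast
    with False show ?thesis by (simp add: amult_outside)
  qed
qed

text \<open>
  The map between projectives induced by a path, for scalar \<open>1\<close>.
\<close>

definition rmul :: "('v, 'a) qpath \<Rightarrow> ('v, 'a, 'k::field) algelt \<Rightarrow> ('v, 'a, 'k) algelt" where
  "rmul p u = amult A u (path_elt p)"

lemma pmap_eq: "pmap A c p u = scl c (rmul p u)"
  by (simp add: pmap_def scl_def rmul_def)

lemma path_elt_mult_support:
  assumes "amult A u (path_elt p) r \<noteq> 0"
  shows "\<exists>bs. r = (fst p, snd p @ bs) \<and> r \<in> nzpaths A"
proof -
  obtain x as where r: "r = (x, as)" by (cases r)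
  have nz: "(x, as) \<in> nzpaths A" using assms amult_outside r by metis
  obtain n where "n \<le> length as" "path_elt p (x, take n as) \<noteq> (0::'b)"
    using assms unfolding r amult_splits[OF nz] by (metis (mono_tags, lifting) atMost_iff mult_eq_0_iff sum.not_neutral_contains_not_neutral)
  then have "p = (x, take n as)" by (simp add: path_elt_def split: if_splits)
  then show ?thesis using nz by (intro exI[of _ "drop n as"]) (auto simp: r)
qed

lemma rmul_proj: "rmul p u \<in> proj A (pstart p)"
  unfolding proj_def rmul_def using amult_alg path_elt_mult_support[of u p]
  by (fastforce simp: pstart_def)

lemma path_elt_mult:
  assumes "p \<in> nzpaths A" "q \<in> nzpaths A" "pstart q = pend A p"
  shows "amult A (path_elt q) (path_elt p) = (if pcomp q p \<in> nzpaths A then path_elt (pcomp q p) else (0 :: ('v, 'a, 'k::field) algelt))"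
proof
  fix r :: "('v, 'a) qpath" obtain x as where r: "r = (x, as)" by (cases r)
  obtain y bs where p: "p = (y, bs)" by (cases p)
  obtain z cs where q: "q = (z, cs)" by (cases q)
  have z: "z = awlast y bs" using assms by (simp add: p q pend_def pstart_def)
  have pc: "pcomp q p = (y, bs @ cs)" by (simp add: pcomp_def p q)
  show "amult A (path_elt q) (path_elt p) r = (if pcomp q p \<in> nzpaths A then path_elt (pcomp q p) else (0 :: ('v, 'a, 'k) algelt)) r"
  proof (cases "r \<in> nzpaths A")
    case False
    then show ?thesis by (auto simp: amult_outside path_elt_def)
  next
    case True
    have e: "path_elt q (awlast x (take n as), drop n as) * path_elt p (x, take n as) =
        (if r = pcomp q p \<and> n = length bs then 1 else (0::'k))" if "n \<le> length as" for n
    proof (cases "(x, take n as) = p \<and> (awlast x (take n as), drop n as) = q")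
      case True
      then have "x = y" "take n as = bs" "drop n as = cs" by (auto simp: p q)
      then have "as = bs @ cs" "n = length bs" using that by (metis append_take_drop_id, auto)
      then show ?thesis using True \<open>x = y\<close> by (simp add: path_elt_def r pc)
    next
      case False
      have "\<not> (r = pcomp q p \<and> n = length bs)"
      proof
        assume "r = pcomp q p \<and> n = length bs"
        then have "x = y" "as = bs @ cs" "n = length bs" by (auto simp: r pc)
        with False show False by (simp add: p q z)
      qed
      then show ?thesis using False by (auto simp: path_elt_def)
    qed
    have nz: "(x, as) \<in> nzpaths A" using True r by simp
    have "amult A (path_elt q) (path_elt p) r = (\<Sum>n\<le>length as. if r = pcomp q p \<and> n = length bs then 1 else (0::'k))"
      unfolding r amult_splits[OF nz] using e[unfolded r] by (intro sum.cong) auto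
    also have "\<dots> = (if r = pcomp q p then 1 else 0)"
      by (auto simp: r pc)
    finally show ?thesis using True by (auto simp: path_elt_def)
  qed
qed

text \<open>
  The two ways in which a composition of maps given by paths can behave: the paths compose to a
  nonzero path, or they meet in a relation.
\<close>

lemma rmul_rmul:
  fixes u :: "('v, 'a, 'k::field) algelt"
  assumes "pcomp p h \<in> nzpaths A" "pstart p = pend A h"
  shows "rmul h (rmul p u) = rmul (pcomp p h) u"
proof -
  have "h \<in> nzpaths A" "p \<in> nzpaths A"
    using assms nzpaths_append[of "fst h" "snd h" "snd p"]
    by (cases p, cases h, auto simp: pcomp_def pend_def pstart_def)+
  then show ?thesis
    using assms path_elt_mult[of h p, where 'k = 'k] by (simp add: rmul_def amult_assoc)
qed

lemma rmul_rmul_0: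
  fixes u :: "('v, 'a, 'k::field) algelt"
  assumes "p \<in> nzpaths A" "h \<in> nzpaths A" "pstart p = pend A h" "nontrivial p" "nontrivial h"
    "(hd (snd p), last (snd h)) \<in> rels A"
  shows "rmul h (rmul p u) = 0"
proof -
  have "pcomp p h \<notin> nzpaths A"
    using assms nzpaths_append[of "fst h" "snd h" "snd p"] by (auto simp: pcomp_def nontrivial_def)
  then show ?thesis
    using assms path_elt_mult[of h p, where 'k = 'k] by (simp add: rmul_def amult_assoc)
qed

text \<open>
  \<open>\<Lambda>\<close>-linearity for the operators on coefficient functions from which all maps of complexes below
  are built. It is imposed on all functions, so no membership in a carrier has to be tracked when
  operators are moved past each other.
\<close>

definition lin :: "(('v, 'a, 'k::field) algelt \<Rightarrow> ('v, 'a, 'k) algelt) \<Rightarrow> bool" where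
  "lin \<phi> \<longleftrightarrow> (\<forall>u v. \<phi> (u + v) = \<phi> u + \<phi> v) \<and> (\<forall>c u. \<phi> (scl c u) = scl c (\<phi> u)) \<and>
     (\<forall>a u. \<phi> (amult A a u) = amult A a (\<phi> u))"

lemma lin_add: "lin \<phi> \<Longrightarrow> \<phi> (u + v) = \<phi> u + \<phi> v" by (simp add: lin_def)
lemma lin_scl: "lin \<phi> \<Longrightarrow> \<phi> (scl c u) = scl c (\<phi> u)" by (simp add: lin_def)
lemma lin_amult: "lin \<phi> \<Longrightarrow> \<phi> (amult A a u) = amult A a (\<phi> u)" by (simp add: lin_def)
lemma lin_zero: "lin \<phi> \<Longrightarrow> \<phi> 0 = 0" using lin_scl[of \<phi> 0 0] by simp
lemma lin_minus: "lin \<phi> \<Longrightarrow> \<phi> (- u) = - \<phi> u" using lin_scl[of \<phi> "- 1" u] by (simp add: scl_minus_1)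
lemma lin_diff: "lin \<phi> \<Longrightarrow> \<phi> (u - v) = \<phi> u - \<phi> v" using lin_add[of \<phi> u "- v"] lin_minus[of \<phi> v] by simp
lemma lin_rmul: "lin (rmul p)"
  by (simp add: lin_def rmul_def amult_add_left amult_scl_left amult_assoc)
lemma lin_id: "lin (\<lambda>u. u)" by (simp add: lin_def)
lemma lin_0: "lin (\<lambda>u. 0)" by (simp add: lin_def)

end

section \<open>Chain isomorphisms and mapping cones\<close>

text \<open>
  All isomorphisms in the proof are bijective cochain maps, which is easier to handle than
  isomorphism in the derived category: they can be inverted, and they carry over
  finite generation and bounded cohomology.
\<close>

definition chain_iso :: "('v, 'a) bound_quiver \<Rightarrow>
    (('v, 'a, 'k::field) algelt, 'm::ab_group_add) cplx \<Rightarrow>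
    (('v, 'a, 'k) algelt, 'n::ab_group_add) cplx \<Rightarrow> (int \<Rightarrow> 'm \<Rightarrow> 'n) \<Rightarrow> bool" where
  "chain_iso A C D \<phi> \<longleftrightarrow> chain_map A C D \<phi> \<and>
     (\<forall>i. bij_betw (\<phi> i) (mcar (cobj C i)) (mcar (cobj D i)))"

lemma is_moduleD:
  assumes "is_module A M"
  shows "0 \<in> mcar M" "\<And>x y. x \<in> mcar M \<Longrightarrow> y \<in> mcar M \<Longrightarrow> x + y \<in> mcar M"
    "\<And>x. x \<in> mcar M \<Longrightarrow> - x \<in> mcar M"
    "\<And>a x. a \<in> alg A \<Longrightarrow> x \<in> mcar M \<Longrightarrow> mact M a x \<in> mcar M"
  using assms by (auto simp: is_module_def)

lemma mod_homD:
  assumes "mod_hom A M N h"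
  shows "\<And>x. x \<in> mcar M \<Longrightarrow> h x \<in> mcar N"
    "\<And>x y. x \<in> mcar M \<Longrightarrow> y \<in> mcar M \<Longrightarrow> h (x + y) = h x + h y"
    "\<And>a x. a \<in> alg A \<Longrightarrow> x \<in> mcar M \<Longrightarrow> h (mact M a x) = mact N a (h x)"
  using assms by (auto simp: mod_hom_def)

lemma mod_hom_0:
  assumes "is_module A M" "mod_hom A M N h"
  shows "h 0 = 0"
  using mod_homD(2)[OF assms(2), of 0 0] is_moduleD(1)[OF assms(1)] by simp

lemma mod_hom_minus:
  assumes "is_module A M" "mod_hom A M N h" "x \<in> mcar M"
  shows "h (- x) = - h x"
  using mod_homD(2)[OF assms(2), of x "- x"] is_moduleD(3)[OF assms(1,3)] assms(3)
    mod_hom_0[OF assms(1,2)] by (simp add: eq_neg_iff_add_eq_0 add.commute)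

lemma is_complexD:
  assumes "is_complex A C"
  shows "is_module A (cobj C i)" "mod_hom A (cobj C i) (cobj C (i + 1)) (cdif C i)"
    "x \<in> mcar (cobj C i) \<Longrightarrow> cdif C (i + 1) (cdif C i x) = 0"
  using assms by (auto simp: is_complex_def)

lemma chain_isoD:
  assumes "chain_iso A C D \<phi>"
  shows "mod_hom A (cobj C i) (cobj D i) (\<phi> i)"
    "x \<in> mcar (cobj C i) \<Longrightarrow> \<phi> (i + 1) (cdif C i x) = cdif D i (\<phi> i x)"
    "inj_on (\<phi> i) (mcar (cobj C i))" "\<phi> i ` mcar (cobj C i) = mcar (cobj D i)"
  using assms by (auto simp: chain_iso_def chain_map_def bij_betw_def)

lemma chain_iso_trans:
  assumes "chain_iso A C D \<phi>" "chain_iso A D E \<psi>"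
  shows "chain_iso A C E (\<lambda>i x. \<psi> i (\<phi> i x))"
proof -
  have "bij_betw (\<lambda>x. \<psi> i (\<phi> i x)) (mcar (cobj C i)) (mcar (cobj E i))" for i
    using bij_betw_trans[of "\<phi> i" "mcar (cobj C i)" "mcar (cobj D i)" "\<psi> i"] assms
    by (simp add: chain_iso_def comp_def)
  then show ?thesis
    using assms by (auto simp: chain_iso_def chain_map_def mod_hom_def)
qed

lemma chain_iso_sym:
  fixes C :: "(('v, 'a, 'k::field) algelt, 'm::ab_group_add) cplx"
  assumes C: "is_complex A C" and \<phi>: "chain_iso A C D \<phi>"
  shows "chain_iso A D C (\<lambda>i. the_inv_into (mcar (cobj C i)) (\<phi> i))"
proof -
  let ?\<psi> = "\<lambda>i. the_inv_into (mcar (cobj C i)) (\<phi> i)"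
  note inj = chain_isoD(3)[OF \<phi>] and surj = chain_isoD(4)[OF \<phi>]
  have mem: "?\<psi> i y \<in> mcar (cobj C i)" if "y \<in> mcar (cobj D i)" for i y
    using that surj[of i] by (intro the_inv_into_into[OF inj]) auto
  have eq: "?\<psi> i y = x" if "x \<in> mcar (cobj C i)" "\<phi> i x = y" for i x y
    using that by (intro the_inv_into_f_eq[OF inj]) auto
  have pre: "\<exists>x \<in> mcar (cobj C i). \<phi> i x = y" if "y \<in> mcar (cobj D i)" for i y
    using that unfolding surj[of i, symmetric] by auto
  have "mod_hom A (cobj D i) (cobj C i) (?\<psi> i)" for i
    unfolding mod_hom_def
  proof (intro conjI ballI)
    fix y assume y: "y \<in> mcar (cobj D i)"
    then show "?\<psi> i y \<in> mcar (cobj C i)" by (rule mem)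
    obtain x where x: "x \<in> mcar (cobj C i)" "\<phi> i x = y" using pre[OF y] by auto
    { fix y' assume "y' \<in> mcar (cobj D i)"
      then obtain x' where x': "x' \<in> mcar (cobj C i)" "\<phi> i x' = y'" using pre by auto
      have "?\<psi> i (y + y') = x + x'"
        using x x' mod_homD(2)[OF chain_isoD(1)[OF \<phi>]] is_moduleD(2)[OF is_complexD(1)[OF C]]
        by (intro eq) auto
      then show "?\<psi> i (y + y') = ?\<psi> i y + ?\<psi> i y'" using eq x x' by simp }
    fix a :: "('v, 'a, 'k) algelt" assume a: "a \<in> alg A"
    have "?\<psi> i (mact (cobj D i) a y) = mact (cobj C i) a x"
      using x a mod_homD(3)[OF chain_isoD(1)[OF \<phi>]] is_moduleD(4)[OF is_complexD(1)[OF C]]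
      by (intro eq) auto
    then show "?\<psi> i (mact (cobj D i) a y) = mact (cobj C i) a (?\<psi> i y)" using eq x by simp
  qed
  moreover have "?\<psi> (i + 1) (cdif D i y) = cdif C i (?\<psi> i y)" if y: "y \<in> mcar (cobj D i)" for i y
  proof -
    obtain x where x: "x \<in> mcar (cobj C i)" "\<phi> i x = y" using pre[OF y] by auto
    have "?\<psi> (i + 1) (cdif D i y) = cdif C i x"
      using x chain_isoD(2)[OF \<phi>] mod_homD(1)[OF is_complexD(2)[OF C]] by (intro eq) auto
    then show ?thesis using eq x by simp
  qed
  moreover have "bij_betw (?\<psi> i) (mcar (cobj D i)) (mcar (cobj C i))" for i
    using \<phi> by (intro bij_betw_the_inv_into) (simp add: chain_iso_def)
  ultimately show ?thesis by (simp add: chain_iso_def chain_map_def)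
qed

lemma mod_hom_sum:
  assumes "is_module A M" "mod_hom A M N h" "finite G" "\<And>g. g \<in> G \<Longrightarrow> x g \<in> mcar M"
  shows "h (\<Sum>g\<in>G. x g) = (\<Sum>g\<in>G. h (x g)) \<and> (\<Sum>g\<in>G. x g) \<in> mcar M"
  using assms(3,4)
proof (induction G rule: finite_induct)
  case empty
  then show ?case using mod_hom_0[OF assms(1,2)] is_moduleD(1)[OF assms(1)] by simp
next
  case (insert g G)
  then show ?case using mod_homD(2)[OF assms(2)] is_moduleD(2)[OF assms(1)] by simp
qed

lemma chain_iso_fin_gen:
  assumes C: "is_complex A C" and \<phi>: "chain_iso A C D \<phi>" and G: "fin_gen A (cobj C i)"
  shows "fin_gen A (cobj D i)"
proof -
  obtain G where G: "finite G" "G \<subseteq> mcar (cobj C i)"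
    "\<And>x. x \<in> mcar (cobj C i) \<Longrightarrow> \<exists>c. (\<forall>g\<in>G. c g \<in> alg A) \<and> x = (\<Sum>g\<in>G. mact (cobj C i) (c g) g)"
    using G unfolding fin_gen_def by blast
  have inj: "inj_on (\<phi> i) G" using chain_isoD(3)[OF \<phi>] G(2) inj_on_subset by blast
  show ?thesis unfolding fin_gen_def
  proof (intro exI[of _ "\<phi> i ` G"] conjI ballI)
    show "\<phi> i ` G \<subseteq> mcar (cobj D i)" using chain_isoD(4)[OF \<phi>] G(2) by blast
    fix y assume "y \<in> mcar (cobj D i)"
    then obtain x where x: "x \<in> mcar (cobj C i)" "y = \<phi> i x" using chain_isoD(4)[OF \<phi>] by blast
    obtain c where c: "\<forall>g\<in>G. c g \<in> alg A" "x = (\<Sum>g\<in>G. mact (cobj C i) (c g) g)"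
      using G(3)[OF x(1)] by blast
    have mem: "\<And>g. g \<in> G \<Longrightarrow> mact (cobj C i) (c g) g \<in> mcar (cobj C i)"
      using c(1) G(2) is_moduleD(4)[OF is_complexD(1)[OF C]] by blast
    have "y = (\<Sum>g\<in>G. \<phi> i (mact (cobj C i) (c g) g))"
      unfolding x(2) c(2) using mod_hom_sum[OF is_complexD(1)[OF C] chain_isoD(1)[OF \<phi>] G(1) mem] by simp
    also have "\<dots> = (\<Sum>g\<in>G. mact (cobj D i) (c g) (\<phi> i g))"
      using c(1) G(2) mod_homD(3)[OF chain_isoD(1)[OF \<phi>]] by (intro sum.cong) auto
    also have "\<dots> = (\<Sum>g\<in>\<phi> i ` G. mact (cobj D i) (c (the_inv_into G (\<phi> i) g)) g)"
      by (simp add: sum.reindex[OF inj] the_inv_into_f_f[OF inj])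
    finally have "y = (\<Sum>g\<in>\<phi> i ` G. mact (cobj D i) (c (the_inv_into G (\<phi> i) g)) g)" .
    then show "\<exists>c. (\<forall>g\<in>\<phi> i ` G. c g \<in> alg A) \<and> y = (\<Sum>g\<in>\<phi> i ` G. mact (cobj D i) (c g) g)"
      using c(1) by (intro exI[of _ "\<lambda>g. c (the_inv_into G (\<phi> i) g)"]) (auto simp: the_inv_into_f_f[OF inj])
  qed (use G in auto)
qed

lemma chain_iso_cocycles:
  assumes C: "is_complex A C" and D: "is_complex A D" and \<phi>: "chain_iso A C D \<phi>"
  shows "\<phi> i ` cocycles C i = cocycles D i"
proof -
  have "cdif D i (\<phi> i x) = 0 \<longleftrightarrow> cdif C i x = 0" if x: "x \<in> mcar (cobj C i)" for x
  proof -
    have "cdif D i (\<phi> i x) = 0 \<longleftrightarrow> \<phi> (i + 1) (cdif C i x) = \<phi> (i + 1) 0"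
      using chain_isoD(2)[OF \<phi> x] mod_hom_0[OF is_complexD(1)[OF C] chain_isoD(1)[OF \<phi>]] by simp
    also have "\<dots> \<longleftrightarrow> cdif C i x = 0"
      using mod_homD(1)[OF is_complexD(2)[OF C] x] is_moduleD(1)[OF is_complexD(1)[OF C]]
      by (intro inj_on_eq_iff[OF chain_isoD(3)[OF \<phi>]]) auto
    finally show ?thesis .
  qed
  then show ?thesis unfolding cocycles_def chain_isoD(4)[OF \<phi>, of i, symmetric] by auto
qed

lemma chain_iso_coboundaries:
  assumes \<phi>: "chain_iso A C D \<phi>"
  shows "\<phi> i ` coboundaries C i = coboundaries D i"
proof -
  have "\<phi> i ` coboundaries C i = (\<lambda>x. \<phi> i (cdif C (i - 1) x)) ` mcar (cobj C (i - 1))"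
    by (simp add: coboundaries_def image_image)
  also have "\<dots> = (\<lambda>x. cdif D (i - 1) (\<phi> (i - 1) x)) ` mcar (cobj C (i - 1))"
    using chain_isoD(2)[OF \<phi>, of _ "i - 1"] by (intro image_cong) auto
  also have "\<dots> = coboundaries D i"
    unfolding coboundaries_def chain_isoD(4)[OF \<phi>, of "i - 1", symmetric] by auto
  finally show ?thesis .
qed

lemma chain_iso_bounded_cohomology:
  assumes "is_complex A C" "is_complex A D" "chain_iso A C D \<phi>" "bounded_cohomology C"
  shows "bounded_cohomology D"
  using assms(4) chain_iso_cocycles[OF assms(1-3)] chain_iso_coboundaries[OF assms(3)]
  unfolding bounded_cohomology_def by (metis image_mono)

lemma chain_iso_in_Db:
  assumes "is_complex A D" "chain_iso A C D \<phi>" "in_Db A C"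
  shows "in_Db A D"
  using assms chain_iso_fin_gen chain_iso_bounded_cohomology unfolding in_Db_def by blast

lemma coboundaries_subset:
  assumes "is_complex A C" shows "coboundaries C i \<subseteq> cocycles C i"
  using is_complexD(3)[OF assms, of _ "i - 1"] mod_homD(1)[OF is_complexD(2)[OF assms], of _ "i - 1"]
  by (auto simp: coboundaries_def cocycles_def)

lemma chain_iso_quasi_iso:
  assumes C: "is_complex A C" and D: "is_complex A D" and \<phi>: "chain_iso A C D \<phi>"
  shows "quasi_iso A C D \<phi>"
  unfolding quasi_iso_def
proof (intro conjI allI ballI impI)
  show "chain_map A C D \<phi>" using \<phi> by (simp add: chain_iso_def)
  fix i x assume x: "x \<in> cocycles C i" "\<phi> i x \<in> coboundaries D i"
  then obtain z where z: "z \<in> coboundaries C i" "\<phi> i x = \<phi> i z"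
    using chain_iso_coboundaries[OF \<phi>, of i] by auto
  then have "x = z"
    using inj_onD[OF chain_isoD(3)[OF \<phi>] z(2)] x coboundaries_subset[OF C, of i] by (auto simp: cocycles_def)
  then show "x \<in> coboundaries C i" using z by simp
next
  fix i y assume "y \<in> cocycles D i"
  then obtain x where x: "x \<in> cocycles C i" "y = \<phi> i x"
    using chain_iso_cocycles[OF C D \<phi>, of i] by auto
  have "0 \<in> coboundaries D i"
    unfolding coboundaries_def
    using mod_hom_0[OF is_complexD(1)[OF D] is_complexD(2)[OF D], of "i - 1"]
      is_moduleD(1)[OF is_complexD(1)[OF D], of "i - 1"] by (auto simp: image_iff intro!: bexI[of _ 0])
  then show "\<exists>x\<in>cocycles C i. y - \<phi> i x \<in> coboundaries D i"
    using x by (intro bexI[of _ x]) simp_all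
qed

lemma chain_iso_id: "chain_iso A C C (\<lambda>i x. x)"
  by (simp add: chain_iso_def chain_map_def mod_hom_def bij_betw_def inj_on_def)

lemma chain_iso_Db_iso:
  assumes "in_Db A C" "in_Db A D" "chain_iso A C D \<phi>"
  shows "Db_iso A C D"
proof -
  have "is_complex A C" "is_complex A D" using assms by (auto simp: in_Db_def)
  then show ?thesis
    unfolding Db_iso_def using assms chain_iso_quasi_iso[OF _ _ chain_iso_id] chain_iso_quasi_iso by blast
qed

lemma cone_simps [simp]:
  "mcar (cobj (cone C D f) i) = mcar (cobj C (i + 1)) \<times> mcar (cobj D i)"
  "mact (cobj (cone C D f) i) a (x, y) = (mact (cobj C (i + 1)) a x, mact (cobj D i) a y)"
  "cdif (cone C D f) i (x, y) = (- cdif C (i + 1) x, f (i + 1) x + cdif D i y)"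
  by (simp_all add: cone_def)

lemma cone_is_complex:
  assumes C: "is_complex A C" and D: "is_complex A D" and f: "chain_map A C D f"
  shows "is_complex A (cone C D f)"
proof -
  have fh: "mod_hom A (cobj C i) (cobj D i) (f i)" for i using f by (simp add: chain_map_def)
  have fd: "x \<in> mcar (cobj C i) \<Longrightarrow> f (i + 1) (cdif C i x) = cdif D i (f i x)" for i x
    using f by (simp add: chain_map_def)
  note mC = is_complexD(1)[OF C] and mD = is_complexD(1)[OF D]
  note dC = is_complexD(2)[OF C] and dD = is_complexD(2)[OF D]
  have "is_module A (cobj (cone C D f) i)" for i
    using mC[of "i + 1"] mD[of i] unfolding is_module_def
    by (auto simp: zero_prod_def)
  moreover have "mod_hom A (cobj (cone C D f) i) (cobj (cone C D f) (i + 1)) (cdif (cone C D f) i)" for i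
  proof -
    have "mact (cobj C j) a (- x) = - mact (cobj C j) a x"
      if "a \<in> alg A" "x \<in> mcar (cobj C j)" for j a x
    proof -
      have "mact (cobj C j) a (x + - x) = mact (cobj C j) a x + mact (cobj C j) a (- x)"
        "mact (cobj C j) a (0 + 0) = mact (cobj C j) a 0 + mact (cobj C j) a 0"
        using that mC[of j] unfolding is_module_def by blast+
      then show ?thesis by (simp add: eq_neg_iff_add_eq_0 add.commute)
    qed
    moreover have "mact (cobj D j) a (x + y) = mact (cobj D j) a x + mact (cobj D j) a y"
      if "a \<in> alg A" "x \<in> mcar (cobj D j)" "y \<in> mcar (cobj D j)" for j a x y
      using that mD[of j] unfolding is_module_def by blast
    ultimately show ?thesis
      unfolding mod_hom_def
      using mod_homD[OF dC[of "i + 1"]] mod_homD[OF dD[of i]] mod_homD[OF fh[of "i + 1"]]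
        is_moduleD[OF mC[of "i + 1 + 1"]] is_moduleD[OF mD[of "i + 1"]]
      by (auto simp: algebra_simps)
  qed
  moreover have "cdif (cone C D f) (i + 1) (cdif (cone C D f) i x) = 0"
    if "x \<in> mcar (cobj (cone C D f) i)" for i x
  proof -
    obtain a b where x: "x = (a, b)" "a \<in> mcar (cobj C (i + 1))" "b \<in> mcar (cobj D i)"
      using \<open>x \<in> _\<close> by auto
    have da: "cdif C (i + 1) a \<in> mcar (cobj C (i + 1 + 1))" using mod_homD(1)[OF dC x(2)] .
    have fa: "f (i + 1) a \<in> mcar (cobj D (i + 1))" using mod_homD(1)[OF fh x(2)] .
    have db: "cdif D i b \<in> mcar (cobj D (i + 1))" using mod_homD(1)[OF dD x(3)] .
    show ?thesis
      using is_complexD(3)[OF C x(2)] is_complexD(3)[OF D x(3)] fd[OF x(2)]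
        mod_hom_minus[OF mC dC da] mod_hom_minus[OF mC fh da] mod_homD(2)[OF dD fa db]
      by (simp add: x(1) zero_prod_def)
  qed
  ultimately show ?thesis unfolding is_complex_def by blast
qed

text \<open>
  A cocycle \<open>(x, y)\<close> of the cone has \<open>x = d x'\<close>; then \<open>y + f x'\<close> is a cocycle of the target,
  hence a coboundary. This is the relevant piece of the long exact sequence.
\<close>

lemma cone_bounded_cohomology:
  assumes C: "is_complex A C" and D: "is_complex A D" and f: "chain_map A C D f"
    and "bounded_cohomology C" "bounded_cohomology D"
  shows "bounded_cohomology (cone C D f)"
proof -
  obtain n m where n: "\<And>i. \<bar>i\<bar> > n \<Longrightarrow> cocycles C i \<subseteq> coboundaries C i"
    and m: "\<And>i. \<bar>i\<bar> > m \<Longrightarrow> cocycles D i \<subseteq> coboundaries D i"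
    using assms(4,5) unfolding bounded_cohomology_def by blast
  have fh: "mod_hom A (cobj C i) (cobj D i) (f i)" for i using f by (simp add: chain_map_def)
  have fd: "x \<in> mcar (cobj C i) \<Longrightarrow> f (i + 1) (cdif C i x) = cdif D i (f i x)" for i x
    using f by (simp add: chain_map_def)
  note mC = is_complexD(1)[OF C] and mD = is_complexD(1)[OF D]
  note dC = is_complexD(2)[OF C] and dD = is_complexD(2)[OF D]
  have "cocycles (cone C D f) i \<subseteq> coboundaries (cone C D f) i" if i: "\<bar>i\<bar> > \<bar>n\<bar> + \<bar>m\<bar> + 1" for i
  proof
    fix z assume z: "z \<in> cocycles (cone C D f) i"
    then obtain x y where xy: "z = (x, y)" "x \<in> mcar (cobj C (i + 1))" "y \<in> mcar (cobj D i)"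
      "cdif C (i + 1) x = 0" "f (i + 1) x + cdif D i y = 0"
      by (auto simp: cocycles_def zero_prod_def)
    have "x \<in> cocycles C (i + 1)" "\<bar>i + 1\<bar> > n" using xy i by (auto simp: cocycles_def)
    then have "x \<in> coboundaries C (i + 1)" using n by blast
    then obtain x' where x': "x' \<in> mcar (cobj C i)" "x = cdif C i x'"
      by (auto simp: coboundaries_def)
    have fx': "f i x' \<in> mcar (cobj D i)" using mod_homD(1)[OF fh x'(1)] .
    have "y + f i x' \<in> cocycles D i"
      using xy x' fx' mod_homD(2)[OF dD xy(3) fx'] fd[OF x'(1)] is_moduleD(2)[OF mD]
      by (auto simp: cocycles_def algebra_simps)
    then have "y + f i x' \<in> coboundaries D i" using subsetD[OF m, of i] i by auto
    then obtain y' where y': "y' \<in> mcar (cobj D (i - 1))" "y + f i x' = cdif D (i - 1) y'"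
      by (auto simp: coboundaries_def)
    have mx': "- x' \<in> mcar (cobj C i)" using is_moduleD(3)[OF mC x'(1)] .
    have "z = cdif (cone C D f) (i - 1) (- x', y')"
      using x' y' xy mod_hom_minus[OF mC dC x'(1)] mod_hom_minus[OF mC fh x'(1)]
      by (simp add: algebra_simps)
    then show "z \<in> coboundaries (cone C D f) i"
      unfolding coboundaries_def using y' mx' by (auto simp: image_iff intro!: bexI[of _ "(- x', y')"])
  qed
  then show ?thesis unfolding bounded_cohomology_def by blast
qed

text \<open>
  If \<open>f - g = d h + h d\<close>, then \<open>(x, y) \<mapsto> (x, y + h x)\<close> identifies the cones, with inverse
  \<open>(x, y) \<mapsto> (x, y - h x)\<close>.
\<close>

lemma cone_homotopic:
  assumes C: "is_complex A C" and D: "is_complex A D" and fg: "homotopic A C D f g"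
  shows "\<exists>\<phi>. chain_iso A (cone C D f) (cone C D g) \<phi>"
proof -
  obtain h where hh: "\<And>i. mod_hom A (cobj C i) (cobj D (i - 1)) (h i)"
    and h: "\<And>i x. x \<in> mcar (cobj C i) \<Longrightarrow>
        f i x - g i x = cdif D (i - 1) (h i x) + h (i + 1) (cdif C i x)"
    using fg unfolding homotopic_def by blast
  note mC = is_complexD(1)[OF C] and mD = is_complexD(1)[OF D]
  note dC = is_complexD(2)[OF C] and dD = is_complexD(2)[OF D]
  have hm: "h (i + 1) x \<in> mcar (cobj D i)" if "x \<in> mcar (cobj C (i + 1))" for i x
    using mod_homD(1)[OF hh that] by simp
  define \<phi> where "\<phi> i = (\<lambda>(x, y). (x, y + h (i + 1) x))" for i
  have "mod_hom A (cobj (cone C D f) i) (cobj (cone C D g) i) (\<phi> i)" for i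
  proof -
    have 1: "y + y' + h (i + 1) (x + x') = y + h (i + 1) x + (y' + h (i + 1) x')"
      if "x \<in> mcar (cobj C (i + 1))" "x' \<in> mcar (cobj C (i + 1))" for x x' y y'
      using mod_homD(2)[OF hh that] by simp
    have 2: "y + h (i + 1) x \<in> mcar (cobj D i)" if "x \<in> mcar (cobj C (i + 1))" "y \<in> mcar (cobj D i)" for x y
      using that hm is_moduleD(2)[OF mD] by blast
    have 3: "mact (cobj D i) a y + h (i + 1) (mact (cobj C (i + 1)) a x) = mact (cobj D i) a (y + h (i + 1) x)"
      if "x \<in> mcar (cobj C (i + 1))" "y \<in> mcar (cobj D i)" "a \<in> alg A" for x y a
    proof -
      have "mact (cobj D i) a (y + h (i + 1) x) = mact (cobj D i) a y + mact (cobj D i) a (h (i + 1) x)"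
        using mD[of i] that(3,2) hm[OF that(1)] unfolding is_module_def by blast
      then show ?thesis using mod_homD(3)[OF hh that(3,1)] by simp
    qed
    show ?thesis
      unfolding mod_hom_def using 1 2 3 by (auto simp: \<phi>_def)
  qed
  moreover have "\<phi> (i + 1) (cdif (cone C D f) i z) = cdif (cone C D g) i (\<phi> i z)"
    if "z \<in> mcar (cobj (cone C D f) i)" for i z
  proof -
    obtain x y where z: "z = (x, y)" "x \<in> mcar (cobj C (i + 1))" "y \<in> mcar (cobj D i)" using \<open>z \<in> _\<close> by auto
    have "cdif C (i + 1) x \<in> mcar (cobj C (i + 1 + 1))" using mod_homD(1)[OF dC z(2)] .
    then show ?thesis
      using h[OF z(2)] mod_homD(2)[OF dD z(3) hm[OF z(2)]] mod_hom_minus[OF mC hh]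
      by (simp add: \<phi>_def z(1) algebra_simps)
  qed
  moreover have "bij_betw (\<phi> i) (mcar (cobj (cone C D f) i)) (mcar (cobj (cone C D g) i))" for i
  proof (rule bij_betw_byWitness[where f' = "\<lambda>(x, y). (x, y - h (i + 1) x)"])
    show "\<phi> i ` mcar (cobj (cone C D f) i) \<subseteq> mcar (cobj (cone C D g) i)"
      using hm is_moduleD(2)[OF mD] by (auto simp: \<phi>_def)
    have "y - h (i + 1) x \<in> mcar (cobj D i)" if "x \<in> mcar (cobj C (i + 1))" "y \<in> mcar (cobj D i)" for x y
      using is_moduleD(2)[OF mD that(2) is_moduleD(3)[OF mD hm[OF that(1)]]] by simp
    then show "(\<lambda>(x, y). (x, y - h (i + 1) x)) ` mcar (cobj (cone C D g) i) \<subseteq> mcar (cobj (cone C D f) i)"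
      by auto
  qed (auto simp: \<phi>_def)
  ultimately show ?thesis unfolding chain_iso_def chain_map_def by blast
qed

lemma homotopic_chain_map:
  assumes C: "is_complex A C" and D: "is_complex A D" and f: "chain_map A C D f"
    and fg: "homotopic A C D f g" and x: "x \<in> mcar (cobj C i)"
  shows "g (i + 1) (cdif C i x) = cdif D i (g i x)"
proof -
  obtain h where hh: "\<And>i. mod_hom A (cobj C i) (cobj D (i - 1)) (h i)"
    and h: "\<And>i x. x \<in> mcar (cobj C i) \<Longrightarrow>
        f i x - g i x = cdif D (i - 1) (h i x) + h (i + 1) (cdif C i x)"
    using fg unfolding homotopic_def by blast
  have fh: "mod_hom A (cobj C i) (cobj D i) (f i)" for i using f by (simp add: chain_map_def)
  note mC = is_complexD(1)[OF C] and mD = is_complexD(1)[OF D]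
  note dC = is_complexD(2)[OF C] and dD = is_complexD(2)[OF D]
  have dx: "cdif C i x \<in> mcar (cobj C (i + 1))" using mod_homD(1)[OF dC x] .
  have hx: "h i x \<in> mcar (cobj D (i - 1))" using mod_homD(1)[OF hh x] .
  have hdx: "h (i + 1) (cdif C i x) \<in> mcar (cobj D i)" using mod_homD(1)[OF hh dx] by simp
  have dhx: "cdif D (i - 1) (h i x) \<in> mcar (cobj D i)" using mod_homD(1)[OF dD hx] by simp
  have fx: "f i x \<in> mcar (cobj D i)" using mod_homD(1)[OF fh x] .
  have "g i x = f i x + - (cdif D (i - 1) (h i x) + h (i + 1) (cdif C i x))"
    using h[OF x] by (simp add: algebra_simps)
  then have "cdif D i (g i x) = cdif D i (f i x) - (cdif D i (cdif D (i - 1) (h i x)) + cdif D i (h (i + 1) (cdif C i x)))"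
    using mod_homD(2)[OF dD fx is_moduleD(3)[OF mD is_moduleD(2)[OF mD dhx hdx]]]
      mod_hom_minus[OF mD dD is_moduleD(2)[OF mD dhx hdx]] mod_homD(2)[OF dD dhx hdx] by simp
  also have "cdif D i (cdif D (i - 1) (h i x)) = 0" using is_complexD(3)[OF D hx] by simp
  finally have "cdif D i (g i x) = cdif D i (f i x) - cdif D i (h (i + 1) (cdif C i x))" by simp
  moreover have "g (i + 1) (cdif C i x) = f (i + 1) (cdif C i x) - cdif D i (h (i + 1) (cdif C i x))"
    using h[OF dx] is_complexD(3)[OF C x] mod_hom_0[OF mC hh, of "i + 1 + 1"] by (simp add: algebra_simps)
  ultimately show ?thesis using f x by (simp add: chain_map_def)
qed

section \<open>Homotopy letters and the ends of an overlap\<close>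

definition olt :: "('v, 'a) word \<Rightarrow> int \<Rightarrow> ('v, 'a) letter option" where
  "olt w k = (if k \<in> wpos w \<and> k + 1 \<in> wpos w then Some (wltr w k) else None)"

lemma ltr_right_olt: "k \<in> wpos w \<Longrightarrow> ltr_right w k = olt w k"
  by (simp add: ltr_right_def olt_def)
lemma ltr_left_olt: "k \<in> wpos w \<Longrightarrow> ltr_left w k = olt w (k - 1)"
  by (simp add: ltr_left_def olt_def)
lemma olt_None: "k \<notin> wpos w \<Longrightarrow> olt w k = None" "k + 1 \<notin> wpos w \<Longrightarrow> olt w k = None"
  by (auto simp: olt_def)

text \<open>
  Reading a word from right to left inverts its letters. This exchanges the conditions at the two
  ends of an overlap, so that only one end has to be analysed.
\<close>

fun flip :: "('v, 'a) letter \<Rightarrow> ('v, 'a) letter" where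
  "flip (Dir p) = Inv p" | "flip (Inv p) = Dir p"

lemma letter_ok_flip: "letter_ok A y (flip a) x \<longleftrightarrow> letter_ok A x a y"
  by (cases a) auto
lemma junction_ok_flip: "junction_ok A (flip b) (flip a) \<longleftrightarrow> junction_ok A a b"
  by (cases a; cases b) auto
lemma is_dir_flip: "is_dir (flip a) \<longleftrightarrow> \<not> is_dir a"
  by (cases a) (auto simp: is_dir_def)
lemma right_end_ok_flip:
  assumes "left_end_ok A s t" shows "right_end_ok A (map_option flip s) (map_option flip t)"
  using assms unfolding left_end_ok_def
proof (elim disjE exE conjE)
  fix p g assume "is_path A g" "nontrivial g" "pstart g = pend A p" "s = Some (Dir p)" "t = Some (Dir (pcomp g p))"
  then show ?thesis unfolding right_end_ok_def by (intro disjI2 disjI1 exI[of _ p] exI[of _ g]) simp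
next
  fix p g assume "is_path A g" "nontrivial g" "pend A g = pstart p" "s = Some (Inv (pcomp p g))" "t = Some (Inv p)"
  then show ?thesis unfolding right_end_ok_def by (intro disjI1 exI[of _ p] exI[of _ g]) simp
next
  assume "empty_or_dir s" "empty_or_inv t" "\<not> (s = None \<and> t = None)"
  then show ?thesis
    unfolding right_end_ok_def empty_or_dir_def empty_or_inv_def by (intro disjI2) auto
qed

lemma hwordD:
  assumes "is_hword A w"
  shows "interval (wpos w)" "olt w k = Some a \<Longrightarrow> letter_ok A (wvtx w k) a (wvtx w (k + 1))"
    "olt w k = Some a \<Longrightarrow> olt w (k + 1) = Some b \<Longrightarrow> junction_ok A a b"
    "k \<in> wpos w \<Longrightarrow> wvtx w k \<in> verts (quiver A)"
  using assms unfolding is_hword_def olt_def by (auto split: if_splits simp: add.commute)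

context gentle_algebra begin

text \<open>
  The components of the differential along a letter: a direct letter maps forwards, from its left
  to its right vertex, an inverse letter backwards. A missing letter gives zero in both directions.
\<close>

definition fwo :: "('v, 'a) letter option \<Rightarrow> ('v, 'a, 'k::field) algelt \<Rightarrow> ('v, 'a, 'k) algelt" where
  "fwo l u = (case l of Some (Dir p) \<Rightarrow> rmul p u | _ \<Rightarrow> 0)"

definition bwo :: "('v, 'a) letter option \<Rightarrow> ('v, 'a, 'k::field) algelt \<Rightarrow> ('v, 'a, 'k) algelt" where
  "bwo l u = (case l of Some (Inv p) \<Rightarrow> rmul p u | _ \<Rightarrow> 0)"

lemma fwo_simps [simp]: "fwo None u = 0" "fwo (Some (Dir p)) u = rmul p u" "fwo (Some (Inv p)) u = 0"
  and bwo_simps [simp]: "bwo None u = 0" "bwo (Some (Dir p)) u = 0" "bwo (Some (Inv p)) u = rmul p u"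
  by (simp_all add: fwo_def bwo_def)

lemma fwo_flip: "fwo (map_option flip l) u = bwo l u" "bwo (map_option flip l) u = fwo l u"
  by (auto simp: fwo_def bwo_def split: option.splits letter.splits)

lemma lin_fwo: "lin (fwo l)" and lin_bwo: "lin (bwo l)"
  using lin_rmul lin_0 by (auto simp: lin_def fwo_def bwo_def split: option.splits letter.splits)

lemmas rmul_0 [simp] = lin_zero[OF lin_rmul] and fwo_0 [simp] = lin_zero[OF lin_fwo] and bwo_0 [simp] = lin_zero[OF lin_bwo]

lemma nz_pcomp:
  assumes "pcomp p h \<in> nzpaths A" "pstart p = pend A h"
  shows "h \<in> nzpaths A" "p \<in> nzpaths A"
    "nontrivial h \<Longrightarrow> nontrivial p \<Longrightarrow> (hd (snd p), last (snd h)) \<notin> rels A"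
    "nontrivial p \<Longrightarrow> last (snd (pcomp p h)) = last (snd p)"
    "nontrivial h \<Longrightarrow> hd (snd (pcomp p h)) = hd (snd h)"
    "pend A (pcomp p h) = pend A p" "pstart (pcomp p h) = pstart h"
  using assms nzpaths_append[of "fst h" "snd h" "snd p"]
  by (cases p, cases h, auto simp: pcomp_def pend_def pstart_def nontrivial_def awlast_append)+

text \<open>
  At the right end of an overlap, \<open>t\<close> is the next letter of the source of a graph map and \<open>s\<close> that
  of its target; \<open>m\<close> and \<open>n\<close> are the letters after them. The first two equations say that the squares
  formed by the identity and \<open>H\<close> over \<open>t\<close> and \<open>s\<close> commute, the other two that \<open>H\<close> does not reach the
  following letters. The operator \<open>H\<close> is right multiplication by the path \<open>h\<close> of the end condition,
  or zero in the third case of that condition. What happens after \<open>h\<close> vanishes because one letter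
  starts (ends) with the first (last) arrow of \<open>h\<close>, or because the junction condition excludes
  the only arrow that composes with \<open>h\<close> to a nonzero path.
\<close>

lemma right_square:
  assumes ends: "right_end_ok A s t"
    and s: "\<And>a. s = Some a \<Longrightarrow> letter_ok A x a y" and t: "\<And>a. t = Some a \<Longrightarrow> letter_ok A x' a y'"
    and n: "\<And>a. n = Some a \<Longrightarrow> letter_ok A y a z" and m: "\<And>a. m = Some a \<Longrightarrow> letter_ok A y' a z'"
    and sn: "\<And>a b. s = Some a \<Longrightarrow> n = Some b \<Longrightarrow> junction_ok A a b"
    and tm: "\<And>a b. t = Some a \<Longrightarrow> m = Some b \<Longrightarrow> junction_ok A a b"
  shows "\<exists>H :: ('v, 'a, 'k::field) algelt \<Rightarrow> ('v, 'a, 'k) algelt. lin H \<and>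
    (\<forall>u. fwo s u = H (fwo t u)) \<and> (\<forall>u. bwo s (H u) = bwo t u) \<and>
    (\<forall>u. fwo n (H u) = 0) \<and> (\<forall>u. H (bwo m u) = 0) \<and>
    ((\<forall>u. H u = 0) \<or> (\<exists>a b. s = Some a \<and> t = Some b \<and> is_dir a = is_dir b \<and> (\<forall>u. H u \<in> proj A y)))"
  using ends unfolding right_end_ok_def
proof (elim disjE exE conjE)
  fix p h assume h: "is_path A h" "nontrivial h" "pend A h = pstart p"
    and st: "s = Some (Dir (pcomp p h))" "t = Some (Dir p)"
  have p: "pcomp p h \<in> nzpaths A" "pstart p = pend A h" "nontrivial p"
    using s[OF st(1)] t[OF st(2)] h by auto
  note nz = nz_pcomp[OF p(1,2)]
  have y: "pstart h = y" "pstart p = y'" using s[OF st(1)] t[OF st(2)] nz(7) by auto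
  note hl = nzpaths_hd_last[OF nz(1) h(2)] nzpaths_hd_last[OF nz(2) p(3)]
  have 1: "fwo n (rmul h u) = 0" for u :: "('v, 'a, 'k) algelt"
  proof (cases "\<exists>q. n = Some (Dir q)")
    case True
    then obtain q where q: "n = Some (Dir q)" by auto
    have "(hd (snd h), last (snd q)) \<in> rels A" using sn[OF st(1) q] nz(5)[OF h(2)] by simp
    then show ?thesis using n[OF q] q h y nz(1) by (auto intro!: rmul_rmul_0)
  qed (auto simp: fwo_def split: option.splits letter.splits)
  have 2: "rmul h (bwo m u) = 0" for u :: "('v, 'a, 'k) algelt"
  proof (cases "\<exists>q. m = Some (Inv q)")
    case True
    then obtain q where q: "m = Some (Inv q)" by auto
    have mq: "q \<in> nzpaths A" "nontrivial q" "pstart q = y'" using m[OF q] by auto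
    have "(hd (snd q), last (snd h)) \<in> rels A"
      using relation_after[of "last (snd h)" "hd (snd p)" "hd (snd q)"] tm[OF st(2) q]
        nz(3)[OF h(2) p(3)] nzpaths_hd_last[OF mq(1,2)] hl mq y p by auto
    then show ?thesis using q mq h y p nz(1) by (auto intro!: rmul_rmul_0)
  qed (auto simp: bwo_def split: option.splits letter.splits)
  show ?thesis
    using 1 2 lin_rmul[of h] st y
    by (intro exI[of _ "rmul h"]) (auto simp: is_dir_def rmul_rmul[OF p(1,2)] intro: rmul_proj)
next
  fix p h assume h: "is_path A h" "nontrivial h" "pstart h = pend A p"
    and st: "s = Some (Inv p)" "t = Some (Inv (pcomp h p))"
  have p: "pcomp h p \<in> nzpaths A" "pstart h = pend A p" "nontrivial p"
    using s[OF st(1)] t[OF st(2)] h by auto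
  note nz = nz_pcomp[OF p(1,2)]
  have y: "pstart h = y" "pend A h = y'" using s[OF st(1)] t[OF st(2)] nz(6) h by auto
  note hl = nzpaths_hd_last[OF nz(2) h(2)] nzpaths_hd_last[OF nz(1) p(3)]
  have 1: "fwo n (rmul h u) = 0" for u :: "('v, 'a, 'k) algelt"
  proof (cases "\<exists>q. n = Some (Dir q)")
    case True
    then obtain q where q: "n = Some (Dir q)" by auto
    have nq: "q \<in> nzpaths A" "nontrivial q" "pend A q = y" using n[OF q] by auto
    have "(hd (snd h), last (snd q)) \<in> rels A"
      using relation_before[of "hd (snd h)" "last (snd p)" "last (snd q)"] sn[OF st(1) q]
        nz(3)[OF p(3) h(2)] nzpaths_hd_last[OF nq(1,2)] hl nq y p by auto
    then show ?thesis using q nq h y nz(2) by (auto intro!: rmul_rmul_0)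
  qed (auto simp: fwo_def split: option.splits letter.splits)
  have 2: "rmul h (bwo m u) = 0" for u :: "('v, 'a, 'k) algelt"
  proof (cases "\<exists>q. m = Some (Inv q)")
    case True
    then obtain q where q: "m = Some (Inv q)" by auto
    have "(hd (snd q), last (snd h)) \<in> rels A" using tm[OF st(2) q] nz(4)[OF h(2)] by simp
    then show ?thesis using m[OF q] q h y nz(2) by (auto intro!: rmul_rmul_0)
  qed (auto simp: bwo_def split: option.splits letter.splits)
  show ?thesis
    using 1 2 lin_rmul[of h] st y
    by (intro exI[of _ "rmul h"]) (auto simp: is_dir_def rmul_rmul[OF p(1,2)] intro: rmul_proj)
next
  assume "empty_or_inv s" "empty_or_dir t"
  then show ?thesis
    using lin_0 by (intro exI[of _ "\<lambda>_. 0"]) (auto simp: empty_or_inv_def empty_or_dir_def)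
qed

lemma left_square:
  assumes ends: "left_end_ok A s t"
    and s: "\<And>a. s = Some a \<Longrightarrow> letter_ok A y a x" and t: "\<And>a. t = Some a \<Longrightarrow> letter_ok A y' a x'"
    and n: "\<And>a. n = Some a \<Longrightarrow> letter_ok A z a y" and m: "\<And>a. m = Some a \<Longrightarrow> letter_ok A z' a y'"
    and sn: "\<And>a b. s = Some a \<Longrightarrow> n = Some b \<Longrightarrow> junction_ok A b a"
    and tm: "\<And>a b. t = Some a \<Longrightarrow> m = Some b \<Longrightarrow> junction_ok A b a"
  shows "\<exists>H :: ('v, 'a, 'k::field) algelt \<Rightarrow> ('v, 'a, 'k) algelt. lin H \<and>
    (\<forall>u. bwo s u = H (bwo t u)) \<and> (\<forall>u. fwo s (H u) = fwo t u) \<and>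
    (\<forall>u. bwo n (H u) = 0) \<and> (\<forall>u. H (fwo m u) = 0) \<and>
    ((\<forall>u. H u = 0) \<or> (\<exists>a b. s = Some a \<and> t = Some b \<and> is_dir a = is_dir b \<and> (\<forall>u. H u \<in> proj A y)))"
proof -
  have "\<exists>H :: ('v, 'a, 'k) algelt \<Rightarrow> ('v, 'a, 'k) algelt. lin H \<and>
    (\<forall>u. fwo (map_option flip s) u = H (fwo (map_option flip t) u)) \<and>
    (\<forall>u. bwo (map_option flip s) (H u) = bwo (map_option flip t) u) \<and>
    (\<forall>u. fwo (map_option flip n) (H u) = 0) \<and> (\<forall>u. H (bwo (map_option flip m) u) = 0) \<and>
    ((\<forall>u. H u = 0) \<or> (\<exists>a b. map_option flip s = Some a \<and> map_option flip t = Some b \<and>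
        is_dir a = is_dir b \<and> (\<forall>u. H u \<in> proj A y)))"
    by (rule right_square[OF right_end_ok_flip[OF ends], where x = x and x' = x' and y' = y' and z = z and z' = z'])
      (auto simp: letter_ok_flip junction_ok_flip s t n m sn tm)
  then obtain H :: "('v, 'a, 'k) algelt \<Rightarrow> ('v, 'a, 'k) algelt" where H: "lin H"
    "\<forall>u. bwo s u = H (bwo t u)" "\<forall>u. fwo s (H u) = fwo t u" "\<forall>u. bwo n (H u) = 0" "\<forall>u. H (fwo m u) = 0"
    "(\<forall>u. H u = 0) \<or> (\<exists>a b. map_option flip s = Some a \<and> map_option flip t = Some b \<and>
        is_dir a = is_dir b \<and> (\<forall>u. H u \<in> proj A y))"
    unfolding fwo_flip by blast
  then show ?thesis by (intro exI[of _ H]) (auto simp: is_dir_flip)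
qed

abbreviation fw :: "('v, 'a) word \<Rightarrow> int \<Rightarrow> ('v, 'a, 'k::field) algelt \<Rightarrow> ('v, 'a, 'k) algelt" where
  "fw w k \<equiv> fwo (olt w k)"
abbreviation bw :: "('v, 'a) word \<Rightarrow> int \<Rightarrow> ('v, 'a, 'k::field) algelt \<Rightarrow> ('v, 'a, 'k) algelt" where
  "bw w k \<equiv> bwo (olt w k)"

text \<open>
  The square of the differential vanishes because consecutive letters of the same direction meet in
  a relation.
\<close>

lemma fw_fw:
  assumes w: "is_hword A w" shows "fw w (k + 1) (fw w k u) = 0"
proof (cases "\<exists>p q. olt w k = Some (Dir q) \<and> olt w (k + 1) = Some (Dir p)")
  case True
  then obtain p q where pq: "olt w k = Some (Dir q)" "olt w (k + 1) = Some (Dir p)" by auto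
  show ?thesis
    using hwordD(2)[OF w pq(1)] hwordD(2)[OF w pq(2)] hwordD(3)[OF w pq] pq by (simp add: rmul_rmul_0)
qed (auto simp: fwo_def split: option.splits letter.splits)

lemma bw_bw:
  assumes w: "is_hword A w" shows "bw w k (bw w (k + 1) u) = 0"
proof (cases "\<exists>p q. olt w k = Some (Inv q) \<and> olt w (k + 1) = Some (Inv p)")
  case True
  then obtain p q where pq: "olt w k = Some (Inv q)" "olt w (k + 1) = Some (Inv p)" by auto
  show ?thesis
    using hwordD(2)[OF w pq(1)] hwordD(2)[OF w pq(2)] hwordD(3)[OF w pq] pq by (simp add: rmul_rmul_0)
qed (auto simp: bwo_def split: option.splits letter.splits)

lemma fwo_bwo [simp]: "fwo l (bwo l u) = 0" "bwo l (fwo l u) = 0"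
  by (auto simp: fwo_def bwo_def split: option.splits letter.splits)

end

section \<open>String and band complexes\<close>

lemma mod_Suc_cases:
  fixes k L :: int assumes "L > 0"
  shows "(k + 1) mod L = k mod L + 1 \<and> k mod L + 1 < L \<or> k mod L + 1 = L \<and> (k + 1) mod L = 0"
proof -
  have "(k + 1) mod L = (k mod L + 1) mod L" by (simp add: mod_add_left_eq)
  moreover have "0 \<le> k mod L" "k mod L < L" using assms by auto
  moreover from this have "k mod L + 1 < L \<or> k mod L + 1 = L" by linarith
  ultimately show ?thesis by auto
qed

lemma wlen_interval: "wpos w = {a..b} \<Longrightarrow> a \<le> b \<Longrightarrow> wlen w = b - a"
  by (simp add: wlen_def cSup_atLeastAtMost cInf_atLeastAtMost)

lemma band_wpos:
  assumes "is_band A w" shows "wlen w > 0" "wpos w = {0..wlen w}"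
proof -
  obtain n where "n > 0" "wpos w = {0..n}" using assms by (auto simp: is_band_def)
  moreover from this have "wlen w = n" using wlen_interval[of w 0 n] by simp
  ultimately show "wlen w > 0" "wpos w = {0..wlen w}" by auto
qed

lemma unroll_simps [simp]:
  "wpos (unroll w) = UNIV" "wvtx (unroll w) k = wvtx w (k mod wlen w)"
  "wltr (unroll w) k = wltr w (k mod wlen w)"
  by (simp_all add: unroll_def)

lemma olt_unroll: "olt (unroll w) k = Some (wltr w (k mod wlen w))"
  by (simp add: olt_def)

lemma band_wlen_ge_2:
  assumes "is_band A w" shows "wlen w \<ge> 2"
proof (rule ccontr)
  assume "\<not> wlen w \<ge> 2"
  then have L: "{0..<wlen w} = {0}" using band_wpos(1)[OF assms] by auto
  have "card {k \<in> {0..<wlen w}. is_dir (wltr w k)} = card {k \<in> {0..<wlen w}. \<not> is_dir (wltr w k)}"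
    using assms by (simp add: is_band_def)
  moreover have "{k \<in> {0..<wlen w}. is_dir (wltr w k)} = (if is_dir (wltr w 0) then {0} else {})"
    "{k \<in> {0..<wlen w}. \<not> is_dir (wltr w k)} = (if is_dir (wltr w 0) then {} else {0})"
    unfolding L by auto
  ultimately show False by (simp split: if_splits)
qed

text \<open>
  Going once around a band, each direct letter raises the degree by one and each inverse letter
  lowers it by one, and there are equally many of them.
\<close>

lemma band_degree_closed:
  assumes w: "is_band A w" and d: "grading w d"
  shows "d (wlen w) = d 0"
proof -
  note L = band_wpos[OF w]
  let ?D = "\<lambda>n. card {k \<in> {0..<int n}. is_dir (wltr w k)}"
  let ?I = "\<lambda>n. card {k \<in> {0..<int n}. \<not> is_dir (wltr w k)}"
  have "d (int n) - d 0 = int (?D n) - int (?I n)" if "int n \<le> wlen w" for n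
    using that
  proof (induction n)
    case (Suc n)
    have e: "{0..<int (Suc n)} = insert (int n) {0..<int n}" by auto
    have m: "{int n, int n + 1} \<subseteq> wpos w" using Suc.prems L(2) by auto
    have step: "if is_dir (wltr w (int n)) then d (int n + 1) = d (int n) + 1 else d (int n) = d (int n + 1) + 1"
      using d m unfolding grading_def by blast
    have split: "{k \<in> {0..<int (Suc n)}. P k} = (if P (int n) then insert (int n) {k \<in> {0..<int n}. P k} else {k \<in> {0..<int n}. P k})" for P
      unfolding e by auto
    have card: "card {k \<in> {0..<int (Suc n)}. P k} = card {k \<in> {0..<int n}. P k} + (if P (int n) then 1 else 0)" for P
      unfolding split by (auto intro!: card_insert_disjoint finite_subset[of _ "{0..<int n}"])
    have "d (int n) - d 0 = int (?D n) - int (?I n)" using Suc by simp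
    then show ?case using step unfolding card by (auto simp: add.commute split: if_splits)
  qed simp
  from this[of "nat (wlen w)"] have "d (wlen w) - d 0 = int (card {k \<in> {0..<wlen w}. is_dir (wltr w k)}) - int (card {k \<in> {0..<wlen w}. \<not> is_dir (wltr w k)})"
    using L(1) by simp
  then show ?thesis using w by (simp add: is_band_def)
qed

text \<open>
  Every pair of consecutive letters of the unrolled band occurs in \<open>w \<cdot> w\<close>.
\<close>

lemma unroll_hword:
  assumes w: "is_band A w" shows "is_hword A (unroll w)"
proof -
  let ?L = "wlen w"
  note L = band_wpos[OF w]
  have h: "is_hword A w" and hh: "is_hword A (w \<cdot> w)" and cl: "wvtx w 0 = wvtx w ?L"
    using w by (auto simp: is_band_def)
  have S: "Sup (wpos w) - Inf (wpos w) = ?L" by (simp add: wlen_def)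
  have ww: "wpos (w \<cdot> w) = wpos w \<union> (\<lambda>k. k + ?L) ` wpos w"
    "\<And>k. wltr (w \<cdot> w) k = (if k \<in> wpos w \<and> k + 1 \<in> wpos w then wltr w k else wltr w (k - ?L))"
    unfolding wcat_def Let_def S by simp_all
  have m: "0 \<le> k mod ?L" "k mod ?L < ?L" for k using L(1) by auto
  have letter: "letter_ok A (wvtx w (k mod ?L)) (wltr w (k mod ?L)) (wvtx w ((k + 1) mod ?L))" for k
  proof -
    have "{k mod ?L, k mod ?L + 1} \<subseteq> wpos w" using m[of k] unfolding L(2) by auto
    then have "letter_ok A (wvtx w (k mod ?L)) (wltr w (k mod ?L)) (wvtx w (k mod ?L + 1))"
      using h unfolding is_hword_def by blast
    moreover have "wvtx w ((k + 1) mod ?L) = wvtx w (k mod ?L + 1)"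
      using mod_Suc_cases[OF L(1), of k] cl by auto
    ultimately show ?thesis by simp
  qed
  have junction: "junction_ok A (wltr w (k mod ?L)) (wltr w ((k + 1) mod ?L))" for k
  proof -
    let ?a = "k mod ?L"
    have a: "0 \<le> ?a" "?a < ?L" "{?a, ?a + 1} \<subseteq> wpos w" using m[of k] unfolding L(2) by auto
    have "?a + 2 \<in> wpos (w \<cdot> w)"
    proof (cases "?a + 2 \<le> ?L")
      case False
      then have "?a + 2 = 1 + ?L" using a(1,2) by linarith
      moreover have "1 \<in> wpos w" using L by auto
      ultimately
      show ?thesis unfolding ww by (metis UnI2 image_eqI)
    qed (use a L ww in auto)
    then have "{?a, ?a + 1, ?a + 2} \<subseteq> wpos (w \<cdot> w)" using a ww by auto
    then have "junction_ok A (wltr (w \<cdot> w) ?a) (wltr (w \<cdot> w) (?a + 1))"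
      using hh unfolding is_hword_def by blast
    moreover have "wltr (w \<cdot> w) ?a = wltr w ?a" using a unfolding ww by simp
    moreover have "wltr (w \<cdot> w) (?a + 1) = wltr w ((k + 1) mod ?L)"
      using mod_Suc_cases[OF L(1), of k]
    proof (elim disjE conjE)
      assume "?a + 1 = ?L" "(k + 1) mod ?L = 0"
      moreover have "?L + 1 \<notin> wpos w" unfolding L(2) by simp
      ultimately show ?thesis unfolding ww by simp
    next
      assume *: "(k + 1) mod ?L = ?a + 1" "?a + 1 < ?L"
      then have "?a + 1 \<in> wpos w" "?a + 1 + 1 \<in> wpos w" using a(1) unfolding L(2) by auto
      then show ?thesis unfolding ww * by simp
    qed
    ultimately show ?thesis by simp
  qed
  show ?thesis
    unfolding is_hword_def
  proof (intro conjI ballI allI impI)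
    fix k have "k mod ?L \<in> wpos w" using m[of k] unfolding L(2) by simp
    then show "wvtx (unroll w) k \<in> verts (quiver A)" using hwordD(4)[OF h] by simp
  qed (use letter junction in \<open>auto simp: interval_def\<close>)
qed

lemma unroll_grading:
  assumes w: "is_band A w" and d: "grading w d"
  shows "grading (unroll w) (\<lambda>k. d (k mod wlen w))"
  unfolding grading_def
proof (intro allI impI)
  fix k let ?L = "wlen w"
  note L = band_wpos[OF w]
  have m: "0 \<le> k mod ?L" "k mod ?L < ?L" using L(1) by auto
  have "{k mod ?L, k mod ?L + 1} \<subseteq> wpos w" using m unfolding L(2) by auto
  then have "if is_dir (wltr w (k mod ?L)) then d (k mod ?L + 1) = d (k mod ?L) + 1 else d (k mod ?L) = d (k mod ?L + 1) + 1"
    using d unfolding grading_def by blast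
  moreover have "d ((k + 1) mod ?L) = d (k mod ?L + 1)"
    using mod_Suc_cases[OF L(1), of k] band_degree_closed[OF w d] by auto
  ultimately show "if is_dir (wltr (unroll w) k) then d ((k + 1) mod ?L) = d (k mod ?L) + 1 else d (k mod ?L) = d ((k + 1) mod ?L) + 1"
    by simp
qed

text \<open>
  A graded string or band up to the bounded cohomology of an infinite string. For the word of the
  cone, that last condition can only be obtained from the isomorphism with the cone, which in turn
  needs the complex of the word.
\<close>

fun pre_hobj :: "('v, 'a) bound_quiver \<Rightarrow> ('v, 'a, 'k::field) hobj \<Rightarrow> bool" where
  "pre_hobj A (HStr w d) \<longleftrightarrow> is_hword A w \<and> grading w d \<and>
     (infinite (wpos w) \<longrightarrow> (\<exists>n. \<forall>k \<in> wpos w. d k \<le> n) \<and> (\<forall>i. finite {k \<in> wpos w. d k = i}))"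
| "pre_hobj A (HBnd w d l k0) \<longleftrightarrow> is_hobj A (HBnd w d l k0)"

lemma hobj_pre: "is_hobj A X \<Longrightarrow> pre_hobj A X"
  by (cases X) (simp_all only: is_hobj.simps pre_hobj.simps simp_thms, blast)

lemma hobj_hword: "pre_hobj A X \<Longrightarrow> is_hword A (oword X)"
  by (cases X) (auto simp: unroll_hword)

lemma odeg_HStr [simp]: "odeg (HStr w d) = d"
  and odeg_HBnd: "odeg (HBnd w d l k0) = (\<lambda>k. d (k mod wlen w))"
  by auto

lemma hobj_grading:
  assumes "pre_hobj A X" shows "grading (oword X) (odeg X)"
  using assms by (cases X) (auto simp: unroll_grading odeg_HBnd)

lemma hobj_wlen: "pre_hobj A (HBnd w d l k0) \<Longrightarrow> wlen w > 0"
  by (simp add: band_wpos)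

lemma hobj_oix:
  assumes "pre_hobj A X"
  shows "k \<in> wpos (oword X) \<Longrightarrow> oix X k \<in> overts X" "v \<in> overts X \<Longrightarrow> oix X v = v"
    "wvtx (oword X) (oix X k) = wvtx (oword X) k" "odeg X (oix X k) = odeg X k"
    "v \<in> overts X \<Longrightarrow> v \<in> wpos (oword X)"
  using assms by (cases X; auto simp: hobj_wlen band_wpos)+

lemma gradingD:
  assumes "grading w d" "olt w k = Some a"
  shows "is_dir a \<Longrightarrow> d (k + 1) = d k + 1" "\<not> is_dir a \<Longrightarrow> d k = d (k + 1) + 1"
  using assms unfolding grading_def olt_def by (auto split: if_splits)

context gentle_algebra begin

lemma Qdif_outside:
  assumes "pre_hobj A X" "v \<notin> overts X" shows "Qdif A X u v = 0"
proof -
  have e: "{k \<in> oletters X. oix X (k + 1) = v} = {}" "{k \<in> oletters X. oix X k = v} = {}"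
    using assms by (cases X; auto simp: band_wpos)+
  show ?thesis unfolding Qdif_def e by simp
qed

lemma Qdif_overts:
  fixes u :: "('v, 'a, 'k::field) dsum"
  assumes X: "pre_hobj A X" and v: "v \<in> overts X"
  shows "Qdif A X u v = scl (ocoef X (oix X (v - 1))) (fw (oword X) (v - 1) (u (oix X (v - 1)))) +
    scl (ocoef X v) (bw (oword X) v (u (oix X (v + 1))))"
proof (cases X)
  case (HStr w d)
  have e: "{k \<in> oletters X. oix X (k + 1) = v} = (if v - 1 \<in> wpos w \<and> v \<in> wpos w then {v - 1} else {})"
    "{k \<in> oletters X. oix X k = v} = (if v \<in> wpos w \<and> v + 1 \<in> wpos w then {v} else {})"
    using HStr by auto
  then show ?thesis
    unfolding Qdif_def e using HStr by (auto simp: olt_def pmap_eq split: letter.splits)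
next
  case (HBnd w d l k0)
  let ?L = "wlen w"
  have L: "?L > 0" using X HBnd hobj_wlen by blast
  have v': "0 \<le> v" "v < ?L" using v HBnd by auto
  have e1: "{k \<in> oletters X. oix X (k + 1) = v} = {(v - 1) mod ?L}"
  proof -
    have "(k + 1) mod ?L = v \<longleftrightarrow> k = (v - 1) mod ?L" if k: "0 \<le> k" "k < ?L" for k
    proof
      assume "(k + 1) mod ?L = v"
      then have "(v - 1) mod ?L = (k + 1 - 1) mod ?L" by (metis mod_diff_left_eq)
      then show "k = (v - 1) mod ?L" using k by simp
    next
      assume "k = (v - 1) mod ?L"
      then have "(k + 1) mod ?L = (v - 1 + 1) mod ?L" by (metis mod_add_left_eq)
      then show "(k + 1) mod ?L = v" using v' by simp
    qed
    then show ?thesis using HBnd L by auto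
  qed
  have e2: "{k \<in> oletters X. oix X k = v} = {v}" using HBnd v' by auto
  have "((v - 1) mod ?L + 1) mod ?L = v" "(v - 1) mod ?L mod ?L = (v - 1) mod ?L"
    using v' by (simp_all add: mod_add_left_eq)
  then show ?thesis
    unfolding Qdif_def e1 e2 using HBnd v' by (auto simp: olt_unroll pmap_eq split: letter.splits)
qed

lemma oix_step:
  assumes "pre_hobj A X" "k \<in> wpos (oword X)"
  shows "oix X (oix X k - 1) = oix X (k - 1)" "oix X (oix X k + 1) = oix X (k + 1)"
    "olt (oword X) (oix X k - 1) = olt (oword X) (k - 1)" "olt (oword X) (oix X k) = olt (oword X) k"
proof -
  have "(k mod L - 1) mod L = (k - 1) mod L" "(k mod L + 1) mod L = (k + 1) mod L" for L :: int
    by (simp_all add: mod_diff_left_eq mod_add_left_eq)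
  then show "oix X (oix X k - 1) = oix X (k - 1)" "oix X (oix X k + 1) = oix X (k + 1)"
    "olt (oword X) (oix X k - 1) = olt (oword X) (k - 1)" "olt (oword X) (oix X k) = olt (oword X) k"
    by (cases X; simp add: olt_unroll)+
qed

text \<open>
  The differential at the vertex \<open>k\<close> of the unrolled diagram. In this form it is the same for
  strings and bands, and free of sums.
\<close>

lemma Qdif_line:
  assumes X: "pre_hobj A X" and k: "k \<in> wpos (oword X)"
  shows "Qdif A X u (oix X k) = scl (ocoef X (oix X (k - 1))) (fw (oword X) (k - 1) (u (oix X (k - 1)))) +
    scl (ocoef X (oix X k)) (bw (oword X) k (u (oix X (k + 1))))"
  using Qdif_overts[OF X hobj_oix(1)[OF X k]] oix_step[OF X k] by simp

lemma Qdif_str: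
  fixes u :: "('v, 'a, 'k::field) dsum"
  assumes X: "pre_hobj A (HStr w d :: ('v, 'a, 'k) hobj)"
  shows "Qdif A (HStr w d) u v = fw w (v - 1) (u (v - 1)) + bw w v (u (v + 1))"
proof (cases "v \<in> wpos w")
  case True
  then show ?thesis using Qdif_overts[OF X, of v u] by simp
next
  case False
  then show ?thesis using Qdif_outside[OF X, of v u] by (simp add: olt_None)
qed

text \<open>
  The component at the vertex \<open>v\<close> of the degree \<open>n\<close> part of the complex of a word. With the
  value zero for all other \<open>v\<close>, membership in the complex is a condition on each integer \<open>v\<close>, and
  for an unrolled band it is periodic.
\<close>

definition wcomp :: "('v, 'a) word \<Rightarrow> (int \<Rightarrow> int) \<Rightarrow> int \<Rightarrow> int \<Rightarrow> ('v, 'a, 'k::field) algelt set" where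
  "wcomp w d n v = (if v \<in> wpos w \<and> d v = n then proj A (wvtx w v) else {0})"

lemma proj_closed:
  "0 \<in> proj A x" "u \<in> proj A x \<Longrightarrow> v \<in> proj A x \<Longrightarrow> u + v \<in> proj A x"
  "u \<in> proj A x \<Longrightarrow> scl c u \<in> proj A x"
  by (auto simp: proj_def alg_def scl_def) (metis add_0)

lemma amult_proj:
  fixes u :: "('v, 'a, 'k::field) algelt"
  assumes "u \<in> proj A x" shows "amult A a u \<in> proj A x"
proof -
  have "pstart p = x" if "amult A a u p \<noteq> 0" for p
  proof -
    obtain y as where p: "p = (y, as)" by (cases p)
    have nz: "(y, as) \<in> nzpaths A" using that amult_outside p by metis
    have "\<exists>n. u (y, take n as) \<noteq> 0"
    proof (rule ccontr)
      assume "\<not> (\<exists>n. u (y, take n as) \<noteq> 0)"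
      then have "amult A a u (y, as) = 0" unfolding amult_splits[OF nz] by simp
      then show False using that p by simp
    qed
    then obtain n where "u (y, take n as) \<noteq> 0" by blast
    then show ?thesis using assms unfolding proj_def p by (auto simp: pstart_def)
  qed
  then show ?thesis using amult_alg by (auto simp: proj_def)
qed

lemma wcomp_closed:
  "0 \<in> wcomp w d n v" "u \<in> wcomp w d n v \<Longrightarrow> u' \<in> wcomp w d n v \<Longrightarrow> u + u' \<in> wcomp w d n v"
  "u \<in> wcomp w d n v \<Longrightarrow> scl c u \<in> wcomp w d n v" "u \<in> wcomp w d n v \<Longrightarrow> amult A a u \<in> wcomp w d n v"
  by (auto simp: wcomp_def proj_closed amult_proj)

lemma wcomp_minus:
  "u \<in> wcomp w d n v \<Longrightarrow> - u \<in> wcomp w d n v"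
  "u \<in> wcomp w d n v \<Longrightarrow> u' \<in> wcomp w d n v \<Longrightarrow> u - u' \<in> wcomp w d n v"
proof -
  show m: "- u \<in> wcomp w d n v" if "u \<in> wcomp w d n v" for u :: "('v, 'a, 'b) algelt"
    using wcomp_closed(3)[OF that, of "- 1"] by (simp add: scl_minus_1)
  show "u - u' \<in> wcomp w d n v" if "u \<in> wcomp w d n v" "u' \<in> wcomp w d n v" for u u' :: "('v, 'a, 'b) algelt"
    using wcomp_closed(2)[OF that(1) m[OF that(2)]] by simp
qed

lemma fw_wcomp:
  assumes w: "is_hword A w" and d: "grading w d" and u: "u \<in> wcomp w d n k"
  shows "fw w k u \<in> wcomp w d (n + 1) (k + 1)"
proof (cases "u = 0 \<or> \<not> (\<exists>p. olt w k = Some (Dir p))")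
  case True
  then show ?thesis by (auto simp: wcomp_closed fwo_def split: option.splits letter.splits)
next
  case False
  then obtain p where p: "olt w k = Some (Dir p)" by auto
  have "d k = n" using False u by (auto simp: wcomp_def split: if_splits)
  then have "d (k + 1) = n + 1" using gradingD(1)[OF d p] by (simp add: is_dir_def)
  moreover have "pstart p = wvtx w (k + 1)" using hwordD(2)[OF w p] by simp
  moreover have "k + 1 \<in> wpos w" using p by (auto simp: olt_def split: if_splits)
  ultimately show ?thesis using rmul_proj[of p u] p by (simp add: wcomp_def)
qed

lemma bw_wcomp:
  assumes w: "is_hword A w" and d: "grading w d" and u: "u \<in> wcomp w d n (k + 1)"
  shows "bw w k u \<in> wcomp w d (n + 1) k"
proof (cases "u = 0 \<or> \<not> (\<exists>p. olt w k = Some (Inv p))")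
  case True
  then show ?thesis by (auto simp: wcomp_closed bwo_def split: option.splits letter.splits)
next
  case False
  then obtain p where p: "olt w k = Some (Inv p)" by auto
  have "d (k + 1) = n" using False u by (auto simp: wcomp_def split: if_splits)
  then have "d k = n + 1" using gradingD(2)[OF d p] by (simp add: is_dir_def)
  moreover have "pstart p = wvtx w k" using hwordD(2)[OF w p] by simp
  moreover have "k \<in> wpos w" using p by (auto simp: olt_def split: if_splits)
  ultimately show ?thesis using rmul_proj[of p u] p by (simp add: wcomp_def)
qed

abbreviation car :: "('v, 'a, 'k::field) hobj \<Rightarrow> int \<Rightarrow> ('v, 'a, 'k) dsum set" where
  "car X n \<equiv> mcar (cobj (Qcx A X) n)"

lemma Qcx_simps [simp]: "cdif (Qcx A X) n = Qdif A X" "mact (cobj (Qcx A X) n) a u = (\<lambda>v. amult A a (u v))"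
  by (simp_all add: Qcx_def)

lemma car_iff:
  assumes X: "pre_hobj A X"
  shows "u \<in> car X n \<longleftrightarrow> finite {v. u v \<noteq> 0} \<and>
    (\<forall>k \<in> wpos (oword X). u (oix X k) \<in> wcomp (oword X) (odeg X) n k) \<and> (\<forall>v. v \<notin> overts X \<longrightarrow> u v = 0)"
proof -
  have "u \<in> car X n \<longleftrightarrow> finite {v. u v \<noteq> 0} \<and>
    (\<forall>v \<in> overts X. u v \<in> wcomp (oword X) (odeg X) n v) \<and> (\<forall>v. v \<notin> overts X \<longrightarrow> u v = 0)"
    using hobj_oix(5)[OF X] by (auto simp: Qcx_def wcomp_def split: if_splits)
  moreover have "wcomp (oword X) (odeg X) n (oix X k) = wcomp (oword X) (odeg X) n k" if "k \<in> wpos (oword X)" for k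
    using hobj_oix[OF X] that by (simp add: wcomp_def)
  ultimately show ?thesis using hobj_oix(1,2,5)[OF X] by (metis (no_types, lifting))
qed

lemma car_iff_str:
  fixes u :: "('v, 'a, 'k::field) dsum"
  assumes X: "pre_hobj A (HStr w d :: ('v, 'a, 'k) hobj)"
  shows "u \<in> car (HStr w d) n \<longleftrightarrow> finite {v. u v \<noteq> 0} \<and> (\<forall>v. u v \<in> wcomp w d n v)"
proof -
  show ?thesis unfolding car_iff[OF X] by (auto simp: wcomp_def)
qed

lemma Qdif_add: "pre_hobj A X \<Longrightarrow> Qdif A X (u + v) = Qdif A X u + Qdif A X v"
proof
  fix x assume X: "pre_hobj A X"
  show "Qdif A X (u + v) x = (Qdif A X u + Qdif A X v) x"
    by (cases "x \<in> overts X")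
      (simp_all add: Qdif_overts[OF X] Qdif_outside[OF X] lin_add[OF lin_fwo] lin_add[OF lin_bwo] scl_add ac_simps)
qed

lemma Qdif_amult: "pre_hobj A X \<Longrightarrow> Qdif A X (\<lambda>v. amult A a (u v)) = (\<lambda>v. amult A a (Qdif A X u v))"
proof
  fix x assume X: "pre_hobj A X"
  show "Qdif A X (\<lambda>v. amult A a (u v)) x = amult A a (Qdif A X u x)"
    by (cases "x \<in> overts X")
      (simp_all add: Qdif_overts[OF X] Qdif_outside[OF X] lin_amult[OF lin_fwo] lin_amult[OF lin_bwo]
        amult_add_right amult_scl_right)
qed

lemma finite_shift:
  assumes "finite {v. u v \<noteq> 0}" shows "finite {v :: int. u (v + a) \<noteq> (0 :: 'z::zero)}"
proof -
  have "{v. u (v + a) \<noteq> 0} \<subseteq> (\<lambda>v. v - a) ` {v. u v \<noteq> 0}"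
  proof
    fix v assume "v \<in> {v. u (v + a) \<noteq> 0}"
    then show "v \<in> (\<lambda>v. v - a) ` {v. u v \<noteq> 0}" by (intro image_eqI[of _ _ "v + a"]) auto
  qed
  then show ?thesis using assms finite_subset by blast
qed

lemma Qdif_car:
  assumes X: "pre_hobj A X" and u: "u \<in> car X n"
  shows "Qdif A X u \<in> car X (n + 1)"
  unfolding car_iff[OF X]
proof (intro conjI ballI allI impI)
  show "finite {v. Qdif A X u v \<noteq> 0}"
  proof (cases X)
    case (HStr w d)
    have "finite {v. u v \<noteq> 0}" using u car_iff[OF X] by blast
    then have "finite ({v. u (v + (- 1)) \<noteq> 0} \<union> {v. u (v + 1) \<noteq> 0})" using finite_shift by blast
    moreover have "{v. Qdif A X u v \<noteq> 0} \<subseteq> {v. u (v + (- 1)) \<noteq> 0} \<union> {v. u (v + 1) \<noteq> 0}"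
      using X HStr by (auto simp: Qdif_str)
    ultimately show ?thesis by (rule rev_finite_subset)
  next
    case (HBnd w d l k0)
    have "{v. Qdif A X u v \<noteq> 0} \<subseteq> overts X" using Qdif_outside[OF X] by auto
    then show ?thesis using HBnd finite_subset by auto
  qed
  fix k assume k: "k \<in> wpos (oword X)"
  note hw = hobj_hword[OF X] and gr = hobj_grading[OF X]
  have uk: "u (oix X k) \<in> wcomp (oword X) (odeg X) n k" if "k \<in> wpos (oword X)" for k
    using u that car_iff[OF X] by blast
  have "fw (oword X) (k - 1) (u (oix X (k - 1))) \<in> wcomp (oword X) (odeg X) (n + 1) k"
  proof (cases "k - 1 \<in> wpos (oword X)")
    case True
    then show ?thesis using fw_wcomp[OF hw gr uk[OF True]] by simp
  qed (simp add: olt_None wcomp_closed)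
  moreover have "bw (oword X) k (u (oix X (k + 1))) \<in> wcomp (oword X) (odeg X) (n + 1) k"
  proof (cases "k + 1 \<in> wpos (oword X)")
    case True
    then show ?thesis using bw_wcomp[OF hw gr uk[OF True]] by simp
  qed (simp add: olt_None wcomp_closed)
  ultimately show "Qdif A X u (oix X k) \<in> wcomp (oword X) (odeg X) (n + 1) k"
    unfolding Qdif_line[OF X k] by (intro wcomp_closed)
next
  fix v assume "v \<notin> overts X" then show "Qdif A X u v = 0" by (rule Qdif_outside[OF X])
qed

lemma Qdif_Qdif:
  fixes u :: "('v, 'a, 'k::field) dsum"
  assumes X: "pre_hobj A X" shows "Qdif A X (Qdif A X u) = 0"
proof
  fix v show "Qdif A X (Qdif A X u) v = 0 v"
  proof (cases "v \<in> overts X")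
    case True
    note v = hobj_oix(5)[OF X True]
    note hw = hobj_hword[OF X]
    have ff: "fw (oword X) (v - 1) (fw (oword X) (v - 2) z) = 0" for z :: "('v, 'a, 'k) algelt"
      using fw_fw[OF hw, of "v - 2" z] by simp
    have 1: "fw (oword X) (v - 1) (Qdif A X u (oix X (v - 1))) = 0"
    proof (cases "v - 1 \<in> wpos (oword X)")
      case True
      show ?thesis unfolding Qdif_line[OF X True]
        by (simp add: lin_add[OF lin_fwo] lin_scl[OF lin_fwo] ff)
    qed (simp add: olt_None)
    have 2: "bw (oword X) v (Qdif A X u (oix X (v + 1))) = 0"
    proof (cases "v + 1 \<in> wpos (oword X)")
      case True
      show ?thesis unfolding Qdif_line[OF X True]
        by (simp add: lin_add[OF lin_bwo] lin_scl[OF lin_bwo] bw_bw[OF hw])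
    qed (simp add: olt_None)
    show ?thesis unfolding Qdif_overts[OF X True] by (simp add: 1 2)
  qed (simp add: Qdif_outside[OF X])
qed

lemma car_closed:
  assumes X: "pre_hobj A X"
  shows "0 \<in> car X n" "u \<in> car X n \<Longrightarrow> v \<in> car X n \<Longrightarrow> u + v \<in> car X n"
    "u \<in> car X n \<Longrightarrow> - u \<in> car X n" "u \<in> car X n \<Longrightarrow> (\<lambda>v. amult A a (u v)) \<in> car X n"
proof -
  have fin: "finite {v. u v \<noteq> 0} \<Longrightarrow> \<forall>v. u v = 0 \<longrightarrow> w v = 0 \<Longrightarrow> finite {v. w v \<noteq> 0}"
    for u w :: "('v, 'a, 'b) dsum" by (rule rev_finite_subset) auto
  show "0 \<in> car X n" by (simp add: car_iff[OF X] wcomp_closed)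
  show "- u \<in> car X n" if "u \<in> car X n" for u using that by (auto simp: car_iff[OF X] wcomp_minus intro: fin)
  show "(\<lambda>v. amult A a (u v)) \<in> car X n" if "u \<in> car X n" for u
    using that by (auto simp: car_iff[OF X] wcomp_closed intro: fin)
  show "u + v \<in> car X n" if "u \<in> car X n" "v \<in> car X n" for u v
  proof -
    have "finite ({x. u x \<noteq> 0} \<union> {x. v x \<noteq> 0})" using that car_iff[OF X] by blast
    then have "finite {x. u x + v x \<noteq> 0}" by (rule rev_finite_subset) auto
    then show ?thesis using that by (auto simp: car_iff[OF X] wcomp_closed)
  qed
qed

lemma wcomp_alg: "u \<in> wcomp w d n v \<Longrightarrow> u \<in> alg A"
  by (auto simp: wcomp_def proj_def alg_def split: if_splits)

lemma car_alg: "pre_hobj A X \<Longrightarrow> u \<in> car X n \<Longrightarrow> u v \<in> alg A"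
  using hobj_oix(2,5)[of A X v] wcomp_alg[of "u v"] unfolding car_iff
  by (cases "v \<in> overts X") (force, simp add: alg_def)

text \<open>
  The square of the differential is computed along the unrolled diagram, where it involves at most
  two consecutive letters.
\<close>

lemma Qcx_is_complex:
  assumes X: "pre_hobj A X" shows "is_complex A (Qcx A X)"
  unfolding is_complex_def
proof (intro allI conjI ballI)
  fix n
  show "is_module A (cobj (Qcx A X) n)"
    unfolding is_module_def Qcx_simps
    by (intro conjI ballI)
      (simp_all add: car_closed[OF X] amult_add_left amult_add_right amult_assoc
        amult_one[OF car_alg[OF X]] fun_eq_iff)
  show "mod_hom A (cobj (Qcx A X) n) (cobj (Qcx A X) (n + 1)) (cdif (Qcx A X) n)"
    unfolding mod_hom_def using Qdif_car[OF X] Qdif_add[OF X] Qdif_amult[OF X] by auto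
  fix u show "cdif (Qcx A X) (n + 1) (cdif (Qcx A X) n u) = 0" by (simp add: Qdif_Qdif[OF X])
qed

lemma carD:
  assumes X: "pre_hobj A X" and u: "u \<in> car X n"
  shows "finite {v. u v \<noteq> 0}" "k \<in> wpos (oword X) \<Longrightarrow> u (oix X k) \<in> wcomp (oword X) (odeg X) n k"
    "v \<notin> overts X \<Longrightarrow> u v = 0" "v \<in> overts X \<Longrightarrow> u v \<in> wcomp (oword X) (odeg X) n v"
proof -
  note c = iffD1[OF car_iff[OF X] u]
  show "finite {v. u v \<noteq> 0}" using c by (rule conjunct1)
  show 2: "u (oix X k) \<in> wcomp (oword X) (odeg X) n k" if "k \<in> wpos (oword X)" for k using c that by blast
  show "u v = 0" if "v \<notin> overts X" using c that by blast
  show "u v \<in> wcomp (oword X) (odeg X) n v" if "v \<in> overts X"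
    using 2[OF hobj_oix(5)[OF X that]] hobj_oix(2)[OF X that] by metis
qed

lemma hobj_finite_degree:
  assumes "pre_hobj A X" shows "finite {v \<in> overts X. odeg X v = i}"
proof (cases "finite (overts X)")
  case True
  then show ?thesis by (rule rev_finite_subset) blast
next
  case False
  then obtain w d where X: "X = HStr w d" by (cases X) auto
  have "\<forall>i. finite {k \<in> wpos w. d k = i}"
    using assms False unfolding X pre_hobj.simps overts.simps by blast
  then show ?thesis unfolding X overts.simps odeg.simps by blast
qed

lemma path_elt_trivial:
  assumes x: "x \<in> verts (quiver A)"
  shows "path_elt (x, []) \<in> proj A x" "u \<in> proj A x \<Longrightarrow> amult A u (path_elt (x, [])) = (u :: ('v, 'a, 'k::field) algelt)"
proof -
  show "path_elt (x, []) \<in> proj A x"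
    using trivial_path_nz[OF x] by (auto simp: proj_def alg_def path_elt_def pstart_def)
  assume u: "u \<in> proj A x"
  show "amult A u (path_elt (x, [])) = u"
  proof
    fix p :: "('v, 'a) qpath" obtain y as where p: "p = (y, as)" by (cases p)
    show "amult A u (path_elt (x, [])) p = u p"
    proof (cases "p \<in> nzpaths A")
      case True
      then have nz: "(y, as) \<in> nzpaths A" using p by simp
      have e: "path_elt (x, []) (y, take n as) = (if n = 0 \<and> y = x then 1 else (0 :: 'k))" if "n \<le> length as" for n
        using that by (auto simp: path_elt_def)
      have "amult A u (path_elt (x, [])) (y, as) = (\<Sum>n\<le>length as. if n = 0 then (if y = x then u (y, as) else 0) else 0)"
        unfolding amult_splits[OF nz] using e by (intro sum.cong) auto
      also have "\<dots> = u (y, as)" using u by (auto simp: proj_def pstart_def)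
      finally show ?thesis using p by simp
    next
      case False
      then have "u p = 0" using u unfolding proj_def alg_def by blast
      then show ?thesis using False by (simp add: amult_outside)
    qed
  qed
qed

text \<open>
  The generator of the summand \<open>P(x)\<close> that belongs to the vertex \<open>v\<close> of the diagram. These elements
  generate the complex in each degree, and they are used to test compositions of letters.
\<close>

definition unit_at :: "('v, 'a, 'k::field) hobj \<Rightarrow> int \<Rightarrow> ('v, 'a, 'k) dsum" where
  "unit_at X v = (\<lambda>x. if x = v then path_elt (wvtx (oword X) v, []) else 0)"

lemma unit_at_car:
  assumes X: "pre_hobj A X" and v: "v \<in> overts X"
  shows "unit_at X v \<in> car X (odeg X v)"
proof -
  have "wvtx (oword X) v \<in> verts (quiver A)" using hobj_hword[OF X] hobj_oix(5)[OF X v] hwordD(4) by blast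
  moreover have "odeg X k = odeg X v \<and> wvtx (oword X) k = wvtx (oword X) v" if "oix X k = v" for k
    using hobj_oix(3,4)[OF X] that by metis
  ultimately show ?thesis
    unfolding car_iff[OF X] using path_elt_trivial(1) v by (auto simp: unit_at_def wcomp_def proj_closed)
qed

lemma Qcx_fin_gen:
  fixes X :: "('v, 'a, 'k::field) hobj"
  assumes X: "pre_hobj A X" shows "fin_gen A (cobj (Qcx A X) i)"
proof -
  let ?V = "{v \<in> overts X. odeg X v = i}"
  let ?G = "unit_at X ` ?V"
  have nz: "path_elt p \<noteq> (0 :: ('v, 'a, 'k) algelt)" for p :: "('v, 'a) qpath"
  proof
    assume "path_elt p = (0 :: ('v, 'a, 'k) algelt)"
    from fun_cong[OF this, of p] show False by (simp add: path_elt_def)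
  qed
  have inj: "inj_on (unit_at X) ?V"
  proof (rule inj_onI)
    fix v w assume "(unit_at X v :: ('v, 'a, 'k) dsum) = unit_at X w"
    from fun_cong[OF this, of v] show "v = w"
      using nz[of "(wvtx (oword X) v, [])"] by (cases "v = w") (simp_all add: unit_at_def)
  qed
  have sum_at: "(\<Sum>v\<in>V. f v) x = (\<Sum>v\<in>V. f v x)" for V and f :: "int \<Rightarrow> ('v, 'a, 'k) dsum" and x
    by (induction V rule: infinite_finite_induct) simp_all
  show ?thesis unfolding fin_gen_def
  proof (intro exI[of _ ?G] conjI ballI)
    show "finite ?G" using hobj_finite_degree[OF X] by simp
    show "?G \<subseteq> car X i"
    proof
      fix g assume "g \<in> ?G"
      then obtain v where "g = unit_at X v" "v \<in> overts X" "odeg X v = i" by blast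
      then show "g \<in> car X i" using unit_at_car[OF X, of v] by simp
    qed
    fix u assume u: "u \<in> car X i"
    let ?c = "\<lambda>g. u (the_inv_into ?V (unit_at X) g)"
    have "u = (\<Sum>v\<in>?V. mact (cobj (Qcx A X) i) (u v) (unit_at X v))"
    proof
      fix x
      have S: "(\<Sum>v\<in>?V. (\<lambda>y. amult A (u v) (unit_at X v y))) x = (\<Sum>v\<in>?V. amult A (u v) (unit_at X v x))"
        by (rule sum_at)
      also have "\<dots> = (\<Sum>v\<in>?V. if v = x then amult A (u v) (unit_at X x x) else 0)"
        by (intro sum.cong) (auto simp: unit_at_def)
      also have "\<dots> = (if x \<in> ?V then amult A (u x) (unit_at X x x) else 0)"
        using hobj_finite_degree[OF X] by (simp add: sum.delta')
      also have "\<dots> = u x"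
      proof (cases "x \<in> overts X")
        case True
        then have ux: "u x \<in> wcomp (oword X) (odeg X) i x" by (rule carD(4)[OF X u])
        have "wvtx (oword X) x \<in> verts (quiver A)" using hobj_hword[OF X] hobj_oix(5)[OF X True] hwordD(4) by blast
        then show ?thesis using ux True path_elt_trivial(2) by (auto simp: wcomp_def unit_at_def split: if_splits)
      qed (simp add: carD(3)[OF X u])
      finally show "u x = (\<Sum>v\<in>?V. mact (cobj (Qcx A X) i) (u v) (unit_at X v)) x" by simp
    qed
    also have "\<dots> = (\<Sum>g\<in>?G. mact (cobj (Qcx A X) i) (?c g) g)"
      unfolding sum.reindex[OF inj] o_def by (rule sum.cong[OF refl]) (simp only: the_inv_into_f_f[OF inj])
    finally have eq: "u = (\<Sum>g\<in>?G. mact (cobj (Qcx A X) i) (?c g) g)" .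
    show "\<exists>c. (\<forall>g\<in>?G. c g \<in> alg A) \<and> u = (\<Sum>g\<in>?G. mact (cobj (Qcx A X) i) (c g) g)"
      by (rule exI[of _ ?c], rule conjI[OF _ eq], rule ballI, rule car_alg[OF X u])
  qed
qed

lemma Qcx_bounded_finite:
  assumes X: "pre_hobj A X" and f: "finite (overts X)"
  shows "bounded_cohomology (Qcx A X)"
proof -
  obtain n where n: "\<And>v. v \<in> overts X \<Longrightarrow> \<bar>odeg X v\<bar> \<le> n"
  proof
    fix v assume "v \<in> overts X"
    then show "\<bar>odeg X v\<bar> \<le> Max (insert 0 ((\<lambda>v. \<bar>odeg X v\<bar>) ` overts X))" using f by (intro Max_ge) auto
  qed
  have "cocycles (Qcx A X) i \<subseteq> coboundaries (Qcx A X) i" if i: "\<bar>i\<bar> > n" for i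
  proof
    fix u assume "u \<in> cocycles (Qcx A X) i"
    then have u: "u \<in> car X i" by (simp add: cocycles_def)
    have "u v = 0" for v
    proof (cases "v \<in> overts X")
      case True
      then have "u v \<in> wcomp (oword X) (odeg X) i v" by (rule carD(4)[OF X u])
      moreover have "odeg X v \<noteq> i" using n[OF True] i by auto
      ultimately show ?thesis by (simp add: wcomp_def)
    qed (simp add: carD(3)[OF X u])
    then have "u = 0" by auto
    moreover have "Qdif A X 0 = 0" using Qdif_add[OF X, of 0 0] by simp
    ultimately show "u \<in> coboundaries (Qcx A X) i"
      unfolding coboundaries_def using car_closed(1)[OF X] by (auto simp: image_iff intro!: bexI[of _ 0])
  qed
  then show ?thesis unfolding bounded_cohomology_def by blast
qed

lemma hobj_bounded:
  assumes X: "is_hobj A X" shows "bounded_cohomology (Qcx A X)"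
proof (cases "finite (overts X)")
  case True then show ?thesis by (rule Qcx_bounded_finite[OF hobj_pre[OF X]])
next
  case False
  then obtain w d where "X = HStr w d" by (cases X) auto
  then show ?thesis using X False unfolding \<open>X = _\<close> is_hobj.simps overts.simps by blast
qed

lemma hobj_in_Db: "is_hobj A X \<Longrightarrow> in_Db A (Qcx A X)"
  by (simp add: in_Db_def Qcx_is_complex Qcx_fin_gen hobj_pre hobj_bounded)

lemma pre_hobj_is_hobj:
  assumes "pre_hobj A X" "bounded_cohomology (Qcx A X)" shows "is_hobj A X"
proof (cases X)
  case (HStr w d)
  show ?thesis using assms unfolding HStr is_hobj.simps pre_hobj.simps by blast
qed (use assms in simp)

end

section \<open>Graph maps\<close>

context gentle_algebra begin

text \<open>
  A map that sends the vertex \<open>k\<close> of \<open>w1\<close> to the vertex \<open>k + a\<close> of \<open>w2\<close>, by \<open>G k\<close>, commutes with the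
  differentials iff it does so across each single letter.
\<close>

definition intertwines :: "('v, 'a) word \<Rightarrow> ('v, 'a) word \<Rightarrow> int \<Rightarrow>
    (int \<Rightarrow> ('v, 'a, 'k::field) algelt \<Rightarrow> ('v, 'a, 'k) algelt) \<Rightarrow> bool" where
  "intertwines w1 w2 a G \<longleftrightarrow> (\<forall>k. lin (G k)) \<and>
     (\<forall>k u. fw w2 (k + a) (G k u) = G (k + 1) (fw w1 k u)) \<and>
     (\<forall>k u. bw w2 (k + a) (G (k + 1) u) = G k (bw w1 k u))"

text \<open>
  The components of a graph map that is the identity up to the vertex \<open>r\<close> and ends one vertex later
  with \<open>H\<close>; \<open>lgraph\<close> is the mirror image.
\<close>

definition rgraph :: "int \<Rightarrow> (('v, 'a, 'k::field) algelt \<Rightarrow> ('v, 'a, 'k) algelt) \<Rightarrow>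
    int \<Rightarrow> ('v, 'a, 'k) algelt \<Rightarrow> ('v, 'a, 'k) algelt" where
  "rgraph r H k = (if k \<le> r then (\<lambda>u. u) else if k = r + 1 then H else (\<lambda>u. 0))"

definition lgraph :: "int \<Rightarrow> (('v, 'a, 'k::field) algelt \<Rightarrow> ('v, 'a, 'k) algelt) \<Rightarrow>
    int \<Rightarrow> ('v, 'a, 'k) algelt \<Rightarrow> ('v, 'a, 'k) algelt" where
  "lgraph r H k = (if k \<ge> r then (\<lambda>u. u) else if k = r - 1 then H else (\<lambda>u. 0))"

text \<open>
  Words that agree to the left of \<open>r\<close> and satisfy the end condition at \<open>r\<close> are connected by a graph
  map, whose source is the word that plays the part of \<open>\<tau>\<close> in the end condition. In this
  sense a quasi-graph map is a graph map in the opposite direction.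
\<close>

lemma right_graph_map:
  assumes w: "is_hword A w1" "is_hword A w2" and d: "grading w1 d1" "grading w2 d2"
    and r: "r \<in> wpos w1" "r + a \<in> wpos w2" "d2 (r + a) = d1 r"
    and eq: "\<And>k. k < r \<Longrightarrow> olt w2 (k + a) = olt w1 k"
    and comp: "\<And>n k. k \<le> r \<Longrightarrow> wcomp w2 d2 n (k + a) = (wcomp w1 d1 n k :: ('v, 'a, 'k::field) algelt set)"
    and ends: "right_end_ok A (ltr_right w2 (r + a)) (ltr_right w1 r)"
  obtains H :: "('v, 'a, 'k::field) algelt \<Rightarrow> ('v, 'a, 'k) algelt" where
    "intertwines w1 w2 a (rgraph r H)" "\<And>n k u. u \<in> wcomp w1 d1 n k \<Longrightarrow> rgraph r H k u \<in> wcomp w2 d2 n (k + a)"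
proof -
  have "\<exists>H :: ('v, 'a, 'k) algelt \<Rightarrow> ('v, 'a, 'k) algelt. lin H \<and>
    (\<forall>u. fw w2 (r + a) u = H (fw w1 r u)) \<and> (\<forall>u. bw w2 (r + a) (H u) = bw w1 r u) \<and>
    (\<forall>u. fw w2 (r + a + 1) (H u) = 0) \<and> (\<forall>u. H (bw w1 (r + 1) u) = 0) \<and>
    ((\<forall>u. H u = 0) \<or> (\<exists>b c. olt w2 (r + a) = Some b \<and> olt w1 r = Some c \<and> is_dir b = is_dir c \<and>
       (\<forall>u. H u \<in> proj A (wvtx w2 (r + a + 1)))))"
    using ends hwordD(2)[OF w(1)] hwordD(2)[OF w(2)] hwordD(3)[OF w(1)] hwordD(3)[OF w(2)]
    unfolding ltr_right_olt[OF r(1)] ltr_right_olt[OF r(2)]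
    by (intro right_square) auto
  then obtain H :: "('v, 'a, 'k) algelt \<Rightarrow> ('v, 'a, 'k) algelt" where H: "lin H"
    "\<And>u. fw w2 (r + a) u = H (fw w1 r u)" "\<And>u. bw w2 (r + a) (H u) = bw w1 r u"
    "\<And>u. fw w2 (r + a + 1) (H u) = 0" "\<And>u. H (bw w1 (r + 1) u) = 0"
    "(\<forall>u. H u = 0) \<or> (\<exists>b c. olt w2 (r + a) = Some b \<and> olt w1 r = Some c \<and> is_dir b = is_dir c \<and>
       (\<forall>u. H u \<in> proj A (wvtx w2 (r + a + 1))))" by blast
  have cs: "k < r \<or> k = r \<or> k = r + 1 \<or> k > r + 1" for k by linarith
  have 1: "fw w2 (k + a) (rgraph r H k u) = rgraph r H (k + 1) (fw w1 k u)" for k u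
    using eq[of k] H(2) H(4)[of u] by (auto simp: rgraph_def ac_simps)
  have 2: "bw w2 (k + a) (rgraph r H (k + 1) u) = rgraph r H k (bw w1 k u)" for k u
    using cs[of k] eq[of k] H(3) H(5)[of u] by (auto simp: rgraph_def ac_simps)
  have 3: "rgraph r H k u \<in> wcomp w2 d2 n (k + a)" if u: "u \<in> wcomp w1 d1 n k" for n k u
  proof -
    consider "k \<le> r" | "k = r + 1" "H u \<noteq> 0" | "rgraph r H k u = 0"
      by (cases "k \<le> r"; cases "k = r + 1"; auto simp: rgraph_def)
    then show ?thesis
    proof cases
      case 1 then show ?thesis using u by (simp add: rgraph_def comp)
    next
      case 2
      then have "u \<noteq> 0" using lin_zero[OF H(1)] by auto
      then have n: "d1 (r + 1) = n" using u 2 by (simp add: wcomp_def split: if_splits)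
      obtain b c where bc: "olt w2 (r + a) = Some b" "olt w1 r = Some c" "is_dir b = is_dir c"
        "H u \<in> proj A (wvtx w2 (r + a + 1))" using H(6) 2 by auto
      have "d2 (r + a + 1) = d1 (r + 1)"
        using gradingD[OF d(1) bc(2)] gradingD[OF d(2) bc(1)] bc(3) r(3) by (cases "is_dir c") auto
      moreover have "r + a + 1 \<in> wpos w2" using bc(1) by (auto simp: olt_def split: if_splits)
      ultimately have "H u \<in> wcomp w2 d2 n (r + a + 1)" using bc(4) n by (simp add: wcomp_def)
      moreover have "rgraph r H k u = H u" "k + a = r + a + 1" using 2 by (simp_all add: rgraph_def)
      ultimately show ?thesis by (simp only:)
    qed (simp add: wcomp_closed)
  qed
  show thesis
    using 1 2 3 H(1) lin_id lin_0 by (intro that[of H]) (auto simp: intertwines_def rgraph_def)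
qed

lemma left_graph_map:
  assumes w: "is_hword A w1" "is_hword A w2" and d: "grading w1 d1" "grading w2 d2"
    and r: "r \<in> wpos w1" "r + a \<in> wpos w2" "d2 (r + a) = d1 r"
    and eq: "\<And>k. k \<ge> r \<Longrightarrow> olt w2 (k + a) = olt w1 k"
    and comp: "\<And>n k. k \<ge> r \<Longrightarrow> wcomp w2 d2 n (k + a) = (wcomp w1 d1 n k :: ('v, 'a, 'k::field) algelt set)"
    and ends: "left_end_ok A (ltr_left w2 (r + a)) (ltr_left w1 r)"
  obtains H :: "('v, 'a, 'k::field) algelt \<Rightarrow> ('v, 'a, 'k) algelt" where
    "intertwines w1 w2 a (lgraph r H)" "\<And>n k u. u \<in> wcomp w1 d1 n k \<Longrightarrow> lgraph r H k u \<in> wcomp w2 d2 n (k + a)"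
proof -
  have "\<exists>H :: ('v, 'a, 'k) algelt \<Rightarrow> ('v, 'a, 'k) algelt. lin H \<and>
    (\<forall>u. bw w2 (r + a - 1) u = H (bw w1 (r - 1) u)) \<and> (\<forall>u. fw w2 (r + a - 1) (H u) = fw w1 (r - 1) u) \<and>
    (\<forall>u. bw w2 (r + a - 2) (H u) = 0) \<and> (\<forall>u. H (fw w1 (r - 2) u) = 0) \<and>
    ((\<forall>u. H u = 0) \<or> (\<exists>b c. olt w2 (r + a - 1) = Some b \<and> olt w1 (r - 1) = Some c \<and> is_dir b = is_dir c \<and>
       (\<forall>u. H u \<in> proj A (wvtx w2 (r + a - 1)))))"
    using ends hwordD(2)[OF w(1), of "r - 1"] hwordD(2)[OF w(2), of "r + a - 1"]
      hwordD(2)[OF w(1), of "r - 2"] hwordD(2)[OF w(2), of "r + a - 2"]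
      hwordD(3)[OF w(1), of "r - 2"] hwordD(3)[OF w(2), of "r + a - 2"]
    unfolding ltr_left_olt[OF r(1)] ltr_left_olt[OF r(2)]
    by (intro left_square[where x = "wvtx w2 (r + a)" and x' = "wvtx w1 r" and y' = "wvtx w1 (r - 1)"
          and z = "wvtx w2 (r + a - 2)" and z' = "wvtx w1 (r - 2)"]) (auto simp: algebra_simps)
  then obtain H :: "('v, 'a, 'k) algelt \<Rightarrow> ('v, 'a, 'k) algelt" where H: "lin H"
    "\<And>u. bw w2 (r + a - 1) u = H (bw w1 (r - 1) u)" "\<And>u. fw w2 (r + a - 1) (H u) = fw w1 (r - 1) u"
    "\<And>u. bw w2 (r + a - 2) (H u) = 0" "\<And>u. H (fw w1 (r - 2) u) = 0"
    "(\<forall>u. H u = 0) \<or> (\<exists>b c. olt w2 (r + a - 1) = Some b \<and> olt w1 (r - 1) = Some c \<and> is_dir b = is_dir c \<and>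
       (\<forall>u. H u \<in> proj A (wvtx w2 (r + a - 1))))" by blast
  have cs: "k \<ge> r \<or> k = r - 1 \<or> k = r - 2 \<or> k < r - 2" for k by linarith
  have 1: "fw w2 (k + a) (lgraph r H k u) = lgraph r H (k + 1) (fw w1 k u)" for k u
    using cs[of k] eq[of k] H(3)[of u] H(5)[of u] by (auto simp: lgraph_def algebra_simps)
  have 2: "bw w2 (k + a) (lgraph r H (k + 1) u) = lgraph r H k (bw w1 k u)" for k u
    using cs[of k] eq[of k] H(2)[of u] H(4)[of u] by (auto simp: lgraph_def algebra_simps)
  have 3: "lgraph r H k u \<in> wcomp w2 d2 n (k + a)" if u: "u \<in> wcomp w1 d1 n k" for n k u
  proof -
    consider "k \<ge> r" | "k = r - 1" "H u \<noteq> 0" | "lgraph r H k u = 0"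
      by (cases "k \<ge> r"; cases "k = r - 1"; auto simp: lgraph_def)
    then show ?thesis
    proof cases
      case 1 then show ?thesis using u by (simp add: lgraph_def comp)
    next
      case 2
      then have "u \<noteq> 0" using lin_zero[OF H(1)] by auto
      then have n: "d1 (r - 1) = n" using u 2 by (simp add: wcomp_def split: if_splits)
      obtain b c where bc: "olt w2 (r + a - 1) = Some b" "olt w1 (r - 1) = Some c" "is_dir b = is_dir c"
        "H u \<in> proj A (wvtx w2 (r + a - 1))" using H(6) 2 by auto
      have "d2 (r + a - 1) = d1 (r - 1)"
        using gradingD[OF d(1) bc(2)] gradingD[OF d(2) bc(1)] bc(3) r(3) by (cases "is_dir c") auto
      moreover have "r + a - 1 \<in> wpos w2" using bc(1) by (auto simp: olt_def split: if_splits)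
      ultimately have "H u \<in> wcomp w2 d2 n (r + a - 1)" using bc(4) n by (simp add: wcomp_def)
      moreover have "lgraph r H k u = H u" "k + a = r + a - 1" using 2 by (simp_all add: lgraph_def)
      ultimately show ?thesis by (simp only:)
    qed (simp add: wcomp_closed)
  qed
  show thesis
    using 1 2 3 H(1) lin_id lin_0 by (intro that[of H]) (auto simp: intertwines_def lgraph_def)
qed

end

section \<open>Inserting one turn of a band into a string\<close>

text \<open>
  \<open>ins t j b e L\<close> is \<open>t\<close> up to the vertex \<open>j\<close>, continues with the letters of \<open>b\<close> between the vertices
  \<open>j + e\<close> and \<open>j + e + L\<close>, and then with the rest of \<open>t\<close>. Vertices and letters switch
  at the same numbers, so the vertex that begins a part is taken from that part.
\<close>

definition ins :: "('v, 'a) word \<Rightarrow> int \<Rightarrow> ('v, 'a) word \<Rightarrow> int \<Rightarrow> int \<Rightarrow> ('v, 'a) word" where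
  "ins t j b e L = \<lparr>
     wpos = {k. if k < j then k \<in> wpos t else k < j + L \<or> k - L \<in> wpos t},
     wvtx = (\<lambda>k. if k < j then wvtx t k else if k < j + L then wvtx b (k + e) else wvtx t (k - L)),
     wltr = (\<lambda>k. if k < j then wltr t k else if k < j + L then wltr b (k + e) else wltr t (k - L))\<rparr>"

text \<open>
  The string \<open>t\<close> and the \<open>L\<close>-periodic word \<open>b\<close> of the band agree, including degrees, on the overlap
  \<open>{j..j + l}\<close>, where the vertex \<open>k\<close> of \<open>t\<close> corresponds to the vertex \<open>k + e\<close> of \<open>b\<close>. The length \<open>l\<close> may
  exceed \<open>L\<close>. The last two assumptions concern overlaps that are a single vertex, where a letter of
  \<open>t\<close> becomes a neighbour of a letter of \<open>b\<close>.
\<close>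

locale insertion = gentle_algebra A for A :: "('v, 'a) bound_quiver" +
  fixes t b :: "('v, 'a) word" and j e L l :: int and dt db :: "int \<Rightarrow> int"
  assumes t: "is_hword A t" and b: "is_hword A b" and bpos: "wpos b = UNIV"
    and dt: "grading t dt" and db: "grading b db"
    and dt_fin: "infinite (wpos t) \<Longrightarrow> (\<exists>n. \<forall>k \<in> wpos t. dt k \<le> n) \<and> (\<forall>i. finite {k \<in> wpos t. dt k = i})"
    and L: "L > 0" and l: "0 \<le> l"
    and per: "\<And>k. wvtx b (k + L) = wvtx b k" "\<And>k. wltr b (k + L) = wltr b k" "\<And>k. db (k + L) = db k"
    and tpos: "{j..j + l} \<subseteq> wpos t"
    and ov: "\<And>k. j \<le> k \<Longrightarrow> k \<le> j + l \<Longrightarrow> wvtx t k = wvtx b (k + e)"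
      "\<And>k. j \<le> k \<Longrightarrow> k < j + l \<Longrightarrow> wltr t k = wltr b (k + e)"
      "\<And>k. j \<le> k \<Longrightarrow> k \<le> j + l \<Longrightarrow> dt k = db (k + e)"
    and jl: "\<And>a. l = 0 \<Longrightarrow> olt t (j - 1) = Some a \<Longrightarrow> junction_ok A a (wltr b (j + e))"
    and jr: "\<And>a. l = 0 \<Longrightarrow> olt t j = Some a \<Longrightarrow> junction_ok A (wltr b (j + e - 1)) a"
begin

abbreviation c :: "('v, 'a) word" where "c \<equiv> ins t j b e L"

definition dc :: "int \<Rightarrow> int" where
  "dc k = (if k < j then dt k else if k < j + L then db (k + e) else dt (k - L))"

lemma j_in: "j \<in> wpos t" and jl_in: "j + l \<in> wpos t"
  using tpos l by auto

text \<open>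
  The word \<open>c\<close> agrees with \<open>b\<close> on the inserted turn and on the second copy of the overlap. There, \<open>c\<close>
  is defined by \<open>t\<close>, and periodicity brings \<open>b\<close> back to the overlap.
\<close>

lemma c_mid:
  assumes "j \<le> k" "k \<le> j + L + l"
  shows "k \<in> wpos c" "wvtx c k = wvtx b (k + e)" "dc k = db (k + e)"
    "k < j + L + l \<Longrightarrow> wltr c k = wltr b (k + e)"
proof -
  have "k < j + L \<or> (j \<le> k - L \<and> k - L \<le> j + l)" using assms by linarith
  moreover have "k - L \<in> wpos t" if "j \<le> k - L" "k - L \<le> j + l" using that tpos by auto
  ultimately show "k \<in> wpos c" using assms by (auto simp: ins_def)
  show "wvtx c k = wvtx b (k + e)" "dc k = db (k + e)"
    using assms ov(1,3)[of "k - L"] per(1,3)[of "k - L + e"] by (auto simp: ins_def dc_def algebra_simps)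
  show "wltr c k = wltr b (k + e)" if "k < j + L + l"
    using assms that ov(2)[of "k - L"] per(2)[of "k - L + e"] by (auto simp: ins_def algebra_simps)
qed

lemma c_left:
  assumes "k \<le> j + l"
  shows "k \<in> wpos c \<longleftrightarrow> k \<in> wpos t" "wvtx c k = wvtx t k" "dc k = dt k"
    "k < j + l \<Longrightarrow> wltr c k = wltr t k"
proof -
  have "k < j \<or> (j \<le> k \<and> k \<le> j + L + l)" using assms L by linarith
  then show "k \<in> wpos c \<longleftrightarrow> k \<in> wpos t" "wvtx c k = wvtx t k" "dc k = dt k"
    using assms c_mid[of k] ov[of k] tpos by (auto simp: ins_def dc_def)
  show "wltr c k = wltr t k" if "k < j + l"
    using that assms c_mid(4)[of k] ov(2)[of k] L by (cases "k < j") (auto simp: ins_def)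
qed

lemma c_right:
  assumes "j \<le> k"
  shows "k + L \<in> wpos c \<longleftrightarrow> k \<in> wpos t" "wvtx c (k + L) = wvtx t k" "dc (k + L) = dt k"
    "wltr c (k + L) = wltr t k"
  using assms L by (auto simp: ins_def dc_def)

lemma olt_mid: "j \<le> k \<Longrightarrow> k < j + L + l \<Longrightarrow> olt c k = olt b (k + e)"
  using c_mid[of k] c_mid(1)[of "k + 1"] by (simp add: olt_def bpos)

lemma olt_left: "k < j + l \<Longrightarrow> olt c k = olt t k"
  using c_left[of k] c_left(1)[of "k + 1"] by (simp add: olt_def)

lemma olt_right: "j \<le> k \<Longrightarrow> olt c (k + L) = olt t k"
  using c_right[of k] c_right(1)[of "k + 1"] by (simp add: olt_def algebra_simps)

lemma c_olt_letter:
  assumes "olt c k = Some a"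
  shows "letter_ok A (wvtx c k) a (wvtx c (k + 1)) \<and> (if is_dir a then dc (k + 1) = dc k + 1 else dc k = dc (k + 1) + 1)"
proof -
  consider "k < j" | "j \<le> k" "k < j + L" | "j \<le> k - L" by linarith
  then show ?thesis
  proof cases
    case 1
    then show ?thesis
      using assms olt_left[of k] c_left[of k] c_left[of "k + 1"] hwordD(2)[OF t] gradingD[OF dt] l by simp
  next
    case 2
    then show ?thesis
      using assms olt_mid[of k] c_mid[of k] c_mid[of "k + 1"] hwordD(2)[OF b, of "k + e"] gradingD[OF db, of "k + e"] l
      by (simp add: algebra_simps)
  next
    case 3
    then show ?thesis
      using assms olt_right[of "k - L"] c_right[of "k - L"] c_right[of "k - L + 1"]
        hwordD(2)[OF t, of "k - L" a] gradingD[OF dt, of "k - L" a] by (auto simp: algebra_simps)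
  qed
qed

text \<open>
  If the overlap has a letter, the ranges on which \<open>c\<close> agrees with \<open>t\<close>, with \<open>b\<close>, and with the shifted
  \<open>t\<close> overlap in at least one letter, so every junction lies in one of them.
\<close>

lemma c_junction:
  assumes "olt c k = Some a" "olt c (k + 1) = Some a'"
  shows "junction_ok A a a'"
proof -
  consider "k + 1 < j + l" | "j \<le> k" "k + 1 < j + L + l" | "j \<le> k - L"
    | "l = 0" "k = j - 1" | "l = 0" "k = j + L - 1" "k \<ge> j" using l L by linarith
  then show ?thesis
  proof cases
    case 1
    then show ?thesis using assms olt_left[of k] olt_left[of "k + 1"] hwordD(3)[OF t] by simp
  next
    case 2
    then show ?thesis using assms olt_mid[of k] olt_mid[of "k + 1"] hwordD(3)[OF b, of "k + e"] by (simp add: algebra_simps)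
  next
    case 3
    then show ?thesis
      using assms olt_right[of "k - L"] olt_right[of "k + 1 - L"] hwordD(3)[OF t, of "k - L"] by (simp add: algebra_simps)
  next
    case 4
    have "olt t (j - 1) = Some a" using assms(1) olt_left[of "j - 1"] 4 by simp
    moreover have "a' = wltr b (j + e)" using assms(2) olt_mid[of j] 4 L by (simp add: olt_def bpos)
    ultimately show ?thesis using jl 4 by simp
  next
    case 5
    have "olt t j = Some a'" using assms(2) olt_right[of j] 5 by simp
    moreover have "a = wltr b (j + e - 1)"
      using assms(1) olt_mid[of k] 5 L per(2)[of "j + e - 1"] by (simp add: olt_def bpos algebra_simps)
    ultimately show ?thesis using jr 5 by simp
  qed
qed

lemma interval_c: "interval (wpos c)"
  unfolding interval_def
proof (intro conjI ballI subsetI)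
  show "wpos c \<noteq> {}" using c_mid(1)[of j] L l by auto
  fix x y m assume x: "x \<in> wpos c" and y: "y \<in> wpos c" and m: "m \<in> {x..y}"
  have ti: "\<And>p q r. p \<in> wpos t \<Longrightarrow> q \<in> wpos t \<Longrightarrow> p \<le> r \<Longrightarrow> r \<le> q \<Longrightarrow> r \<in> wpos t"
    using hwordD(1)[OF t] unfolding interval_def by (meson atLeastAtMost_iff subsetD)
  consider "m < j" | "j \<le> m" "m < j + L" | "j + L \<le> m" by linarith
  then show "m \<in> wpos c"
  proof cases
    case 1
    then have "x \<in> wpos t" using x m by (auto simp: ins_def)
    then have "m \<in> wpos t" using ti[OF _ j_in] 1 m by auto
    then show ?thesis using 1 by (simp add: ins_def)
  next
    case 3
    then have "y - L \<in> wpos t" using y m L by (auto simp: ins_def)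
    then have "m - L \<in> wpos t" using ti[OF j_in, of "y - L" "m - L"] 3 m by auto
    then show ?thesis using 3 L by (auto simp: ins_def)
  qed (simp add: ins_def)
qed

lemma hword_c: "is_hword A c"
  unfolding is_hword_def
proof (intro conjI ballI allI impI)
  fix k assume k: "k \<in> wpos c"
  consider "k < j" | "j \<le> k" "k < j + L" | "j \<le> k - L" by linarith
  then show "wvtx c k \<in> verts (quiver A)"
    using k hwordD(4)[OF t] hwordD(4)[OF b] bpos by cases (auto simp: ins_def)
next
  fix k assume "{k, k + 1} \<subseteq> wpos c"
  then show "letter_ok A (wvtx c k) (wltr c k) (wvtx c (k + 1))"
    using c_olt_letter[of k "wltr c k"] by (simp add: olt_def)
next
  fix k assume "{k, k + 1, k + 2} \<subseteq> wpos c"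
  then show "junction_ok A (wltr c k) (wltr c (k + 1))"
    using c_junction[of k "wltr c k" "wltr c (k + 1)"] by (simp add: olt_def add.commute)
qed (rule interval_c)

lemma grading_c: "grading c dc"
  unfolding grading_def
proof (intro allI impI)
  fix k assume "{k, k + 1} \<subseteq> wpos c"
  then show "if is_dir (wltr c k) then dc (k + 1) = dc k + 1 else dc k = dc (k + 1) + 1"
    using c_olt_letter[of k "wltr c k"] by (simp add: olt_def)
qed

lemma wpos_c_cover: "wpos c \<subseteq> wpos t \<union> {j..<j + L} \<union> (\<lambda>k. k + L) ` wpos t"
proof
  fix k assume k: "k \<in> wpos c"
  have "k \<in> (\<lambda>k. k + L) ` wpos t" if "k - L \<in> wpos t"
    using that by (intro image_eqI[of _ _ "k - L"]) auto
  then show "k \<in> wpos t \<union> {j..<j + L} \<union> (\<lambda>k. k + L) ` wpos t"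
    using k by (auto simp: ins_def split: if_splits)
qed

lemma pre_hobj_c: "pre_hobj A (HStr c dc)"
  unfolding pre_hobj.simps
proof (intro conjI impI hword_c grading_c)
  assume inf: "infinite (wpos c)"
  have inf_t: "infinite (wpos t)"
  proof
    assume "finite (wpos t)"
    then have "finite (wpos t \<union> {j..<j + L} \<union> (\<lambda>k. k + L) ` wpos t)" by blast
    then show False using inf wpos_c_cover finite_subset by blast
  qed
  have cs: "dc k = dt k \<and> k \<in> wpos t \<or> k \<in> {j..<j + L} \<or> (k - L \<in> wpos t \<and> dc k = dt (k - L))" if "k \<in> wpos c" for k
    using that by (auto simp: ins_def dc_def split: if_splits)
  obtain n where n: "\<forall>k \<in> wpos t. dt k \<le> n" using dt_fin[OF inf_t] by blast
  show "\<exists>n. \<forall>k\<in>wpos c. dc k \<le> n"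
  proof (intro exI ballI)
    fix k assume "k \<in> wpos c"
    have "k \<in> {j..<j + L} \<Longrightarrow> dc k \<le> Max (dc ` {j..<j + L})" by (intro Max_ge) auto
    moreover have "dc k \<le> n \<or> k \<in> {j..<j + L}" using cs[OF \<open>k \<in> wpos c\<close>] n by metis
    ultimately show "dc k \<le> max n (Max (dc ` {j..<j + L}))" by linarith
  qed
  show "\<forall>i. finite {k \<in> wpos c. dc k = i}"
  proof
    fix i
    have "{k \<in> wpos c. dc k = i} \<subseteq> {k \<in> wpos t. dt k = i} \<union> {j..<j + L} \<union> (\<lambda>k. k + L) ` {k \<in> wpos t. dt k = i}"
    proof
      fix k assume k: "k \<in> {k \<in> wpos c. dc k = i}"
      then have "k - L \<in> {k \<in> wpos t. dt k = i} \<Longrightarrow> k \<in> (\<lambda>k. k + L) ` {k \<in> wpos t. dt k = i}"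
        by (intro image_eqI[of _ _ "k - L"]) auto
      then show "k \<in> {k \<in> wpos t. dt k = i} \<union> {j..<j + L} \<union> (\<lambda>k. k + L) ` {k \<in> wpos t. dt k = i}"
        using cs[of k] k by (auto simp del: image_iff)
    qed
    moreover have "finite ({k \<in> wpos t. dt k = i} \<union> {j..<j + L} \<union> (\<lambda>k. k + L) ` {k \<in> wpos t. dt k = i})"
      using dt_fin[OF inf_t] by blast
    ultimately show "finite {k \<in> wpos c. dc k = i}" by (rule finite_subset)
  qed
qed

lemma wcomp_left: "k \<le> j + l \<Longrightarrow> wcomp c dc n k = wcomp t dt n k"
  by (simp add: wcomp_def c_left)
lemma wcomp_right: "j \<le> k \<Longrightarrow> wcomp c dc n (k + L) = wcomp t dt n k"
  by (simp add: wcomp_def c_right)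
lemma wcomp_mid: "j \<le> k \<Longrightarrow> k \<le> j + L + l \<Longrightarrow> wcomp c dc n k = wcomp b db n (k + e)"
  by (simp add: wcomp_def c_mid bpos)

lemma ends_c:
  "ltr_right c (j + l) = ltr_right b (j + l + e)" "ltr_left c (j + L) = ltr_left b (j + e)"
proof -
  have "j + l \<in> wpos c" "j + L \<in> wpos c" using c_mid(1) l L by auto
  then show "ltr_right c (j + l) = ltr_right b (j + l + e)" "ltr_left c (j + L) = ltr_left b (j + e)"
    using olt_mid[of "j + l"] olt_mid[of "j + L - 1"] l L per(2)[of "j + e - 1"]
    by (simp_all add: ltr_right_olt ltr_left_olt bpos olt_def algebra_simps)
qed

text \<open>
  The two graph maps from \<open>t\<close> to \<open>c\<close>, one for each copy of the overlap in \<open>c\<close>, and then the two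
  graph maps from \<open>c\<close> to \<open>t\<close>. In either direction the first one follows \<open>t\<close> from the left and ends
  with the first copy, the second one follows the shifted \<open>t\<close> from the right and ends with the
  second copy.
\<close>

lemma right_into_c:
  assumes "right_end_ok A (ltr_right b (j + l + e)) (ltr_right t (j + l))"
  obtains H :: "('v, 'a, 'k::field) algelt \<Rightarrow> ('v, 'a, 'k) algelt" where
    "intertwines t c 0 (rgraph (j + l) H)" "\<And>n k u. u \<in> wcomp t dt n k \<Longrightarrow> rgraph (j + l) H k u \<in> wcomp c dc n k"
  by (rule right_graph_map[OF t hword_c dt grading_c, of "j + l" 0, where 'k = 'k])
    (use assms ends_c(1) c_left jl_in in \<open>auto simp: olt_left wcomp_left\<close>)

lemma left_into_c:
  assumes "left_end_ok A (ltr_left b (j + e)) (ltr_left t j)"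
  obtains H :: "('v, 'a, 'k::field) algelt \<Rightarrow> ('v, 'a, 'k) algelt" where
    "intertwines t c L (lgraph j H)" "\<And>n k u. u \<in> wcomp t dt n k \<Longrightarrow> lgraph j H k u \<in> wcomp c dc n (k + L)"
  by (rule left_graph_map[OF t hword_c dt grading_c, of j L, where 'k = 'k])
    (use assms ends_c(2) c_right j_in in \<open>auto simp: olt_right wcomp_right\<close>)

lemma right_from_c:
  assumes "right_end_ok A (ltr_right t (j + l)) (ltr_right b (j + l + e))"
  obtains H :: "('v, 'a, 'k::field) algelt \<Rightarrow> ('v, 'a, 'k) algelt" where
    "intertwines c t 0 (rgraph (j + l) H)" "\<And>n k u. u \<in> wcomp c dc n k \<Longrightarrow> rgraph (j + l) H k u \<in> wcomp t dt n k"
  by (rule right_graph_map[OF hword_c t grading_c dt, of "j + l" 0, where 'k = 'k])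
    (use assms ends_c(1) c_left jl_in in \<open>auto simp: olt_left wcomp_left\<close>)

lemma left_from_c:
  assumes "left_end_ok A (ltr_left t j) (ltr_left b (j + e))"
  obtains H :: "('v, 'a, 'k::field) algelt \<Rightarrow> ('v, 'a, 'k) algelt" where
    "intertwines c t (- L) (lgraph (j + L) H)"
    "\<And>n k u. u \<in> wcomp c dc n (k + L) \<Longrightarrow> lgraph (j + L) H (k + L) u \<in> wcomp t dt n k"
proof (rule left_graph_map[OF hword_c t grading_c dt, of "j + L" "- L", where 'k = 'k])
  fix k n assume k: "j + L \<le> k"
  show "olt t (k + - L) = olt c k" using olt_right[of "k - L"] k by simp
  have "wcomp c dc n (k - L + L) = (wcomp t dt n (k - L) :: ('v, 'a, 'k) algelt set)"
    by (rule wcomp_right) (use k in simp)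
  then show "wcomp t dt n (k + - L) = (wcomp c dc n k :: ('v, 'a, 'k) algelt set)" by simp
next
  fix H :: "('v, 'a, 'k) algelt \<Rightarrow> ('v, 'a, 'k) algelt"
  assume H: "intertwines c t (- L) (lgraph (j + L) H)"
    "\<And>n k u. u \<in> wcomp c dc n k \<Longrightarrow> lgraph (j + L) H k u \<in> wcomp t dt n (k + - L)"
  show thesis by (rule that[OF H(1)]) (use H(2)[of _ _ "_ + L"] in simp)
qed (use assms ends_c(2) c_right j_in in auto)

end

section \<open>The cone of a map from a band to a string\<close>

context gentle_algebra begin

lemma carI:
  assumes X: "pre_hobj A X" and "finite {v. u v \<noteq> 0}"
    and "\<And>v. v \<in> overts X \<Longrightarrow> u v \<in> wcomp (oword X) (odeg X) n v" and "\<And>v. v \<notin> overts X \<Longrightarrow> u v = 0"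
  shows "u \<in> car X n"
proof (rule iffD2[OF car_iff[OF X]], intro conjI ballI allI impI)
  fix k assume k: "k \<in> wpos (oword X)"
  have "wcomp (oword X) (odeg X) n (oix X k) = (wcomp (oword X) (odeg X) n k :: ('v, 'a, 'b) algelt set)"
    using hobj_oix(3,4,5)[OF X] hobj_oix(1)[OF X k] k by (simp add: wcomp_def)
  then show "u (oix X k) \<in> wcomp (oword X) (odeg X) n k" using assms(3)[OF hobj_oix(1)[OF X k]] by simp
qed (use assms in blast)+

lemma carI_str:
  fixes u :: "('v, 'a, 'k::field) dsum"
  assumes X: "pre_hobj A (HStr w d :: ('v, 'a, 'k) hobj)" and "finite {v. u v \<noteq> 0}" and "\<And>v. u v \<in> wcomp w d n v"
  shows "u \<in> car (HStr w d) n"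
  by (rule iffD2[OF car_iff_str[OF X]], intro conjI allI) (use assms in blast)+

lemma carD_str:
  fixes u :: "('v, 'a, 'k::field) dsum"
  assumes X: "pre_hobj A (HStr w d :: ('v, 'a, 'k) hobj)" and u: "u \<in> car (HStr w d) n"
  shows "finite {v. u v \<noteq> 0}" "u v \<in> wcomp w d n v"
  using iffD1[OF car_iff_str[OF X] u] by blast+

definition sdif :: "('v, 'a) word \<Rightarrow> ('v, 'a, 'k::field) dsum \<Rightarrow> ('v, 'a, 'k) dsum" where
  "sdif w u v = fw w (v - 1) (u (v - 1)) + bw w v (u (v + 1))"

lemma Qdif_sdif:
  fixes u :: "('v, 'a, 'k::field) dsum"
  assumes X: "pre_hobj A (HStr w d :: ('v, 'a, 'k) hobj)"
  shows "Qdif A (HStr w d) u = sdif w u"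
  using Qdif_str[OF X] by (auto simp: sdif_def)

lemma sdif_linear:
  "sdif w (\<lambda>m. u m + v m) m = sdif w u m + sdif w v m"
  "sdif w (\<lambda>m. u m - v m) m = sdif w u m - sdif w v m"
  "sdif w (\<lambda>m. scl a (u m)) m = scl a (sdif w u m)"
  by (simp_all add: sdif_def lin_add[OF lin_fwo] lin_add[OF lin_bwo] lin_diff[OF lin_fwo] lin_diff[OF lin_bwo]
      lin_scl[OF lin_fwo] lin_scl[OF lin_bwo] scl_add)

lemma intertwines_sdif:
  assumes G: "intertwines w1 w2 a G"
  shows "sdif w2 (\<lambda>m. G (m - a) (u (m - a))) m = G (m - a) (sdif w1 u (m - a))"
proof -
  have lin: "lin (G k)" for k using G by (simp add: intertwines_def)
  have 1: "fw w2 (k + a) (G k u) = G (k + 1) (fw w1 k u)" and 2: "bw w2 (k + a) (G (k + 1) u) = G k (bw w1 k u)" for k u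
    using G by (simp_all add: intertwines_def)
  show ?thesis
    using 1[of "m - 1 - a" "u (m - 1 - a)"] 2[of "m - a" "u (m - a + 1)"]
    by (simp add: sdif_def lin_add[OF lin] algebra_simps)
qed

lemma left_end_map_eq:
  fixes u :: "('v, 'a, 'k::field) dsum"
  assumes i: "i \<in> wpos (oword X)" and j: "j \<in> wpos (oword Y)"
  shows "left_end_map A X Y i j u v =
    (if v = oix Y j then scl (ocoef X (oix X (i - 1))) (fw (oword X) (i - 1) (u (oix X (i - 1)))) else 0) +
    (if v = oix Y (j - 1) then scl (ocoef Y (oix Y (j - 1))) (bw (oword Y) (j - 1) (u (oix X i))) else 0)"
  unfolding left_end_map_def ltr_left_olt[OF i] ltr_left_olt[OF j]
  by (auto simp: pmap_eq fwo_def bwo_def split: option.splits letter.splits)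

end

lemma mod_hom_inj:
  assumes M: "is_module A M" and h: "mod_hom A M N h" and ker: "\<And>x. x \<in> mcar M \<Longrightarrow> h x = 0 \<Longrightarrow> x = 0"
  shows "inj_on h (mcar M)"
proof (rule inj_onI)
  fix x y assume x: "x \<in> mcar M" and y: "y \<in> mcar M" and e: "h x = h y"
  have "h (x + - y) = 0" using mod_homD(2)[OF h x is_moduleD(3)[OF M y]] mod_hom_minus[OF M h y] e by simp
  then have "x + - y = 0" using ker is_moduleD(2)[OF M x is_moduleD(3)[OF M y]] by blast
  then show "x = y" by simp
qed

text \<open>
  Both isomorphisms are triangular, so that preimages are determined vertex by vertex, by a recursion
  along the positions in \<open>c\<close>.
\<close>

lemma wf_recursion:
  fixes \<mu> :: "'i \<Rightarrow> nat"
  assumes "\<And>k. \<not> P k \<Longrightarrow> \<mu> (nx k) < \<mu> k"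
  shows "\<exists>y. \<forall>k. y k = (if P k then base k else F k (y (nx k)))"
proof -
  let ?R = "\<lambda>y k. if P k then base k else F k (y (nx k))"
  have "wfrec (measure \<mu>) ?R k = ?R (wfrec (measure \<mu>) ?R) k" for k
    using assms[of k] by (subst wfrec[OF wf_measure]) (simp add: cut_apply)
  then show ?thesis by blast
qed

text \<open>
  Rescaling the vertices of the unrolled band by \<open>\<theta>\<close> multiplies the coefficient of the letter \<open>k\<close> by
  \<open>\<theta> (k + 1) / \<theta> k\<close> or by its inverse, according to the direction of the letter, so the
  coefficients can be prescribed. The price is the factor \<open>q\<close> that \<open>\<theta>\<close> picks up in a turn; for
  a band complex it is the band parameter, up to inversion and sign.
\<close>

lemma multiplicative_primitive:
  fixes \<nu> :: "int \<Rightarrow> 'k::field"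
  assumes \<nu>: "\<And>k. \<nu> k \<noteq> 0" and x: "x \<noteq> 0"
  obtains \<theta> q where "\<And>k. \<theta> k \<noteq> 0" "q \<noteq> 0" "\<theta> i = x" "\<theta> (i + L) = x * q" "\<And>k. i \<le> k \<Longrightarrow> \<theta> (k + 1) = \<theta> k * \<nu> k"
proof (rule that[of "\<lambda>k. x * (\<Prod>m\<in>{i..<k}. \<nu> m)" "\<Prod>m\<in>{i..<i + L}. \<nu> m"])
  fix k assume "i \<le> k"
  then have "{i..<k + 1} = insert k {i..<k}" by auto
  then show "x * (\<Prod>m\<in>{i..<k + 1}. \<nu> m) = x * (\<Prod>m\<in>{i..<k}. \<nu> m) * \<nu> k" by (simp add: mult.commute)
qed (use assms in simp_all)

context insertion begin

text \<open>
  The vertex of the inserted turn in \<open>c\<close> that comes from the vertex \<open>v\<close> of the cyclic diagram.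
\<close>

definition copy_pos :: "int \<Rightarrow> int" where
  "copy_pos v = j + (v - j - e) mod L"

lemma copy_pos_range: "j \<le> copy_pos v" "copy_pos v < j + L"
  using L by (simp_all add: copy_pos_def)

lemma copy_pos_mod: "(copy_pos v + e) mod L = v mod L"
proof -
  have "(copy_pos v + e) mod L = ((v - j - e) mod L + (j + e)) mod L" by (simp add: copy_pos_def algebra_simps)
  also have "\<dots> = (v - j - e + (j + e)) mod L" by (rule mod_add_left_eq)
  finally show ?thesis by simp
qed

lemma copy_pos_unique:
  assumes "j \<le> m" "m < j + L" shows "copy_pos ((m + e) mod L) = m"
proof -
  have "((m + e) mod L - j - e) mod L = ((m + e) mod L - (j + e)) mod L" by (simp add: algebra_simps)
  also have "\<dots> = (m + e - (j + e)) mod L" by (rule mod_diff_left_eq)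
  also have "\<dots> = m - j" using assms by simp
  finally show ?thesis by (simp add: copy_pos_def)
qed

text \<open>
  The isomorphism \<open>(x, y) \<mapsto> T x + V y\<close>. Here \<open>T\<close> puts \<open>x\<close>, rescaled by \<open>\<theta>\<close>, on the inserted turn, and
  \<open>V = q V\<^sub>2 - V\<^sub>1\<close> is made of the two graph maps from \<open>t\<close> to \<open>c\<close>.
\<close>

lemma band_to_string_iso:
  fixes lam c0 :: "'k::field" and X Y :: "('v, 'a, 'k) hobj"
  assumes X: "X = HBnd \<sigma> d\<sigma> lam k0" "pre_hobj A X" and Y: "Y = HStr t dt" "pre_hobj A Y"
    and bX: "b = unroll \<sigma>" and LX: "L = wlen \<sigma>" and dbX: "db = (\<lambda>k. odeg X k - 1)" and c0: "c0 \<noteq> 0"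
    and right: "right_end_ok A (ltr_right b (j + l + e)) (ltr_right t (j + l))"
    and left: "left_end_ok A (ltr_left b (j + e)) (ltr_left t j)"
  shows "\<exists>\<psi>. chain_iso A (cone (Qcx A X) (Qcx A Y) (\<lambda>n u v p. c0 * left_end_map A X Y (j + e) j u v p))
    (Qcx A (HStr c dc)) \<psi>"
proof -
  obtain H :: "('v, 'a, 'k) algelt \<Rightarrow> ('v, 'a, 'k) algelt" where H: "intertwines t c 0 (rgraph (j + l) H)"
    "\<And>n k u. u \<in> wcomp t dt n k \<Longrightarrow> rgraph (j + l) H k u \<in> wcomp c dc n k"
    using right_into_c[OF right] by blast
  obtain G :: "('v, 'a, 'k) algelt \<Rightarrow> ('v, 'a, 'k) algelt" where G: "intertwines t c L (lgraph j G)"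
    "\<And>n k u. u \<in> wcomp t dt n k \<Longrightarrow> lgraph j G k u \<in> wcomp c dc n (k + L)"
    using left_into_c[OF left] by blast
  let ?rg = "rgraph (j + l) H" and ?lg = "lgraph j G"
  have linr: "lin (?rg k)" and linl: "lin (?lg k)" for k using H(1) G(1) by (simp_all add: intertwines_def)
  have ch: "pre_hobj A (HStr c dc :: ('v, 'a, 'k) hobj)" by (rule pre_hobj_c)
  define i where "i = j + e"
  have ow: "oword X = b" "oword Y = t" "odeg Y = dt" "oix X = (\<lambda>k. k mod L)" "oix Y = (\<lambda>k. k)" "\<And>k. ocoef Y k = 1"
    using X Y bX LX by auto
  have ov: "overts X = {0..<L}" using X LX by simp
  define \<kappa> where "\<kappa> k = ocoef X (k mod L)" for k
  have \<kappa>0: "\<kappa> k \<noteq> 0" for k using X by (auto simp: \<kappa>_def)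
  have \<kappa>L: "\<kappa> (k + L) = \<kappa> k" for k by (simp add: \<kappa>_def)
  \<comment> \<open>the recursion that makes \<open>T\<close> anticommute with the differential along every letter of the turn;
    the sign is the one of the differential of the shifted complex in the cone\<close>
  define \<nu> where "\<nu> k = (if is_dir (wltr b k) then - 1 / \<kappa> k else - \<kappa> k)" for k
  have \<nu>0: "\<nu> k \<noteq> 0" for k using \<kappa>0 by (simp add: \<nu>_def)
  \<comment> \<open>the value at \<open>i\<close> is forced by the component of \<open>V f\<^sub>0\<close> at the left end of the overlap\<close>
  obtain \<theta> q where \<theta>0: "\<And>k. \<theta> k \<noteq> 0" and q0: "q \<noteq> 0" and \<theta>i: "\<theta> i = - c0" and "\<theta> (i + L) = - c0 * q"
    and \<theta>Suc: "\<And>k. i \<le> k \<Longrightarrow> \<theta> (k + 1) = \<theta> k * \<nu> k"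
    using multiplicative_primitive[of \<nu> "- c0" i L] \<nu>0 c0 by auto
  then have \<theta>iL: "\<theta> (i + L) = - (q * c0)" by (simp add: mult.commute)
  have F: "scl (\<theta> k) (fw b k z) = scl (- (\<kappa> k * \<theta> (k + 1))) (fw b k z)"
    and B: "scl (\<theta> (k + 1)) (bw b k z) = scl (- (\<theta> k * \<kappa> k)) (bw b k z)" if "i \<le> k" for k z
    using \<theta>Suc[OF that] \<kappa>0[of k] bpos
    by (auto simp: \<nu>_def olt_def is_dir_def fwo_def bwo_def split: letter.splits)
  define T where "T x m = (if j \<le> m \<and> m < j + L then scl (\<theta> (m + e)) (x ((m + e) mod L)) else 0)"
    for x :: "('v, 'a, 'k) dsum" and m
  define V where "V y m = scl q (?lg (m - L) (y (m - L))) - ?rg m (y m)" for y :: "('v, 'a, 'k) dsum" and m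
  define f0 where "f0 x v = scl c0 (left_end_map A X Y i j x v)" for x v
  define \<psi> where "\<psi> (n :: int) = (\<lambda>(x, y). (\<lambda>m. T x m + V y m))" for n
  have iX: "i \<in> wpos (oword X)" and jY: "j \<in> wpos (oword Y)" using ow bpos j_in by auto
  have V_sdif: "sdif c (V y) m = V (sdif t y) m" for y m
    unfolding V_def sdif_linear
    using intertwines_sdif[OF G(1), of y m] intertwines_sdif[OF H(1), of y m] by simp
  have V_add: "V (y + y') m = V y m + V y' m" for y y' m
    by (simp add: V_def lin_add[OF linl] lin_add[OF linr] scl_add)
  have V_amult: "V (\<lambda>m. amult A a (y m)) m = amult A a (V y m)" for a y m
    using amult_add_right[of a "scl q (?lg (m - L) (y (m - L)))" "- ?rg m (y m)"] lin_minus[OF linr]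
      lin_amult[OF linr, of m a "- y m"]
    by (simp add: V_def lin_amult[OF linl] lin_amult[OF linr] amult_scl_right)
       (metis amult_scl_right scl_minus_1 lin_amult[OF linr])
  have T_add: "T (x + x') m = T x m + T x' m" for x x' m by (simp add: T_def scl_add)
  have T_minus: "T (- x) m = - T x m" for x m by (simp add: T_def scl_uminus)
  have T_amult: "T (\<lambda>m. amult A a (x m)) m = amult A a (T x m)" for a x m by (simp add: T_def amult_scl_right)
  have olt_bL: "olt b (k + L) = olt b k" for k using per(2) by (simp add: olt_def bpos)
  \<comment> \<open>the defect of \<open>T\<close>: inside the turn the terms cancel; what remains are the
    letters of \<open>c\<close> into and out of the inserted turn, and the closing letter of the cyclic diagram\<close>
  have key: "sdif c (T x) m + T (Qdif A X x) m = V (f0 x) m" for x m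
  proof -
    define P where "P k = fw b (k - 1) (x ((k - 1) mod L))" for k
    define R where "R k = bw b k (x ((k + 1) mod L))" for k
    have PL: "P (k + L) = P k" and RL: "R (k + L) = R k" for k
      using olt_bL[of "k - 1"] olt_bL[of k] mod_add_self2[of "k - 1" L] mod_add_self2[of "k + 1" L]
      by (simp_all add: P_def R_def algebra_simps)
    let ?k = "m + e"
    let ?R0 = "bw t (j - 1) (x (i mod L))"
    have Q: "Qdif A X x (?k mod L) = scl (\<kappa> (?k - 1)) (P ?k) + scl (\<kappa> ?k) (R ?k)"
      using Qdif_line[OF X(2), of ?k x] ow bpos by (simp add: P_def R_def \<kappa>_def)
    have f0: "f0 x v = (if v = j then scl (c0 * \<kappa> (i - 1)) (P i) else 0) + (if v = j - 1 then scl c0 ?R0 else 0)" for v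
      unfolding f0_def left_end_map_eq[OF iX jY] using ow by (auto simp: P_def \<kappa>_def scl_add)
    \<comment> \<open>an inverse letter to the left of the overlap in \<open>t\<close> continues by \<open>g\<close> to the one in \<open>b\<close>\<close>
    have gR: "G ?R0 = R (i - 1)"
    proof -
      have "bw c (j - 1 + L) (?lg j (x (i mod L))) = ?lg (j - 1) (bw t (j - 1) (x (i mod L)))"
        using G(1) unfolding intertwines_def by (metis diff_add_cancel)
      then have "G ?R0 = bw c (j - 1 + L) (x (i mod L))" by (simp add: lgraph_def)
      also have "olt c (j - 1 + L) = olt b (j - 1 + L + e)" using L l by (intro olt_mid) auto
      also have "\<dots> = olt b (i - 1)" using olt_bL[of "i - 1"] by (simp add: i_def algebra_simps)
      finally show ?thesis by (simp add: R_def)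
    qed
    have Vf: "V (f0 x) m = (if m = j + L then scl (q * c0 * \<kappa> (i - 1)) (P i) else 0) - (if m = j then scl (c0 * \<kappa> (i - 1)) (P i) else 0)
       + ((if m = j + L - 1 then scl (q * c0) (R (i - 1)) else 0) - (if m = j - 1 then scl c0 ?R0 else 0))"
    proof -
      have 1: "?lg (m - L) (f0 x (m - L)) = (if m = j + L then scl (c0 * \<kappa> (i - 1)) (P i) else 0) + (if m = j + L - 1 then scl c0 (R (i - 1)) else 0)"
      proof -
        consider "m - L = j" | "m - L = j - 1" | "m - L \<noteq> j" "m - L \<noteq> j - 1" by blast
        then show ?thesis
        proof cases
          case 1 then show ?thesis by (simp add: f0 lgraph_def algebra_simps)
        next
          case 2
          have "G (scl c0 ?R0) = scl c0 (G ?R0)" using lin_scl[OF linl[of "j - 1"]] by (simp add: lgraph_def)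
          then show ?thesis using 2 gR by (simp add: f0 lgraph_def algebra_simps)
        next
          case 3 then show ?thesis using lin_zero[OF linl] by (auto simp: f0)
        qed
      qed
      have 2: "?rg m (f0 x m) = f0 x m"
        using lin_zero[OF linr, of m] l by (cases "m \<le> j") (auto simp: f0 rgraph_def)
      show ?thesis unfolding V_def 1 2 by (auto simp: f0 scl_add algebra_simps)
    qed
    have Fpart: "fw c (m - 1) (T x (m - 1)) + (if j \<le> m \<and> m < j + L then scl (\<theta> ?k * \<kappa> (?k - 1)) (P ?k) else 0)
       = (if m = j + L then scl (q * c0 * \<kappa> (i - 1)) (P i) else 0) - (if m = j then scl (c0 * \<kappa> (i - 1)) (P i) else 0)"
    proof -
      have f: "fw c (m - 1) (T x (m - 1)) = (if j < m \<and> m \<le> j + L then scl (- (\<kappa> (?k - 1) * \<theta> ?k)) (P ?k) else 0)"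
      proof (cases "j < m \<and> m \<le> j + L")
        case True
        then have "olt c (m - 1) = olt b (m - 1 + e)" using l by (intro olt_mid) auto
        moreover have "T x (m - 1) = scl (\<theta> (?k - 1)) (x ((?k - 1) mod L))" using True by (simp add: T_def algebra_simps)
        ultimately have "fw c (m - 1) (T x (m - 1)) = scl (\<theta> (?k - 1)) (P ?k)"
          by (simp add: lin_scl[OF lin_fwo] P_def algebra_simps)
        also have "\<dots> = scl (- (\<kappa> (?k - 1) * \<theta> ?k)) (P ?k)" unfolding P_def using F[of "?k - 1"] True by (simp add: i_def)
        finally show ?thesis using True by simp
      next
        case False
        then have "T x (m - 1) = 0" by (auto simp: T_def)
        then show ?thesis using False by (simp only: fwo_0 if_False)
      qed
      consider "m = j" | "j < m" "m < j + L" | "m = j + L" | "m < j" | "m > j + L" by linarith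
      then show ?thesis
      proof cases
        case 1 then show ?thesis unfolding f using L \<theta>i by (simp add: i_def scl_minus)
      next
        case 2 then show ?thesis unfolding f by (simp add: scl_minus mult.commute)
      next
        case 3
        then have k: "?k = i + L" by (simp add: i_def)
        show ?thesis unfolding f k using 3 L \<theta>iL PL[of i] \<kappa>L[of "i - 1"] by (simp add: algebra_simps)
      qed (use L in \<open>auto simp: f\<close>)
    qed
    have Bpart: "bw c m (T x (m + 1)) + (if j \<le> m \<and> m < j + L then scl (\<theta> ?k * \<kappa> ?k) (R ?k) else 0)
       = (if m = j + L - 1 then scl (q * c0) (R (i - 1)) else 0) - (if m = j - 1 then scl c0 ?R0 else 0)"
    proof -
      have out: "bw c m (T x (m + 1)) = 0" if "m < j - 1 \<or> m \<ge> j + L - 1"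
      proof -
        have "T x (m + 1) = 0" using that by (auto simp: T_def)
        then show ?thesis by (simp only: bwo_0)
      qed
      consider "m = j - 1" "L > 0" | "j \<le> m" "m < j + L - 1" | "m = j + L - 1" | "m < j - 1" | "m > j + L - 1" using L by linarith
      then show ?thesis
      proof cases
        case 1
        have "olt c (j - 1) = olt t (j - 1)" using l by (intro olt_left) auto
        then show ?thesis using 1 \<theta>i by (simp add: T_def i_def lin_scl[OF lin_bwo] lin_minus[OF lin_bwo] scl_minus)
      next
        case 2
        have o: "olt c m = olt b ?k" using l 2 by (intro olt_mid) auto
        have "T x (m + 1) = scl (\<theta> (?k + 1)) (x ((?k + 1) mod L))" using 2 by (simp add: T_def algebra_simps)
        then have "bw c m (T x (m + 1)) = scl (\<theta> (?k + 1)) (R ?k)" by (simp add: o lin_scl[OF lin_bwo] R_def)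
        also have "\<dots> = - scl (\<theta> ?k * \<kappa> ?k) (R ?k)" unfolding R_def using B[of ?k] 2 by (simp add: i_def scl_minus)
        finally show ?thesis using 2 by simp
      next
        case 3
        then have k: "?k = i - 1 + L" "?k + 1 = i + L" "i \<le> ?k" using L by (simp_all add: i_def)
        have "scl (\<theta> ?k * \<kappa> ?k) (R ?k) = - scl (\<theta> (?k + 1)) (R ?k)"
          unfolding R_def using B[OF k(3)] by (simp add: scl_minus)
        also have "\<dots> = scl (q * c0) (R (i - 1))" using RL[of "i - 1"] \<theta>iL k(2) unfolding k(1) by (simp add: scl_minus)
        finally show ?thesis using out 3 L by simp
      next
        case 4 then show ?thesis using out[of] L by simp
      next
        case 5 then show ?thesis using out[of] L by simp
      qed
    qed
    have "sdif c (T x) m + T (Qdif A X x) m = (fw c (m - 1) (T x (m - 1)) + (if j \<le> m \<and> m < j + L then scl (\<theta> ?k * \<kappa> (?k - 1)) (P ?k) else 0))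
      + (bw c m (T x (m + 1)) + (if j \<le> m \<and> m < j + L then scl (\<theta> ?k * \<kappa> ?k) (R ?k) else 0))"
      unfolding sdif_def T_def[of "Qdif A X x"] Q by (simp add: scl_add)
    then show ?thesis unfolding Fpart Bpart Vf .
  qed
  let ?f = "\<lambda>(n::int) u v p. c0 * left_end_map A X Y (j + e) j u v p"
  have ff: "?f n x = f0 x" for n x by (auto simp: f0_def scl_def i_def)
  let ?M = "cone (Qcx A X) (Qcx A Y) ?f"
  have dbw: "wcomp b db n k = (wcomp b (odeg X) (n + 1) k :: ('v, 'a, 'k) algelt set)" for n k
    by (auto simp: wcomp_def dbX)
  have comp: "\<psi> n (x, y) m \<in> wcomp c dc n m" if x: "x \<in> car X (n + 1)" and y: "y \<in> car Y n" for n x y m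
  proof -
    have "T x m \<in> wcomp c dc n m"
    proof (cases "j \<le> m \<and> m < j + L")
      case True
      have "x ((m + e) mod L) \<in> wcomp b (odeg X) (n + 1) (m + e)" using carD(2)[OF X(2) x, of "m + e"] ow bpos by simp
      then have "x ((m + e) mod L) \<in> wcomp b db n (m + e)" by (simp add: dbw)
      then show ?thesis using True l by (simp add: T_def wcomp_closed wcomp_mid)
    qed (auto simp: T_def wcomp_closed)
    moreover have yk: "y k \<in> wcomp t dt n k" for k using carD_str(2)[OF Y(2)[unfolded Y(1)]] y Y(1) by blast
    then have "?lg (m - L) (y (m - L)) \<in> wcomp c dc n m" "?rg m (y m) \<in> wcomp c dc n m"
      using G(2)[OF yk[of "m - L"]] H(2)[OF yk[of m]] by simp_all
    ultimately show ?thesis by (simp add: \<psi>_def V_def wcomp_closed wcomp_minus)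
  qed
  have mem: "\<psi> n (x, y) \<in> car (HStr c dc) n" if x: "x \<in> car X (n + 1)" and y: "y \<in> car Y n" for n x y
  proof (rule carI_str[OF ch _ comp[OF x y]])
    have fy: "finite {v. y v \<noteq> 0}" by (rule carD(1)[OF Y(2) y])
    have "{m. \<psi> n (x, y) m \<noteq> 0} \<subseteq> {j..<j + L} \<union> ((\<lambda>k. k + L) ` {v. y v \<noteq> 0} \<union> {v. y v \<noteq> 0})"
    proof
      fix m assume m: "m \<in> {m. \<psi> n (x, y) m \<noteq> 0}"
      have "m \<in> (\<lambda>k. k + L) ` {v. y v \<noteq> 0}" if "y (m - L) \<noteq> 0" using that by (intro image_eqI[of _ _ "m - L"]) auto
      moreover have "j \<le> m \<and> m < j + L \<or> y (m - L) \<noteq> 0 \<or> y m \<noteq> 0"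
      proof (rule ccontr)
        assume "\<not> ?thesis"
        then show False using m lin_zero[OF linr, of m] lin_zero[OF linl, of "m - L"] by (auto simp: \<psi>_def T_def V_def)
      qed
      ultimately show "m \<in> {j..<j + L} \<union> ((\<lambda>k. k + L) ` {v. y v \<noteq> 0} \<union> {v. y v \<noteq> 0})"
        unfolding Un_iff mem_Collect_eq atLeastLessThan_iff by blast
    qed
    moreover have "finite ({j..<j + L} \<union> ((\<lambda>k. k + L) ` {v. y v \<noteq> 0} \<union> {v. y v \<noteq> 0}))"
      by (intro finite_UnI finite_atLeastLessThan_int finite_imageI fy)
    ultimately show "finite {m. \<psi> n (x, y) m \<noteq> 0}" by (rule finite_subset)
  qed
  have hom: "mod_hom A (cobj ?M n) (cobj (Qcx A (HStr c dc)) n) (\<psi> n)" for n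
    unfolding mod_hom_def
  proof (intro conjI ballI)
    fix z assume "z \<in> mcar (cobj ?M n)"
    then show "\<psi> n z \<in> car (HStr c dc) n" using mem[of "fst z" n "snd z"] by auto
  next
    fix z z' show "\<psi> n (z + z') = \<psi> n z + \<psi> n z'"
    proof
      fix m show "\<psi> n (z + z') m = (\<psi> n z + \<psi> n z') m"
        by (cases z; cases z') (simp add: \<psi>_def T_add V_add)
    qed
  next
    fix a :: "('v, 'a, 'k) algelt" and z
    show "\<psi> n (mact (cobj ?M n) a z) = mact (cobj (Qcx A (HStr c dc)) n) a (\<psi> n z)"
      by (cases z) (auto simp: \<psi>_def T_amult V_amult amult_add_right)
  qed
  have chain: "\<psi> (n + 1) (cdif ?M n z) = cdif (Qcx A (HStr c dc)) n (\<psi> n z)" for n z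
  proof -
    obtain x y where z: "z = (x, y)" by (cases z)
    have "sdif c (\<lambda>m. T x m + V y m) m = - T (Qdif A X x) m + (V (f0 x) m + V (sdif t y) m)" for m
      unfolding sdif_linear V_sdif key[symmetric] by simp
    moreover have "cdif ?M n (x, y) = (- Qdif A X x, f0 x + Qdif A Y y)" by (simp add: ff)
    moreover have "Qdif A Y y = sdif t y" by (simp add: Y(1) Qdif_sdif[OF Y(2)[unfolded Y(1)]])
    ultimately show ?thesis
      unfolding z Qcx_simps Qdif_sdif[OF ch] by (intro ext[of "\<psi> (n + 1) _"]) (simp add: \<psi>_def T_minus V_add)
  qed
  have lg0: "?lg k z = 0" if "k < j - 1" for k z using that by (simp add: lgraph_def)
  have rg0: "?rg k z = 0" if "k > j + l + 1" for k z using that by (simp add: rgraph_def)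
  have rgid: "?rg k z = z" if "k < j" for k z using that l by (simp add: rgraph_def)
  have lgid: "?lg k z = z" if "k \<ge> j" for k z using that l by (simp add: lgraph_def)
  \<comment> \<open>at a vertex \<open>m \<ge> j + L\<close> the image is \<open>q y (m - L)\<close> minus a term that depends on \<open>y m\<close>, so \<open>y\<close>
    vanishes from right to left; left of \<open>j\<close> the image is \<open>- y\<close>\<close>
  have ker: "z = 0" if z: "z \<in> mcar (cobj ?M n)" and 0: "\<psi> n z = 0" for n z
  proof -
    obtain x y where xy: "z = (x, y)" "x \<in> car X (n + 1)" "y \<in> car Y n" using z by auto
    have TV: "T x m + V y m = 0" for m using fun_cong[OF 0, of m] by (simp add: xy \<psi>_def)
    have y0: "y k = 0" for k
    proof (induction "nat (j + l + 2 - k)" arbitrary: k rule: less_induct)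
      case less
      show ?case
      proof (cases "k < j")
        case True
        then show ?thesis using TV[of k] L by (simp add: T_def V_def lg0 rgid)
      next
        case False
        then have "scl q (y k) = ?rg (k + L) (y (k + L))" using TV[of "k + L"] L by (simp add: T_def V_def lgid)
        also have "\<dots> = 0"
        proof (cases "k + L > j + l + 1")
          case True then show ?thesis by (rule rg0)
        next
          case False
          then have "y (k + L) = 0" using L by (intro less) auto
          then show ?thesis using lin_zero[OF linr] by simp
        qed
        finally show ?thesis using q0 by simp
      qed
    qed
    have "x v = 0" for v
    proof (cases "v \<in> overts X")
      case True
      have "V y (copy_pos v) = 0" using y0 lin_zero[OF linr] lin_zero[OF linl] by (simp add: V_def)
      then have "T x (copy_pos v) = 0" using TV[of "copy_pos v"] by simp
      then show ?thesis using copy_pos_range[of v] copy_pos_mod[of v] True \<theta>0 by (simp add: T_def ov)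
    qed (rule carD(3)[OF X(2) xy(2)])
    then show ?thesis using y0 by (auto simp: xy zero_prod_def fun_eq_iff)
  qed
  have surj: "\<exists>z' \<in> mcar (cobj ?M n). \<psi> n z' = z" if z: "z \<in> car (HStr c dc) n" for n z
  proof -
    have zk: "z k \<in> wcomp c dc n k" for k by (rule carD_str(2)[OF ch z])
    have fz: "finite {v. z v \<noteq> 0}" by (rule carD_str(1)[OF ch z])
    have "\<exists>y. \<forall>k. y k = (if k < j \<or> k + L > j + l + 1 then (if k < j then - z k else scl (1 / q) (z (k + L)))
        else scl (1 / q) (z (k + L) + ?rg (k + L) (y (k + L))))"
      using L by (intro wf_recursion[where \<mu> = "\<lambda>k. nat (j + l + 2 - k)"]) auto
    then obtain y where y: "\<And>k. y k = (if k < j \<or> k + L > j + l + 1 then (if k < j then - z k else scl (1 / q) (z (k + L)))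
        else scl (1 / q) (z (k + L) + ?rg (k + L) (y (k + L))))" by blast
    have y1: "y k = - z k" if "k < j" for k using that y[of k] by simp
    have y2: "y k = scl (1 / q) (z (k + L) + ?rg (k + L) (y (k + L)))" if "k \<ge> j" for k
      using that y[of k] rg0[of "k + L"] by (cases "k + L > j + l + 1") auto
    have yk: "y k \<in> wcomp t dt n k" for k
    proof (induction "nat (j + l + 2 - k)" arbitrary: k rule: less_induct)
      case less
      show ?case
      proof (cases "k < j")
        case True
        then show ?thesis using zk[of k] l by (simp add: y1 wcomp_minus wcomp_left)
      next
        case False
        then have *: "z (k + L) \<in> wcomp t dt n k" using zk[of "k + L"] by (simp add: wcomp_right)
        have "?rg (k + L) (y (k + L)) \<in> wcomp t dt n k"
        proof (cases "k + L > j + l + 1")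
          case True then show ?thesis by (simp add: rg0 wcomp_closed)
        next
          case f: False
          then have "y (k + L) \<in> wcomp t dt n (k + L)" using L by (intro less) auto
          then show ?thesis using H(2)[of "y (k + L)" n "k + L"] False by (simp add: wcomp_right)
        qed
        then show ?thesis using False * by (simp add: y2 wcomp_closed)
      qed
    qed
    have fin_y: "finite {v. y v \<noteq> 0}"
    proof (rule finite_subset)
      show "{v. y v \<noteq> 0} \<subseteq> {j..j + l + 1} \<union> ({v. z v \<noteq> 0} \<union> {v. z (v + L) \<noteq> 0})"
      proof
        fix v assume v: "v \<in> {v. y v \<noteq> 0}"
        have "v \<in> {j..j + l + 1} \<or> z v \<noteq> 0 \<or> z (v + L) \<noteq> 0"
        proof (rule ccontr)
          assume n: "\<not> ?thesis"
          then have "v < j \<or> v > j + l + 1" by auto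
          then have "y v = 0" using n y1[of v] y2[of v] rg0[of "v + L"] L l by auto
          then show False using v by simp
        qed
        then show "v \<in> {j..j + l + 1} \<union> ({v. z v \<noteq> 0} \<union> {v. z (v + L) \<noteq> 0})"
          unfolding Un_iff mem_Collect_eq by blast
      qed
      show "finite ({j..j + l + 1} \<union> ({v. z v \<noteq> 0} \<union> {v. z (v + L) \<noteq> 0}))"
        by (intro finite_UnI finite_atLeastAtMost_int fz finite_shift)
    qed
    have yY: "y \<in> car Y n" unfolding Y(1) by (rule carI_str[OF Y(2)[unfolded Y(1)] fin_y yk])
    define x where "x v = (if v \<in> overts X then scl (1 / \<theta> (copy_pos v + e)) (z (copy_pos v) - V y (copy_pos v)) else 0)" for v
    have Vk: "V y m \<in> wcomp c dc n m" for m
      using G(2)[OF yk[of "m - L"]] H(2)[OF yk[of m]] by (simp add: V_def wcomp_closed wcomp_minus)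
    have xX: "x \<in> car X (n + 1)"
    proof (rule carI[OF X(2)])
      show "finite {v. x v \<noteq> 0}"
      proof (rule finite_subset)
        show "{v. x v \<noteq> 0} \<subseteq> {0..<L}" by (auto simp: x_def ov split: if_splits)
      qed (rule finite_atLeastLessThan_int)
      fix v assume v: "v \<in> overts X"
      then have "x v \<in> wcomp c dc n (copy_pos v)" using zk Vk by (simp add: x_def wcomp_closed wcomp_minus)
      then have "x v \<in> wcomp b db n (copy_pos v + e)" using copy_pos_range[of v] l by (simp add: wcomp_mid)
      then have "x v \<in> wcomp b (odeg X) (n + 1) (copy_pos v + e)" by (simp add: dbw)
      moreover have "wvtx b (copy_pos v + e) = wvtx b v" "odeg X (copy_pos v + e) = odeg X v"
        using copy_pos_mod[of v] v by (simp_all add: bX X(1) LX)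
      ultimately show "x v \<in> wcomp (oword X) (odeg X) (n + 1) v"
        unfolding ow by (simp only: wcomp_def bpos UNIV_I simp_thms)
    qed (simp add: x_def)
    have "T x m + V y m = z m" for m
    proof (cases "j \<le> m \<and> m < j + L")
      case True
      have "(m + e) mod L \<in> overts X" using L by (simp add: ov)
      then have "x ((m + e) mod L) = scl (1 / \<theta> (m + e)) (z m - V y m)" using True by (simp add: x_def copy_pos_unique)
      then show ?thesis using True \<theta>0[of "m + e"] by (simp add: T_def)
    next
      case False
      then have T0: "T x m = 0" by (auto simp: T_def)
      show ?thesis
      proof (cases "m < j")
        case True
        then show ?thesis using T0 L by (simp add: V_def lg0 rgid y1)
      next
        case f: False
        then have "m - L \<ge> j" using False by auto
        then show ?thesis using T0 y2[of "m - L"] q0 by (simp add: V_def lgid)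
      qed
    qed
    then have "\<psi> n (x, y) = z" by (auto simp: \<psi>_def)
    then show ?thesis using xX yY by (intro bexI[of _ "(x, y)"]) auto
  qed
  have "bij_betw (\<psi> n) (mcar (cobj ?M n)) (car (HStr c dc) n)" for n
    unfolding bij_betw_def
  proof
    have "is_module A (cobj ?M n)"
      using is_complexD(1)[OF Qcx_is_complex[OF X(2)], of "n + 1"] is_complexD(1)[OF Qcx_is_complex[OF Y(2)], of n]
      unfolding is_module_def by (auto simp: zero_prod_def)
    then show "inj_on (\<psi> n) (mcar (cobj ?M n))" using hom ker by (rule mod_hom_inj)
    show "\<psi> n ` mcar (cobj ?M n) = car (HStr c dc) n"
      using mod_homD(1)[OF hom] surj by blast
  qed
  then have "chain_iso A ?M (Qcx A (HStr c dc)) \<psi>"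
    using hom chain unfolding chain_iso_def chain_map_def by blast
  then show ?thesis by blast
qed

end

section \<open>The cone of a map from a string to a band\<close>

context insertion begin

text \<open>
  The dual construction: \<open>z \<mapsto> (W z, T z)\<close>, where \<open>W = q W\<^sub>2 - W\<^sub>1\<close> is made of the two graph maps from \<open>c\<close> to
  \<open>t\<close>, and \<open>T\<close> restricts to the inserted turn and rescales by \<open>\<theta>\<close>. Now the sign of the shifted
  differential concerns the string, and it is absorbed into the factor \<open>(-1)\<^sup>n\<close> in degree \<open>n\<close>.
\<close>

lemma string_to_band_iso:
  fixes mu c0 :: "'k::field" and X Y :: "('v, 'a, 'k) hobj"
  assumes X: "X = HStr t d0" "pre_hobj A X" and Y: "Y = HBnd \<tau> d\<tau> mu k0" "pre_hobj A Y"
    and bY: "b = unroll \<tau>" and LY: "L = wlen \<tau>" and dbY: "db = odeg Y" and dtX: "dt = (\<lambda>k. d0 k - 1)"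
    and c0: "c0 \<noteq> 0"
    and right: "right_end_ok A (ltr_right t (j + l)) (ltr_right b (j + l + e))"
    and left: "left_end_ok A (ltr_left t j) (ltr_left b (j + e))"
  shows "\<exists>\<phi>. chain_iso A (Qcx A (HStr c dc))
    (cone (Qcx A X) (Qcx A Y) (\<lambda>n u v p. c0 * left_end_map A X Y j (j + e) u v p)) \<phi>"
proof -
  obtain H :: "('v, 'a, 'k) algelt \<Rightarrow> ('v, 'a, 'k) algelt" where H: "intertwines c t 0 (rgraph (j + l) H)"
    "\<And>n k u. u \<in> wcomp c dc n k \<Longrightarrow> rgraph (j + l) H k u \<in> wcomp t dt n k"
    using right_from_c[OF right] by blast
  obtain G :: "('v, 'a, 'k) algelt \<Rightarrow> ('v, 'a, 'k) algelt" where G: "intertwines c t (- L) (lgraph (j + L) G)"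
    "\<And>n k u. u \<in> wcomp c dc n (k + L) \<Longrightarrow> lgraph (j + L) G (k + L) u \<in> wcomp t dt n k"
    using left_from_c[OF left] by blast
  let ?rg = "rgraph (j + l) H" and ?lg = "lgraph (j + L) G"
  have linr: "lin (?rg k)" and linl: "lin (?lg k)" for k using H(1) G(1) by (simp_all add: intertwines_def)
  have ch: "pre_hobj A (HStr c dc :: ('v, 'a, 'k) hobj)" by (rule pre_hobj_c)
  define i where "i = j + e"
  have ow: "oword X = t" "oword Y = b" "odeg X = d0" "oix Y = (\<lambda>k. k mod L)" "oix X = (\<lambda>k. k)" "\<And>k. ocoef X k = 1"
    using X Y bY LY by auto
  have ov: "overts Y = {0..<L}" using Y LY by simp
  define \<kappa> where "\<kappa> k = ocoef Y (k mod L)" for k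
  have \<kappa>0: "\<kappa> k \<noteq> 0" for k using Y by (auto simp: \<kappa>_def)
  have \<kappa>L: "\<kappa> (k + L) = \<kappa> k" for k by (simp add: \<kappa>_def)
  define sg where "sg n = (if even n then 1 else - 1 :: 'k)" for n :: int
  have sg1: "sg (n + 1) = - sg n" "sg n * sg n = 1" "sg n \<noteq> 0" for n by (simp_all add: sg_def)
  define \<nu> where "\<nu> k = (if is_dir (wltr b k) then \<kappa> k else 1 / \<kappa> k)" for k
  \<comment> \<open>the degree of the left end of the overlap fixes the sign with which \<open>f\<^sub>0\<close> enters\<close>
  define \<theta>0 where "\<theta>0 = c0 * sg (dc j)"
  have \<nu>0: "\<nu> k \<noteq> 0" for k using \<kappa>0 by (simp add: \<nu>_def)
  have "\<theta>0 \<noteq> 0" using c0 sg1(3) by (simp add: \<theta>0_def)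
  then obtain \<theta> q where \<theta>n0: "\<And>k. \<theta> k \<noteq> 0" and q0: "q \<noteq> 0" and \<theta>i: "\<theta> i = \<theta>0" and \<theta>iL: "\<theta> (i + L) = \<theta>0 * q"
    and \<theta>Suc: "\<And>k. i \<le> k \<Longrightarrow> \<theta> (k + 1) = \<theta> k * \<nu> k"
    using multiplicative_primitive[of \<nu> \<theta>0 i L] \<nu>0 by metis
  have F: "scl (\<kappa> k * \<theta> k) (fw b k z) = scl (\<theta> (k + 1)) (fw b k z)"
    and B: "scl (\<kappa> k * \<theta> (k + 1)) (bw b k z) = scl (\<theta> k) (bw b k z)" if "i \<le> k" for k z
    using \<theta>Suc[OF that] \<kappa>0[of k] bpos
    by (auto simp: \<nu>_def olt_def is_dir_def fwo_def bwo_def mult.commute split: letter.splits)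
  define T where "T z v = (if v \<in> overts Y then scl (\<theta> (copy_pos v + e)) (z (copy_pos v)) else 0)"
    for z :: "('v, 'a, 'k) dsum" and v
  define W where "W z k = scl q (?lg (k + L) (z (k + L))) - ?rg k (z k)" for z :: "('v, 'a, 'k) dsum" and k
  define f0 where "f0 x v = scl c0 (left_end_map A X Y j i x v)" for x v
  define \<phi> where "\<phi> (n :: int) z = (\<lambda>k. scl (sg n) (W z k), T z)" for n z
  have jX: "j \<in> wpos (oword X)" and iY: "i \<in> wpos (oword Y)" using ow bpos j_in by auto
  have W_sdif: "sdif t (W z) k = W (sdif c z) k" for z k
    unfolding W_def sdif_linear
    using intertwines_sdif[OF G(1), of z k] intertwines_sdif[OF H(1), of z k] by simp
  have W_add: "W (z + z') k = W z k + W z' k" for z z' k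
    by (simp add: W_def lin_add[OF linl] lin_add[OF linr] scl_add)
  have W_amult: "W (\<lambda>m. amult A a (z m)) k = amult A a (W z k)" for a z k
  proof -
    have "amult A a (u - v) = amult A a u - amult A a v" for u v :: "('v, 'a, 'k) algelt"
      using amult_add_right[of a u "- v"] amult_scl_right[of a "- 1" v] by (simp add: scl_minus_1)
    then show ?thesis by (simp add: W_def lin_amult[OF linl] lin_amult[OF linr] amult_scl_right)
  qed
  have T_add: "T (z + z') v = T z v + T z' v" for z z' v by (simp add: T_def scl_add)
  have T_amult: "T (\<lambda>m. amult A a (z m)) v = amult A a (T z v)" for a z v by (simp add: T_def amult_scl_right)
  have olt_bL: "olt b (k + L) = olt b k" for k using per(2) by (simp add: olt_def bpos)
  have Tk: "T z ((m + e) mod L) = scl (\<theta> (m + e)) (z m)" if "j \<le> m" "m < j + L" for z m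
    using L copy_pos_unique[OF that] by (simp add: T_def ov)
  have dtw: "wcomp t dt n k = (wcomp t d0 (n + 1) k :: ('v, 'a, 'k) algelt set)" for n k
    by (auto simp: wcomp_def dtX)
  have Wk: "W z k \<in> wcomp t dt n k" if z: "\<And>m. z m \<in> wcomp c dc n m" for z n k
    using G(2)[OF z[of "k + L"]] H(2)[OF z[of k]] by (simp add: W_def wcomp_closed wcomp_minus)
  \<comment> \<open>again the terms inside the turn cancel, and only its two ends contribute\<close>
  have key: "T (sdif c z) v = f0 (\<lambda>k. scl (sg n) (W z k)) v + Qdif A Y (T z) v"
    if z: "\<And>m. z m \<in> wcomp c dc n m" for z n v
  proof (cases "v \<in> overts Y")
    case False
    then have "f0 (\<lambda>k. scl (sg n) (W z k)) v = 0"
      unfolding f0_def left_end_map_eq[OF jX iY] using L ow ov by auto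
    then show ?thesis using False by (simp add: T_def Qdif_outside[OF Y(2)])
  next
    case True
    define m where "m = copy_pos v"
    let ?k = "m + e"
    have m: "j \<le> m" "m < j + L" "?k mod L = v" using copy_pos_range[of v] copy_pos_mod[of v] True by (simp_all add: m_def ov)
    \<comment> \<open>a nonzero contribution to \<open>f\<^sub>0\<close> determines the degree \<open>n\<close>, hence the sign\<close>
    have SF: "scl (sg n) (fw t (j - 1) u) = scl (- sg (dc j)) (fw t (j - 1) u)" if u: "u \<in> wcomp t dt n (j - 1)" for u
    proof (cases "fw t (j - 1) u = 0")
      case False
      have "fw t (j - 1) u \<in> wcomp t dt (n + 1) (j - 1 + 1)" by (rule fw_wcomp[OF t dt u])
      then have "dt j = n + 1" using False by (simp add: wcomp_def split: if_splits)
      then have "dc j = n + 1" using c_left(3)[of j] l by simp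
      then show ?thesis by (simp add: sg1)
    qed simp
    have SB: "scl (sg n) (bw b (i - 1) u) = scl (sg (dc j)) (bw b (i - 1) u)" if u: "u \<in> wcomp t dt n j" for u
    proof (cases "u = 0")
      case False
      then have "dt j = n" using u by (simp add: wcomp_def split: if_splits)
      then have "dc j = n" using c_left(3)[of j] l by simp
      then show ?thesis by simp
    qed simp
    have jm: "v = i mod L \<longleftrightarrow> m = j"
    proof
      assume "v = i mod L"
      then show "m = j" using copy_pos_unique[of j] L by (simp add: m_def i_def)
    qed (use m(3) in \<open>simp add: i_def\<close>)
    have jm': "v = (i - 1) mod L \<longleftrightarrow> m = j + L - 1"
    proof
      have e: "(i - 1) mod L = (j + L - 1 + e) mod L" using mod_add_self2[of "i - 1" L] by (simp add: i_def algebra_simps)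
      show "m = j + L - 1" if "v = (i - 1) mod L" using copy_pos_unique[of "j + L - 1"] L that unfolding e by (simp add: m_def)
      show "v = (i - 1) mod L" if "m = j + L - 1" unfolding e using m(3) that by simp
    qed
    let ?a = "fw b (i - 1) (z (j + L - 1))" and ?a' = "fw t (j - 1) (z (j - 1))"
    have a: "fw t (j - 1) (W z (j - 1)) = scl q ?a - ?a'"
    proof -
      have "fw t (j + L - 1 + - L) (?lg (j + L - 1) (z (j + L - 1))) = ?lg (j + L - 1 + 1) (fw c (j + L - 1) (z (j + L - 1)))"
        using G(1) unfolding intertwines_def by blast
      moreover have "olt c (j + L - 1) = olt b (j + L - 1 + e)" using L l by (intro olt_mid) auto
      moreover have "\<dots> = olt b (i - 1)" using olt_bL[of "i - 1"] by (simp add: i_def algebra_simps)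
      ultimately have "fw t (j - 1) (?lg (j + L - 1) (z (j + L - 1))) = ?a" by (simp add: lgraph_def)
      then show ?thesis using l by (simp add: W_def lin_diff[OF lin_fwo] lin_scl[OF lin_fwo] rgraph_def algebra_simps)
    qed
    have Wj: "W z j = scl q (z (j + L)) - z j" using l by (simp add: W_def lgraph_def rgraph_def)
    have f: "f0 (\<lambda>k. scl (sg n) (W z k)) v = (if m = j then scl (- \<theta>0) (scl q ?a - ?a') else 0)
      + (if m = j + L - 1 then scl (\<kappa> (i - 1) * \<theta>0) (bw b (i - 1) (scl q (z (j + L)) - z j)) else 0)"
    proof -
      have "f0 (\<lambda>k. scl (sg n) (W z k)) v = scl c0 ((if m = j then scl (sg n) (fw t (j - 1) (W z (j - 1))) else 0)
        + (if m = j + L - 1 then scl (\<kappa> (i - 1)) (scl (sg n) (bw b (i - 1) (W z j))) else 0))"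
        unfolding f0_def left_end_map_eq[OF jX iY]
        using ow jm jm' by (simp add: \<kappa>_def lin_scl[OF lin_fwo] lin_scl[OF lin_bwo])
      then show ?thesis
        unfolding SF[OF Wk[OF z]] SB[OF Wk[OF z]] unfolding a Wj by (simp add: scl_add \<theta>0_def mult.commute mult.left_commute)
    qed
    have Q: "Qdif A Y (T z) v = scl (\<kappa> (?k - 1)) (fw b (?k - 1) (T z ((?k - 1) mod L))) + scl (\<kappa> ?k) (bw b ?k (T z ((?k + 1) mod L)))"
      using Qdif_line[OF Y(2), of ?k "T z"] ow bpos m(3) by (simp add: \<kappa>_def)
    have S: "T (sdif c z) v = scl (\<theta> ?k) (fw c (m - 1) (z (m - 1))) + scl (\<theta> ?k) (bw c m (z (m + 1)))"
      using True by (simp add: T_def m_def[symmetric] sdif_def scl_add)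
    have Fpart: "scl (\<theta> ?k) (fw c (m - 1) (z (m - 1))) = (if m = j then scl (- \<theta>0) (scl q ?a - ?a') else 0)
      + scl (\<kappa> (?k - 1)) (fw b (?k - 1) (T z ((?k - 1) mod L)))"
    proof (cases "m = j")
      case True
      have o: "olt c (j - 1) = olt t (j - 1)" using l by (intro olt_left) auto
      have "(?k - 1) mod L = (j + L - 1 + e) mod L" using mod_add_self2[of "?k - 1" L] True by (simp add: algebra_simps)
      then have "T z ((?k - 1) mod L) = scl (\<theta> (i + L - 1)) (z (j + L - 1))"
        using Tk[of "j + L - 1" z] L by (simp add: i_def algebra_simps)
      then have "scl (\<kappa> (?k - 1)) (fw b (?k - 1) (T z ((?k - 1) mod L))) = scl (\<kappa> (i - 1) * \<theta> (i + L - 1)) ?a"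
        using True by (simp add: i_def lin_scl[OF lin_fwo])
      also have "\<dots> = scl (\<theta>0 * q) ?a"
        using F[of "i + L - 1" "z (j + L - 1)"] olt_bL[of "i - 1"] \<kappa>L[of "i - 1"] \<theta>iL L by (simp add: algebra_simps)
      finally have "scl (\<kappa> (?k - 1)) (fw b (?k - 1) (T z ((?k - 1) mod L))) = scl (\<theta>0 * q) ?a" .
      moreover have "\<theta> ?k = \<theta>0" using True \<theta>i by (simp add: i_def)
      ultimately show ?thesis using True by (simp add: o scl_diff scl_minus)
    next
      case False
      have o: "olt c (m - 1) = olt b (m - 1 + e)" using m False l by (intro olt_mid) auto
      have "T z ((?k - 1) mod L) = scl (\<theta> (?k - 1)) (z (m - 1))"
        using Tk[of "m - 1" z] m False by (simp add: algebra_simps)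
      then show ?thesis
        using F[of "?k - 1" "z (m - 1)"] m False by (simp add: o lin_scl[OF lin_fwo] i_def algebra_simps)
    qed
    have Bpart: "scl (\<theta> ?k) (bw c m (z (m + 1))) =
      (if m = j + L - 1 then scl (\<kappa> (i - 1) * \<theta>0) (bw b (i - 1) (scl q (z (j + L)) - z j)) else 0)
      + scl (\<kappa> ?k) (bw b ?k (T z ((?k + 1) mod L)))"
    proof -
      have o: "olt c m = olt b ?k" using m l by (intro olt_mid) auto
      show ?thesis
      proof (cases "m = j + L - 1")
        case True
        have k: "?k = i - 1 + L" "?k + 1 = i + L" "m + 1 = j + L" "i \<le> ?k" using True L by (simp_all add: i_def)
        have "(?k + 1) mod L = (j + e) mod L" unfolding k using mod_add_self2[of "j + e" L] by (simp add: i_def add.assoc)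
        then have "T z ((?k + 1) mod L) = scl \<theta>0 (z j)" using Tk[of j z] L \<theta>i by (simp add: i_def)
        moreover have "scl (\<theta> ?k) (bw b ?k u) = scl (\<kappa> (i - 1) * \<theta>0 * q) (bw b (i - 1) u)" for u
          using B[OF k(4), of u] \<theta>iL olt_bL[of "i - 1"] \<kappa>L[of "i - 1"] k(2) unfolding k(1) by (simp add: mult.assoc)
        moreover have "\<kappa> ?k = \<kappa> (i - 1)" "olt b ?k = olt b (i - 1)" unfolding k(1) by (rule \<kappa>L, rule olt_bL)
        ultimately show ?thesis
          using True unfolding o k(3) by (simp add: lin_scl[OF lin_bwo] lin_diff[OF lin_bwo] scl_diff)
      next
        case False
        have "T z ((?k + 1) mod L) = scl (\<theta> (?k + 1)) (z (m + 1))"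
          using Tk[of "m + 1" z] m False by (simp add: algebra_simps)
        then show ?thesis using B[of ?k "z (m + 1)"] m False by (simp add: o lin_scl[OF lin_bwo] i_def)
      qed
    qed
    show ?thesis unfolding S f Q Fpart Bpart by (simp add: ac_simps)
  qed
  let ?f = "\<lambda>(n::int) u v p. c0 * left_end_map A X Y j (j + e) u v p"
  have ff: "?f n x = f0 x" for n x by (auto simp: f0_def scl_def i_def)
  let ?M = "cone (Qcx A X) (Qcx A Y) ?f" and ?C = "Qcx A (HStr c dc) :: (_, ('v, 'a, 'k) dsum) cplx"
  have mem: "\<phi> n z \<in> mcar (cobj ?M n)" if z: "z \<in> car (HStr c dc) n" for n z
  proof -
    have zk: "z k \<in> wcomp c dc n k" for k by (rule carD_str(2)[OF ch z])
    have fz: "finite {v. z v \<noteq> 0}" by (rule carD_str(1)[OF ch z])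
    have "(\<lambda>k. scl (sg n) (W z k)) \<in> car X (n + 1)"
      unfolding X(1)
    proof (rule carI_str[OF X(2)[unfolded X(1)]])
      show "finite {v. scl (sg n) (W z v) \<noteq> 0}"
      proof (rule finite_subset)
        show "{v. scl (sg n) (W z v) \<noteq> 0} \<subseteq> {v. z v \<noteq> 0} \<union> {v. z (v + L) \<noteq> 0}"
        proof
          fix v assume v: "v \<in> {v. scl (sg n) (W z v) \<noteq> 0}"
          have "z v \<noteq> 0 \<or> z (v + L) \<noteq> 0"
          proof (rule ccontr)
            assume "\<not> ?thesis"
            then show False using v lin_zero[OF linr, of v] lin_zero[OF linl, of "v + L"] by (auto simp: W_def)
          qed
          then show "v \<in> {v. z v \<noteq> 0} \<union> {v. z (v + L) \<noteq> 0}" unfolding Un_iff mem_Collect_eq by blast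
        qed
        show "finite ({v. z v \<noteq> 0} \<union> {v. z (v + L) \<noteq> 0})" by (intro finite_UnI fz finite_shift)
      qed
      show "scl (sg n) (W z k) \<in> wcomp t d0 (n + 1) k" for k
        using Wk[of z n k, OF zk] by (simp add: dtw wcomp_closed)
    qed
    moreover have "T z \<in> car Y n"
    proof (rule carI[OF Y(2)])
      show "finite {v. T z v \<noteq> 0}"
      proof (rule finite_subset)
        show "{v. T z v \<noteq> 0} \<subseteq> {0..<L}" by (auto simp: T_def ov split: if_splits)
      qed (rule finite_atLeastLessThan_int)
      fix v assume v: "v \<in> overts Y"
      have "T z v \<in> wcomp c dc n (copy_pos v)" using v zk by (simp add: T_def wcomp_closed)
      then have "T z v \<in> wcomp b db n (copy_pos v + e)" using copy_pos_range[of v] l by (simp add: wcomp_mid)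
      moreover have "wvtx b (copy_pos v + e) = wvtx b v" "db (copy_pos v + e) = db v"
        using copy_pos_mod[of v] v by (simp_all add: bY Y(1) LY dbY)
      ultimately show "T z v \<in> wcomp (oword Y) (odeg Y) n v"
        unfolding ow dbY[symmetric] by (simp only: wcomp_def bpos UNIV_I simp_thms)
    qed (simp add: T_def)
    ultimately show ?thesis by (simp add: \<phi>_def)
  qed
  have hom: "mod_hom A (cobj ?C n) (cobj ?M n) (\<phi> n)" for n
    unfolding mod_hom_def
  proof (intro conjI ballI)
    fix z assume "z \<in> mcar (cobj ?C n)"
    then show "\<phi> n z \<in> mcar (cobj ?M n)" by (rule mem)
  next
    fix z z' :: "('v, 'a, 'k) dsum"
    have "(\<lambda>k. scl (sg n) (W (z + z') k)) = (\<lambda>k. scl (sg n) (W z k)) + (\<lambda>k. scl (sg n) (W z' k))"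
      by (rule ext) (simp add: W_add scl_add)
    moreover have "T (z + z') = T z + T z'" by (rule ext) (simp add: T_add)
    ultimately show "\<phi> n (z + z') = \<phi> n z + \<phi> n z'" by (simp only: \<phi>_def plus_prod_def fst_conv snd_conv)
  next
    fix a :: "('v, 'a, 'k) algelt" and z
    show "\<phi> n (mact (cobj ?C n) a z) = mact (cobj ?M n) a (\<phi> n z)"
      by (simp add: \<phi>_def T_amult W_amult amult_scl_right fun_eq_iff)
  qed
  have chain: "\<phi> (n + 1) (cdif ?C n z) = cdif ?M n (\<phi> n z)" if z: "z \<in> car (HStr c dc) n" for n z
  proof -
    have zk: "z k \<in> wcomp c dc n k" for k by (rule carD_str(2)[OF ch z])
    have 1: "cdif ?M n (\<phi> n z) = (- Qdif A X (\<lambda>k. scl (sg n) (W z k)), f0 (\<lambda>k. scl (sg n) (W z k)) + Qdif A Y (T z))"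
      by (simp add: \<phi>_def ff)
    have 2: "cdif ?C n z = sdif c z" by (simp add: Qdif_sdif[OF ch])
    have "(\<lambda>k. scl (sg (n + 1)) (W (sdif c z) k)) = - Qdif A X (\<lambda>k. scl (sg n) (W z k))"
      by (rule ext) (simp add: X(1) Qdif_sdif[OF X(2)[unfolded X(1)]] sdif_linear W_sdif sg1 scl_minus)
    moreover have "T (sdif c z) = f0 (\<lambda>k. scl (sg n) (W z k)) + Qdif A Y (T z)"
      by (rule ext) (simp add: key[of z n, OF zk])
    ultimately show ?thesis unfolding 1 2 by (simp add: \<phi>_def)
  qed
  have lg0: "?lg k z = 0" if "k < j + L - 1" for k z using that by (simp add: lgraph_def)
  have rg0: "?rg k z = 0" if "k > j + l + 1" for k z using that by (simp add: rgraph_def)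
  have rgid: "?rg k z = z" if "k \<le> j" for k z using that l by (simp add: rgraph_def)
  have lgid: "?lg k z = z" if "k \<ge> j + L" for k z using that l by (simp add: lgraph_def)
  \<comment> \<open>\<open>z\<close> vanishes on the inserted turn; the equation \<open>q z (m + L) = \<dots>\<close>, with a right hand side that
    depends on \<open>z m\<close>, propagates this to the right, and on the left \<open>W\<close> is minus the identity\<close>
  have ker: "z = 0" if 0: "\<phi> n z = 0" for n z
  proof -
    have W0: "W z k = 0" for k using fun_cong[of "\<lambda>k. scl (sg n) (W z k)" 0 k] 0 sg1(3) by (simp add: \<phi>_def zero_prod_def)
    have T0: "T z v = 0" for v using 0 by (simp add: \<phi>_def zero_prod_def)
    have z1: "z m = 0" if "j \<le> m" "m < j + L" for m using Tk[OF that, of z] T0 \<theta>n0 by simp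
    have z2: "z m = 0" if "j \<le> m" for m
      using that
    proof (induction "nat (m - j)" arbitrary: m rule: less_induct)
      case less
      show ?case
      proof (cases "m < j + L")
        case True then show ?thesis using z1 less.prems by simp
      next
        case False
        then have "z (m - L) = 0" using L by (intro less) auto
        then have "scl q (z m) = 0"
          using W0[of "m - L"] False lin_zero[OF linr] by (simp add: W_def lgid)
        then show ?thesis using q0 by simp
      qed
    qed
    have "z m = 0" for m
    proof (cases "m < j")
      case True
      have "?lg (m + L) (z (m + L)) = 0"
      proof (cases "m = j - 1")
        case True
        then have "z (m + L) = 0" using L by (intro z2) auto
        then show ?thesis using lin_zero[OF linl] by simp
      qed (use True in \<open>simp add: lg0\<close>)
      then show ?thesis using W0[of m] True by (simp add: W_def rgid)
    qed (simp add: z2)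
    then show ?thesis by auto
  qed
  have surj: "\<exists>z \<in> car (HStr c dc) n. \<phi> n z = p" if p: "p \<in> mcar (cobj ?M n)" for n p
  proof -
    obtain x w where xw: "p = (x, w)" "x \<in> car X (n + 1)" "w \<in> car Y n" using p by auto
    have xk: "x k \<in> wcomp t dt n k" for k
      using carD_str(2)[OF X(2)[unfolded X(1)], of x "n + 1" k] xw(2) X(1) by (simp add: dtw)
    have fx: "finite {v. x v \<noteq> 0}" by (rule carD(1)[OF X(2) xw(2)])
    define B where "B m = scl (1 / \<theta> (m + e)) (w ((m + e) mod L))" for m
    have Bc: "B m \<in> wcomp c dc n m" if "j \<le> m" "m < j + L" for m
    proof -
      have "w ((m + e) mod L) \<in> wcomp b db n (m + e)" using carD(2)[OF Y(2) xw(3), of "m + e"] ow bpos dbY by simp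
      then show ?thesis using that l by (simp add: B_def wcomp_closed wcomp_mid)
    qed
    have "\<exists>z. \<forall>m. z m = (if m < j + L then (if m < j then scl q (?lg (m + L) (B (m + L))) - scl (sg n) (x m) else B m)
        else scl (1 / q) (scl (sg n) (x (m - L)) + ?rg (m - L) (z (m - L))))"
      using L by (intro wf_recursion[where \<mu> = "\<lambda>m. nat (m - j)"]) auto
    then obtain z where z: "\<And>m. z m = (if m < j + L then (if m < j then scl q (?lg (m + L) (B (m + L))) - scl (sg n) (x m) else B m)
        else scl (1 / q) (scl (sg n) (x (m - L)) + ?rg (m - L) (z (m - L))))" by blast
    have z1: "z m = scl q (?lg (m + L) (B (m + L))) - scl (sg n) (x m)" if "m < j" for m using that z[of m] L by simp
    have z2: "z m = B m" if "j \<le> m" "m < j + L" for m using that z[of m] by simp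
    have z3: "z m = scl (1 / q) (scl (sg n) (x (m - L)) + ?rg (m - L) (z (m - L)))" if "j + L \<le> m" for m using that z[of m] by simp
    have zk: "z m \<in> wcomp c dc n m" for m
    proof (induction "nat (m - j)" arbitrary: m rule: less_induct)
      case less
      consider "m < j" | "j \<le> m" "m < j + L" | "j + L \<le> m" by linarith
      then show ?case
      proof cases
        case 1
        have "?lg (m + L) (B (m + L)) \<in> wcomp t dt n m"
        proof (cases "m = j - 1")
          case True
          then show ?thesis using L by (intro G(2) Bc) auto
        qed (use 1 in \<open>simp add: lg0 wcomp_closed\<close>)
        then show ?thesis using 1 xk[of m] l by (simp add: z1 wcomp_left wcomp_closed wcomp_minus)
      next
        case 2 then show ?thesis by (simp add: z2 Bc)
      next
        case 3
        then have "z (m - L) \<in> wcomp c dc n (m - L)" using L by (intro less) auto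
        then have "?rg (m - L) (z (m - L)) \<in> wcomp t dt n (m - L)" by (rule H(2))
        then have "z m \<in> wcomp t dt n (m - L)" using 3 xk[of "m - L"] by (simp add: z3 wcomp_closed)
        moreover have "wcomp c dc n m = (wcomp t dt n (m - L) :: ('v, 'a, 'k) algelt set)"
          using wcomp_right[of "m - L" n] 3 by simp
        ultimately show ?thesis by simp
      qed
    qed
    have "finite {v. z v \<noteq> 0}"
    proof (rule finite_subset)
      show "{v. z v \<noteq> 0} \<subseteq> {j - 1..j + l + 1 + L} \<union> ({v. x v \<noteq> 0} \<union> {v. x (v + - L) \<noteq> 0})"
      proof
        fix v assume v: "v \<in> {v. z v \<noteq> 0}"
        have "v \<in> {j - 1..j + l + 1 + L} \<or> x v \<noteq> 0 \<or> x (v + - L) \<noteq> 0"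
        proof (rule ccontr)
          assume n: "\<not> ?thesis"
          then have "v < j - 1 \<or> v > j + l + 1 + L" by auto
          then have "z v = 0" using n z1[of v] z3[of v] rg0[of "v - L"] lg0[of "v + L"] L l by auto
          then show False using v by simp
        qed
        then show "v \<in> {j - 1..j + l + 1 + L} \<union> ({v. x v \<noteq> 0} \<union> {v. x (v + - L) \<noteq> 0})"
          unfolding Un_iff mem_Collect_eq by blast
      qed
      show "finite ({j - 1..j + l + 1 + L} \<union> ({v. x v \<noteq> 0} \<union> {v. x (v + - L) \<noteq> 0}))"
        by (intro finite_UnI finite_atLeastAtMost_int fx finite_shift)
    qed
    then have zc: "z \<in> car (HStr c dc) n" by (rule carI_str[OF ch _ zk])
    have Wx: "W z k = scl (sg n) (x k)" for k
    proof (cases "k < j")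
      case True
      have "?lg (k + L) (z (k + L)) = ?lg (k + L) (B (k + L))"
      proof (cases "k = j - 1")
        case True then show ?thesis using L by (simp add: z2)
      qed (use True in \<open>simp add: lg0\<close>)
      then show ?thesis using True by (simp add: W_def rgid z1)
    next
      case False
      then show ?thesis using z3[of "k + L"] q0 by (simp add: W_def lgid)
    qed
    have "T z v = w v" for v
    proof (cases "v \<in> overts Y")
      case True
      then show ?thesis using copy_pos_range[of v] copy_pos_mod[of v] \<theta>n0 by (simp add: T_def z2 B_def ov)
    qed (simp add: T_def carD(3)[OF Y(2) xw(3)])
    then have "T z = w" by auto
    moreover have "(\<lambda>k. scl (sg n) (W z k)) = x" by (rule ext) (simp add: Wx sg1)
    ultimately have "\<phi> n z = p" by (simp add: \<phi>_def xw)
    then show ?thesis using zc by blast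
  qed
  have "bij_betw (\<phi> n) (car (HStr c dc) n) (mcar (cobj ?M n))" for n
    unfolding bij_betw_def
  proof
    show "inj_on (\<phi> n) (car (HStr c dc) n)"
      using mod_hom_inj[OF is_complexD(1)[OF Qcx_is_complex[OF ch]] hom] ker by blast
    show "\<phi> n ` car (HStr c dc) n = mcar (cobj ?M n)"
      using mem surj by blast
  qed
  then have "chain_iso A ?C ?M \<phi>"
    using hom chain unfolding chain_iso_def chain_map_def by blast
  then show ?thesis by blast
qed

end

section \<open>Decompositions of words\<close>

text \<open>
  \<open>w\<close> is the part of the ambient word \<open>Z\<close> with the vertices \<open>Q\<close>, the vertex \<open>k\<close> of \<open>w\<close> being the vertex
  \<open>k + a\<close> of \<open>Z\<close>. Equations between concatenations become trivial once all factors are recognized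
  as adjacent pieces of one ambient word.
\<close>

definition piece :: "('v, 'a) word \<Rightarrow> ('v, 'a) word \<Rightarrow> int set \<Rightarrow> int \<Rightarrow> bool" where
  "piece w Z Q a \<longleftrightarrow> wpos w = {k. k + a \<in> Q} \<and> (\<forall>k. k + a \<in> Q \<longrightarrow> wvtx w k = wvtx Z (k + a)) \<and>
     (\<forall>k. k + a \<in> Q \<and> k + a + 1 \<in> Q \<longrightarrow> wltr w k = wltr Z (k + a))"

lemma piece_self: "piece w w (wpos w) 0"
  by (simp add: piece_def)

lemma piece_wsub:
  assumes "piece w Z Q a" "\<And>k. k + a \<in> Q' \<longleftrightarrow> k + a \<in> Q \<and> k \<in> R"
  shows "piece (wsub w R) Z Q' a"
proof -
  have "k + a + 1 \<in> Q' \<longleftrightarrow> k + a + 1 \<in> Q \<and> k + 1 \<in> R" for k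
    using assms(2)[of "k + 1"] by (simp add: algebra_simps)
  then show ?thesis using assms by (auto simp: piece_def wsub_def)
qed

lemma piece_shift:
  assumes "piece w Z Q a" "\<And>x. x \<in> Q \<Longrightarrow> wvtx Z x = wvtx Z' (x + d)"
    "\<And>x. x \<in> Q \<Longrightarrow> x + 1 \<in> Q \<Longrightarrow> wltr Z x = wltr Z' (x + d)"
  shows "piece w Z' {x. x - d \<in> Q} (a + d)"
  using assms by (auto simp: piece_def algebra_simps)

lemma piece_cat:
  assumes u: "piece u Z P a" and v: "piece v Z Q a'"
    and P: "m \<in> P" "\<And>x. x \<in> P \<Longrightarrow> x \<le> m" and Q: "m \<in> Q" "\<And>x. x \<in> Q \<Longrightarrow> m \<le> x"
  shows "piece (u \<cdot> v) Z (P \<union> Q) a"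
proof -
  have "Sup (wpos u) = m - a"
    using u P by (intro cSup_eq_maximum) (force simp: piece_def)+
  moreover have "Inf (wpos v) = m - a'"
    using v Q by (intro cInf_eq_minimum) (force simp: piece_def)+
  ultimately have s: "Sup (wpos u) - Inf (wpos v) = a' - a" by simp
  have pu: "k \<in> wpos u \<longleftrightarrow> k + a \<in> P" and pv: "k \<in> wpos v \<longleftrightarrow> k + a' \<in> Q" for k
    using u v by (simp_all add: piece_def)
  have "k \<in> (\<lambda>k. k + (a' - a)) ` wpos v \<longleftrightarrow> k + a \<in> Q" for k
  proof
    assume "k + a \<in> Q"
    then show "k \<in> (\<lambda>k. k + (a' - a)) ` wpos v"
      by (intro image_eqI[of _ _ "k - (a' - a)"]) (auto simp: pv algebra_simps)
  qed (auto simp: pv algebra_simps)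
  then have 1: "wpos (u \<cdot> v) = {k. k + a \<in> P \<union> Q}"
    unfolding wcat_def Let_def s by (auto simp: pu)
  have 2: "wvtx (u \<cdot> v) k = wvtx Z (k + a)" if "k + a \<in> P \<union> Q" for k
    using that u v unfolding wcat_def Let_def s by (auto simp: pu piece_def algebra_simps)
  have 3: "wltr (u \<cdot> v) k = wltr Z (k + a)" if k: "k + a \<in> P \<union> Q" "k + a + 1 \<in> P \<union> Q" for k
  proof (cases "k + a \<in> P \<and> k + a + 1 \<in> P")
    case True
    then show ?thesis using u unfolding wcat_def Let_def s by (simp add: pu piece_def algebra_simps)
  next
    case False
    have "k + a \<in> Q \<and> k + a + 1 \<in> Q"
    proof (cases "k + a + 1 \<in> P")
      case True
      then have "k + a < m" using P(2) by fastforce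
      then show ?thesis using False k Q(2)[of "k + a"] True by auto
    next
      case f: False
      then have "k + a + 1 \<in> Q" "k + a + 1 \<noteq> m" using k P(1) by auto
      then have "m \<le> k + a" using Q(2) by fastforce
      then have "k + a \<in> Q" using k(1) P(2)[of "k + a"] Q(1) by force
      then show ?thesis using \<open>k + a + 1 \<in> Q\<close> by simp
    qed
    then show ?thesis using v False unfolding wcat_def Let_def s by (auto simp: pu piece_def algebra_simps)
  qed
  show ?thesis unfolding piece_def using 1 2 3 by blast
qed

lemma piece_wsame:
  assumes "piece w Z Q a" "piece w' Z Q a'" shows "wsame w w'"
  unfolding wsame_def
proof (intro exI[of _ "a - a'"] conjI)
  show "wpos w' = (\<lambda>k. k + (a - a')) ` wpos w"
  proof (intro equalityI subsetI)
    fix k assume "k \<in> wpos w'"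
    then show "k \<in> (\<lambda>k. k + (a - a')) ` wpos w"
      using assms by (intro image_eqI[of _ _ "k - (a - a')"]) (auto simp: piece_def algebra_simps)
  qed (use assms in \<open>auto simp: piece_def algebra_simps\<close>)
qed (use assms in \<open>auto simp: piece_def algebra_simps\<close>)

lemma interval_finite:
  assumes S: "interval S" "S \<subseteq> {a..b}"
  obtains p q where "S = {p..q}" "p \<le> q" "a \<le> p" "q \<le> (b :: int)"
proof -
  have f: "finite S" "S \<noteq> {}" using S finite_subset by (auto simp: interval_def)
  have ab: "a \<le> Min S" "Max S \<le> b" using S(2) Min_in[OF f] Max_in[OF f] by auto
  have S': "S = {Min S..Max S}"
  proof
    show "S \<subseteq> {Min S..Max S}" using f by auto
    show "{Min S..Max S} \<subseteq> S" using S(1) Min_in[OF f] Max_in[OF f] unfolding interval_def by blast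
  qed
  have "Min S \<le> Max S" using f by simp
  then show thesis by (rule that[OF S' _ ab])
qed

text \<open>
  The conditions on powers of the band in the statement enter only through the lengths that they imply.
\<close>

lemma subword_length:
  assumes uw: "subword u w" and w: "wpos w = {a..b}"
  obtains i l where "wpos u = {i..i + l}" "0 \<le> l" "l \<le> b - a" "l = b - a \<Longrightarrow> wsame u w"
proof -
  obtain S' where S': "interval S'" "S' \<subseteq> {a..b}" "wsame u (wsub w S')"
    using uw unfolding subword_def w by blast
  obtain p q where pq: "S' = {p..q}" "p \<le> q" "a \<le> p" "q \<le> b" using interval_finite[OF S'(1,2)] by blast
  obtain s where s: "wpos (wsub w S') = (\<lambda>k. k + s) ` wpos u" using S'(3) unfolding wsame_def by blast
  have "wpos (wsub w S') = {p..q}" using pq w by (auto simp: wsub_def)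
  then have im: "(\<lambda>k. k + s) ` wpos u = {p..q}" using s by simp
  have "wpos u = {p - s..p - s + (q - p)}"
  proof (intro equalityI subsetI)
    fix k assume "k \<in> wpos u"
    then have "k + s \<in> {p..q}" using im by blast
    then show "k \<in> {p - s..p - s + (q - p)}" by auto
  next
    fix k assume "k \<in> {p - s..p - s + (q - p)}"
    then have "k + s \<in> (\<lambda>k. k + s) ` wpos u" unfolding im by auto
    then show "k \<in> wpos u" by auto
  qed
  moreover have "wsame u w" if "q - p = b - a"
  proof -
    have "S' = {a..b}" using that pq by auto
    then have "wsub w S' = w" using w by (simp add: wsub_def)
    then show ?thesis using S'(3) by simp
  qed
  ultimately show thesis using that[of "p - s" "q - p"] pq by auto
qed

lemma wrot_simps [simp]:
  "wpos (wrot r w) = {0..wlen w}" "wvtx (wrot r w) k = wvtx w ((k + r) mod wlen w)"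
  "wltr (wrot r w) k = wltr w ((k + r) mod wlen w)"
  by (simp_all add: wrot_def)

lemma wlen_wrot [simp]: "0 \<le> wlen w \<Longrightarrow> wlen (wrot r w) = wlen w"
  using wlen_interval[of "wrot r w" 0 "wlen w"] by simp

lemma wpow_simps [simp]:
  "wpos (wpow w m) = {0..int m * wlen w}" "wvtx (wpow w m) k = wvtx w (k mod wlen w)"
  "wltr (wpow w m) k = wltr w (k mod wlen w)"
  by (simp_all add: wpow_def wsub_def)

lemma piece_insE: "piece c Z (wpos Z) 0 \<Longrightarrow> wpos c = wpos Z" 
  "piece c Z (wpos Z) 0 \<Longrightarrow> k \<in> wpos Z \<Longrightarrow> wvtx c k = wvtx Z k"
  "piece c Z (wpos Z) 0 \<Longrightarrow> k \<in> wpos Z \<Longrightarrow> k + 1 \<in> wpos Z \<Longrightarrow> wltr c k = wltr Z k"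
  by (auto simp: piece_def)

text \<open>
  A word is determined only up to its values outside the diagram; the complex does not see them.
\<close>

lemma Qcx_piece:
  fixes A :: "('v, 'a) bound_quiver"
  assumes c: "piece c Z (wpos Z) 0"
  shows "Qcx A (HStr c d :: ('v, 'a, 'k::field) hobj) = Qcx A (HStr Z d)"
proof -
  note e = piece_insE[OF c]
  have 1: "Qdif A (HStr c d :: ('v, 'a, 'k) hobj) = Qdif A (HStr Z d)"
  proof (intro ext)
    fix u :: "('v, 'a, 'k) dsum" and v p
    have "Qdif A (HStr c d) u v = Qdif A (HStr Z d) u v"
      unfolding Qdif_def by (intro arg_cong2[where f = "(+)"] sum.cong) (auto simp: e split: letter.splits)
    then show "Qdif A (HStr c d) u v p = Qdif A (HStr Z d) u v p" by simp
  qed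
  let ?c = "HStr c d :: ('v, 'a, 'k) hobj" and ?Z = "HStr Z d :: ('v, 'a, 'k) hobj"
  have 2: "(if v \<in> overts ?c \<and> odeg ?c v = i then u v \<in> proj A (wvtx (oword ?c) v) else u v = 0) =
    (if v \<in> overts ?Z \<and> odeg ?Z v = i then u v \<in> proj A (wvtx (oword ?Z) v) else u v = 0)"
    for u :: "('v, 'a, 'k) dsum" and v i
    by (simp add: e)
  show ?thesis unfolding Qcx_def 1 2 ..
qed

lemma is_hobj_piece:
  assumes c: "piece c Z (wpos Z) 0" and Z: "is_hobj A (HStr Z d :: ('v, 'a, 'k::field) hobj)"
  shows "is_hobj A (HStr c d :: ('v, 'a, 'k) hobj)"
proof -
  have "is_hword A c"
    using Z piece_insE[OF c] unfolding is_hobj.simps is_hword_def by (simp add: add.commute)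
  moreover have "grading c d"
    using Z piece_insE[OF c] unfolding is_hobj.simps grading_def by simp
  ultimately show ?thesis
    using Z unfolding is_hobj.simps Qcx_piece[OF c] piece_insE(1)[OF c] by blast
qed

context insertion begin

text \<open>
  Both formulas for the word of the cone describe \<open>c\<close>. In the second one the overlap is longer than
  \<open>m\<close> turns, and the rest \<open>\<beta>\<close> of the overlap is moved along \<open>b\<close> by periodicity.
\<close>

lemma ins_words:
  assumes w: "b = unroll w" "wlen w = L" and r: "piece \<rho> t {j..j + l} a"
  defines "\<sigma>' \<equiv> wrot (j + e) w" and "\<delta> \<equiv> wsub t {..j}" and "\<gamma> \<equiv> wsub t {j + l..}"
  shows "l \<le> L \<Longrightarrow> \<alpha> = wsub \<sigma>' {l..L} \<Longrightarrow>
      wsame \<sigma>' (\<rho> \<cdot> \<alpha>) \<and> wsame t (\<delta> \<cdot> \<rho> \<cdot> \<gamma>) \<and> piece (\<delta> \<cdot> \<rho> \<cdot> \<alpha> \<cdot> \<rho> \<cdot> \<gamma>) c (wpos c) 0"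
    and "int m * L \<le> l \<Longrightarrow> p = l - int m * L \<Longrightarrow> p \<le> L \<Longrightarrow> \<beta> = wsub \<sigma>' {0..p} \<Longrightarrow> \<alpha>' = wsub \<sigma>' {p..L} \<Longrightarrow>
      wsame \<sigma>' (\<beta> \<cdot> \<alpha>') \<and> wsame \<rho> (wpow \<sigma>' m \<cdot> \<beta>) \<and> wsame t (\<delta> \<cdot> wpow \<sigma>' m \<cdot> \<beta> \<cdot> \<gamma>) \<and>
      piece (\<delta> \<cdot> wpow \<sigma>' (m + 1) \<cdot> \<beta> \<cdot> \<gamma>) c (wpos c) 0"
proof -
  let ?i = "j + e"
  have bv: "wvtx b k = wvtx w (k mod L)" "wltr b k = wltr w (k mod L)" for k using w by simp_all
  have perm: "wvtx b (k + int n * L) = wvtx b k" "wltr b (k + int n * L) = wltr b k" for k n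
    by (simp_all add: bv)
  have ti: "x \<in> wpos t" if "j \<le> x" "x \<le> j + l" for x using that tpos by auto
  have t_c_left: "piece u c Q d" if u: "piece u t Q d" and Q: "Q \<subseteq> {..j + l}" for u Q d
    using piece_shift[OF u, of c 0] Q c_left by force
  have t_c_right: "piece u c {x. x - L \<in> Q} (d + L)" if u: "piece u t Q d" and Q: "Q \<subseteq> {j..}" for u Q d
    using Q c_right by (intro piece_shift[OF u]) auto
  have b_c: "piece u c {x. x + e \<in> Q} (d - e)" if u: "piece u b Q d" and Q: "Q \<subseteq> {?i..?i + L + l}" for u Q d
  proof -
    have *: "wvtx b x = wvtx c (x + - e)" if "x \<in> Q" for x using c_mid(2)[of "x - e"] that Q by force
    have **: "wltr b x = wltr c (x + - e)" if "x \<in> Q" "x + 1 \<in> Q" for x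
    proof -
      have "j \<le> x - e" "x - e < j + L + l" using that Q by force+
      then show ?thesis using c_mid(4)[of "x - e"] by simp
    qed
    show ?thesis using piece_shift[OF u, of c "- e"] * ** by simp
  qed
  have b_t: "piece u t {x. x + e \<in> Q} (d - e)" if u: "piece u b Q d" and Q: "Q \<subseteq> {?i..?i + l}" for u Q d
  proof -
    have *: "wvtx b x = wvtx t (x + - e)" if "x \<in> Q" for x using ov(1)[of "x - e"] that Q by force
    have **: "wltr b x = wltr t (x + - e)" if "x \<in> Q" "x + 1 \<in> Q" for x
    proof -
      have "j \<le> x - e" "x - e < j + l" using that Q by force+
      then show ?thesis using ov(2)[of "x - e"] by simp
    qed
    show ?thesis using piece_shift[OF u, of t "- e"] * ** by simp
  qed
  have D: "piece \<delta> t (wpos t \<inter> {..j}) 0" unfolding \<delta>_def by (rule piece_wsub[OF piece_self]) auto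
  have C: "piece \<gamma> t (wpos t \<inter> {j + l..}) 0" unfolding \<gamma>_def by (rule piece_wsub[OF piece_self]) auto
  have S': "piece \<sigma>' b {?i..?i + L} ?i" using w by (auto simp: piece_def \<sigma>'_def)
  have R: "piece \<rho> b {?i..?i + l} (a + e)"
  proof -
    have "piece \<rho> b {x. x - e \<in> {j..j + l}} (a + e)" using ov by (intro piece_shift[OF r]) auto
    moreover have "{x. x - e \<in> {j..j + l}} = {?i..?i + l}" by auto
    ultimately show ?thesis by simp
  qed
  have DR: "wpos t \<inter> {..j} \<union> ({j..j + l} \<union> wpos t \<inter> {j + l..}) = wpos t" using ti by auto
  have Cc: "piece \<gamma> c {x. x - L \<in> wpos t \<inter> {j + l..}} L"
  proof -
    have "wpos t \<inter> {j + l..} \<subseteq> {j..}" using l by auto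
    from t_c_right[OF C this] show ?thesis by (simp only: add_0)
  qed
  have Dc: "piece \<delta> c (wpos t \<inter> {..j}) 0"
  proof (rule t_c_left[OF D])
    show "wpos t \<inter> {..j} \<subseteq> {..j + l}" using l by auto
  qed
  have Cc_min: "j + L + l \<in> {x. x - L \<in> wpos t \<inter> {j + l..}}" "\<And>x. x \<in> {x. x - L \<in> wpos t \<inter> {j + l..}} \<Longrightarrow> j + L + l \<le> x"
    using jl_in by auto
  have cov: "wpos t \<inter> {..j} \<union> ({j..j + L + l} \<union> {x. x - L \<in> wpos t \<inter> {j + l..}}) = wpos c"
  proof (intro equalityI subsetI)
    fix x assume x: "x \<in> wpos c"
    consider "x < j" | "j \<le> x" "x \<le> j + L + l" | "j + L + l < x" by linarith
    then show "x \<in> wpos t \<inter> {..j} \<union> ({j..j + L + l} \<union> {x. x - L \<in> wpos t \<inter> {j + l..}})"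
      using x L l by cases (auto simp: ins_def split: if_splits)
  next
    fix x assume "x \<in> wpos t \<inter> {..j} \<union> ({j..j + L + l} \<union> {x. x - L \<in> wpos t \<inter> {j + l..}})"
    then show "x \<in> wpos c" using c_left(1)[of x] c_mid(1)[of x] c_right(1)[of "x - L"] l by auto
  qed
  have assemble: "piece (\<delta> \<cdot> u) c (wpos c) 0" if u: "piece u c ({j..j + L + l} \<union> {x. x - L \<in> wpos t \<inter> {j + l..}}) d" for u d
  proof -
    have "piece (\<delta> \<cdot> u) c (wpos t \<inter> {..j} \<union> ({j..j + L + l} \<union> {x. x - L \<in> wpos t \<inter> {j + l..}})) 0"
      by (rule piece_cat[OF Dc u, of j]) (use j_in L l in auto)
    then show ?thesis unfolding cov .
  qed
  have assemble_t: "wsame t (\<delta> \<cdot> u)" if u: "piece u t ({j..j + l} \<union> wpos t \<inter> {j + l..}) d" for u d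
  proof -
    have "piece (\<delta> \<cdot> u) t (wpos t \<inter> {..j} \<union> ({j..j + l} \<union> wpos t \<inter> {j + l..})) 0"
      by (rule piece_cat[OF D u, of j]) (use j_in l in auto)
    then show ?thesis unfolding DR by (rule piece_wsame[OF piece_self])
  qed
  show "wsame \<sigma>' (\<rho> \<cdot> \<alpha>) \<and> wsame t (\<delta> \<cdot> \<rho> \<cdot> \<gamma>) \<and> piece (\<delta> \<cdot> \<rho> \<cdot> \<alpha> \<cdot> \<rho> \<cdot> \<gamma>) c (wpos c) 0"
    if lL: "l \<le> L" and al: "\<alpha> = wsub \<sigma>' {l..L}"
  proof (intro conjI)
    have A: "piece \<alpha> b {?i + l..?i + L} ?i"
      unfolding al by (rule piece_wsub[OF S']) (use l in auto)
    have "piece (\<rho> \<cdot> \<alpha>) b ({?i..?i + l} \<union> {?i + l..?i + L}) (a + e)"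
      using l lL by (intro piece_cat[OF R A, of "?i + l"]) auto
    moreover have "{?i..?i + l} \<union> {?i + l..?i + L} = {?i..?i + L}" using l lL by auto
    ultimately show "wsame \<sigma>' (\<rho> \<cdot> \<alpha>)" using piece_wsame[OF S'] by simp
    have "piece (\<rho> \<cdot> \<gamma>) t ({j..j + l} \<union> wpos t \<inter> {j + l..}) a"
      using jl_in l by (intro piece_cat[OF r C, of "j + l"]) auto
    then show "wsame t (\<delta> \<cdot> \<rho> \<cdot> \<gamma>)" by (rule assemble_t)
    have r2: "piece \<rho> c {x. x - L \<in> {j..j + l}} (a + L)" using t_c_right[OF r] by auto
    have 1: "piece (\<rho> \<cdot> \<gamma>) c ({x. x - L \<in> {j..j + l}} \<union> {x. x - L \<in> wpos t \<inter> {j + l..}}) (a + L)"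
      by (rule piece_cat[OF r2 Cc, of "j + L + l"]) (use Cc_min l in auto)
    have A2: "piece \<alpha> c {x. x + e \<in> {?i + l..?i + L}} (?i - e)" using l by (intro b_c[OF A]) auto
    have 2: "piece (\<alpha> \<cdot> \<rho> \<cdot> \<gamma>) c ({x. x + e \<in> {?i + l..?i + L}} \<union> ({x. x - L \<in> {j..j + l}} \<union> {x. x - L \<in> wpos t \<inter> {j + l..}})) (?i - e)"
      by (rule piece_cat[OF A2 1, of "j + L"]) (use Cc_min l lL in auto)
    have r1: "piece \<rho> c {j..j + l} a" using t_c_left[OF r] by auto
    have 3: "piece (\<rho> \<cdot> \<alpha> \<cdot> \<rho> \<cdot> \<gamma>) c ({j..j + l} \<union> ({x. x + e \<in> {?i + l..?i + L}} \<union> ({x. x - L \<in> {j..j + l}} \<union> {x. x - L \<in> wpos t \<inter> {j + l..}}))) a"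
      by (rule piece_cat[OF r1 2, of "j + l"]) (use Cc_min l lL in auto)
    have "{j..j + l} \<union> ({x. x + e \<in> {?i + l..?i + L}} \<union> ({x. x - L \<in> {j..j + l}} \<union> {x. x - L \<in> wpos t \<inter> {j + l..}}))
        = {j..j + L + l} \<union> {x. x - L \<in> wpos t \<inter> {j + l..}}" using l lL L by auto
    then show "piece (\<delta> \<cdot> \<rho> \<cdot> \<alpha> \<cdot> \<rho> \<cdot> \<gamma>) c (wpos c) 0" using assemble 3 by simp
  qed
  show "wsame \<sigma>' (\<beta> \<cdot> \<alpha>') \<and> wsame \<rho> (wpow \<sigma>' m \<cdot> \<beta>) \<and> wsame t (\<delta> \<cdot> wpow \<sigma>' m \<cdot> \<beta> \<cdot> \<gamma>) \<and>
      piece (\<delta> \<cdot> wpow \<sigma>' (m + 1) \<cdot> \<beta> \<cdot> \<gamma>) c (wpos c) 0"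
    if ml: "int m * L \<le> l" and p: "p = l - int m * L" and pL: "p \<le> L"
      and be: "\<beta> = wsub \<sigma>' {0..p}" and al: "\<alpha>' = wsub \<sigma>' {p..L}"
  proof (intro conjI)
    have p0: "0 \<le> p" using ml p by simp
    have A: "piece \<alpha>' b {?i + p..?i + L} ?i"
      unfolding al by (rule piece_wsub[OF S']) (use p0 in auto)
    have Bq: "piece \<beta> b {?i..?i + p} ?i"
      unfolding be by (rule piece_wsub[OF S']) (use pL in auto)
    have Bn: "piece \<beta> b {?i + int n * L..?i + int n * L + p} (?i + int n * L)" for n
    proof -
      have "piece \<beta> b {x. x - int n * L \<in> {?i..?i + p}} (?i + int n * L)"
        by (rule piece_shift[OF Bq]) (simp_all only: perm)
      moreover have "{x. x - int n * L \<in> {?i..?i + p}} = {?i + int n * L..?i + int n * L + p}" by auto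
      ultimately show ?thesis by simp
    qed
    have P: "piece (wpow \<sigma>' n) b {?i..?i + int n * L} ?i" for n
      using w L by (auto simp: piece_def \<sigma>'_def mod_add_left_eq)
    have nL: "0 \<le> int n * L" for n using L by simp
    have mL: "int (m + 1) * L = int m * L + L" by (simp add: algebra_simps)
    have "piece (\<beta> \<cdot> \<alpha>') b ({?i..?i + p} \<union> {?i + p..?i + L}) ?i"
      using p0 pL by (intro piece_cat[OF Bq A, of "?i + p"]) auto
    moreover have "{?i..?i + p} \<union> {?i + p..?i + L} = {?i..?i + L}" using p0 pL by auto
    ultimately show "wsame \<sigma>' (\<beta> \<cdot> \<alpha>')" using piece_wsame[OF S'] by simp
    have PB: "piece (wpow \<sigma>' n \<cdot> \<beta>) b ({?i..?i + int n * L} \<union> {?i + int n * L..?i + int n * L + p}) ?i" for n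
      by (rule piece_cat[OF P Bn, of "?i + int n * L"]) (use p0 nL[of n] in auto)
    have "{?i..?i + int m * L} \<union> {?i + int m * L..?i + int m * L + p} = {?i..?i + l}" using p0 p nL[of m] by auto
    then show "wsame \<rho> (wpow \<sigma>' m \<cdot> \<beta>)" using piece_wsame[OF R] PB[of m] by simp
    have Bt: "piece \<beta> t {x. x + e \<in> {?i + int m * L..?i + int m * L + p}} (?i + int m * L - e)"
      using p nL[of m] by (intro b_t[OF Bn]) auto
    have Pt: "piece (wpow \<sigma>' m) t {x. x + e \<in> {?i..?i + int m * L}} (?i - e)"
      using ml by (intro b_t[OF P]) auto
    have 1: "piece (\<beta> \<cdot> \<gamma>) t ({x. x + e \<in> {?i + int m * L..?i + int m * L + p}} \<union> wpos t \<inter> {j + l..}) (?i + int m * L - e)"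
      by (rule piece_cat[OF Bt C, of "j + l"]) (use p ml jl_in in auto)
    have 2: "piece (wpow \<sigma>' m \<cdot> \<beta> \<cdot> \<gamma>) t ({x. x + e \<in> {?i..?i + int m * L}} \<union> ({x. x + e \<in> {?i + int m * L..?i + int m * L + p}} \<union> wpos t \<inter> {j + l..})) (?i - e)"
      by (rule piece_cat[OF Pt 1, of "j + int m * L"]) (use p p0 ml nL[of m] in auto)
    have "{x. x + e \<in> {?i..?i + int m * L}} \<union> ({x. x + e \<in> {?i + int m * L..?i + int m * L + p}} \<union> wpos t \<inter> {j + l..})
       = {j..j + l} \<union> wpos t \<inter> {j + l..}" using p ml nL[of m] by auto
    then show "wsame t (\<delta> \<cdot> wpow \<sigma>' m \<cdot> \<beta> \<cdot> \<gamma>)" using assemble_t 2 by simp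
    let ?n = "int (m + 1) * L"
    have Bc: "piece \<beta> c {x. x + e \<in> {?i + ?n..?i + ?n + p}} (?i + ?n - e)"
      using p nL[of m] L unfolding mL by (intro b_c[OF Bn[of "m + 1", unfolded mL]]) auto
    have Pc: "piece (wpow \<sigma>' (m + 1)) c {x. x + e \<in> {?i..?i + ?n}} (?i - e)"
      using ml unfolding mL by (intro b_c[OF P[of "m + 1", unfolded mL]]) auto
    have 3: "piece (\<beta> \<cdot> \<gamma>) c ({x. x + e \<in> {?i + ?n..?i + ?n + p}} \<union> {x. x - L \<in> wpos t \<inter> {j + l..}}) (?i + ?n - e)"
      by (rule piece_cat[OF Bc Cc, of "j + L + l"]) (use p ml mL Cc_min in auto)
    have 4: "piece (wpow \<sigma>' (m + 1) \<cdot> \<beta> \<cdot> \<gamma>) c ({x. x + e \<in> {?i..?i + ?n}} \<union> ({x. x + e \<in> {?i + ?n..?i + ?n + p}} \<union> {x. x - L \<in> wpos t \<inter> {j + l..}})) (?i - e)"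
      by (rule piece_cat[OF Pc 3, of "j + ?n"]) (use p p0 ml mL nL[of m] L Cc_min in auto)
    have "{x. x + e \<in> {?i..?i + ?n}} = {j..j + ?n}" by auto
    moreover have "{x. x + e \<in> {?i + ?n..?i + ?n + p}} = {j + ?n..j + L + l}" using p mL by auto
    moreover have "{j..j + ?n} \<union> {j + ?n..j + L + l} = {j..j + L + l}"
      using nL[of "m + 1"] ml mL by (intro ivl_disj_un_two_touch(4)) linarith+
    ultimately have "{x. x + e \<in> {?i..?i + ?n}} \<union> ({x. x + e \<in> {?i + ?n..?i + ?n + p}} \<union> {x. x - L \<in> wpos t \<inter> {j + l..}})
       = {j..j + L + l} \<union> {x. x - L \<in> wpos t \<inter> {j + l..}}" by (simp only: Un_assoc[symmetric])
    then show "piece (\<delta> \<cdot> wpow \<sigma>' (m + 1) \<cdot> \<beta> \<cdot> \<gamma>) c (wpos c) 0" using assemble 4 by simp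
  qed
qed

end

section \<open>Overlaps that are a single vertex\<close>

context gentle_algebra begin

lemma Qdif_scl:
  assumes X: "pre_hobj A X" shows "Qdif A X (\<lambda>v. scl a (u v)) = (\<lambda>v. scl a (Qdif A X u v))"
proof
  fix x show "Qdif A X (\<lambda>v. scl a (u v)) x = scl a (Qdif A X u x)"
    by (cases "x \<in> overts X")
      (simp_all add: Qdif_overts[OF X] Qdif_outside[OF X] lin_scl[OF lin_fwo] lin_scl[OF lin_bwo] scl_add mult.commute)
qed

lemma vanishing_product:
  assumes p: "p \<in> nzpaths A" "nontrivial p" and q: "q \<in> nzpaths A" "nontrivial q" and pq: "pstart q = pend A p"
    and 0: "rmul p (rmul q (path_elt (pend A q, []))) = (0 :: ('v, 'a, 'k::field) algelt)"
  shows "(hd (snd q), last (snd p)) \<in> rels A"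
proof -
  have "rmul q (path_elt (pend A q, [])) = (path_elt q :: ('v, 'a, 'k) algelt)"
    using path_elt_mult[OF q(1) trivial_path_nz[OF nzpaths_end[OF q(1)]], where 'k = 'k] q(1)
    by (cases q) (simp add: rmul_def pstart_def pcomp_def)
  then have 1: "amult A (path_elt q) (path_elt p) = (0 :: ('v, 'a, 'k) algelt)" using 0 by (simp add: rmul_def)
  have "pcomp q p \<notin> nzpaths A"
  proof
    assume "pcomp q p \<in> nzpaths A"
    then have "path_elt (pcomp q p) = (0 :: ('v, 'a, 'k) algelt)" using path_elt_mult[OF p(1) q(1) pq, where 'k = 'k] 1 by simp
    from fun_cong[OF this, of "pcomp q p"] show False by (simp add: path_elt_def)
  qed
  then show ?thesis
    using p q pq nzpaths_append[of "fst p" "snd p" "snd q"]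
    by (cases p, cases q) (auto simp: pcomp_def nontrivial_def pstart_def pend_def)
qed

text \<open>
  Four letters meet at a vertex, \<open>sL\<close> and \<open>sR\<close> in one word, \<open>tL\<close> and \<open>tR\<close> in another one, and the words
  are cut and glued crosswise. If at one end the letters differ by a path \<open>g\<close> or \<open>h\<close>, they
  have the same arrow at the vertex and can be exchanged. Otherwise \<open>sL\<close> and \<open>tR\<close> are direct and \<open>tL\<close>
  and \<open>sR\<close> inverse, as far as they exist, and the two vanishing products say that they meet in relations.
\<close>

lemma crossed_junctions:
  assumes ends: "left_end_ok A sL tL" "right_end_ok A sR tR"
    and ok: "\<And>a. sL = Some a \<Longrightarrow> letter_ok A x a v" "\<And>a. tL = Some a \<Longrightarrow> letter_ok A x' a v"
      "\<And>a. sR = Some a \<Longrightarrow> letter_ok A v a y" "\<And>a. tR = Some a \<Longrightarrow> letter_ok A v a y'"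
    and s: "\<And>a a'. sL = Some a \<Longrightarrow> sR = Some a' \<Longrightarrow> junction_ok A a a'"
    and t: "\<And>a a'. tL = Some a \<Longrightarrow> tR = Some a' \<Longrightarrow> junction_ok A a a'"
    and z1: "bwo tL (bwo sR (path_elt (y, []))) = (0 :: ('v, 'a, 'k::field) algelt)"
    and z2: "fwo tR (fwo sL (path_elt (x, []))) = (0 :: ('v, 'a, 'k) algelt)"
  shows "tL = Some a \<Longrightarrow> sR = Some a' \<Longrightarrow> junction_ok A a a'"
    and "sL = Some a \<Longrightarrow> tR = Some a' \<Longrightarrow> junction_ok A a a'"
proof -
  have hd: "hd (snd (pcomp g p)) = hd (snd p)" if "nontrivial p" for g p :: "('v, 'a) qpath"
    using that by (simp add: pcomp_def nontrivial_def)
  have last: "last (snd (pcomp p g)) = last (snd p)" if "nontrivial p" for g p :: "('v, 'a) qpath"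
    using that by (simp add: pcomp_def nontrivial_def)
  have L: "(\<exists>a a'. sL = Some a \<and> tL = Some a' \<and> (\<forall>r. junction_ok A a r \<longleftrightarrow> junction_ok A a' r)) \<or> (empty_or_dir sL \<and> empty_or_inv tL)"
    using ends(1) unfolding left_end_ok_def
  proof (elim disjE exE conjE)
    fix p g assume *: "sL = Some (Dir p)" "tL = Some (Dir (pcomp g p))"
    then have "nontrivial p" using ok(1) by auto
    then have "junction_ok A (Dir p) r \<longleftrightarrow> junction_ok A (Dir (pcomp g p)) r" for r by (cases r) (simp_all add: hd)
    then show ?thesis using * by blast
  next
    fix p g assume *: "sL = Some (Inv (pcomp p g))" "tL = Some (Inv p)"
    then have "nontrivial p" using ok(2) by auto
    then have "junction_ok A (Inv (pcomp p g)) r \<longleftrightarrow> junction_ok A (Inv p) r" for r by (cases r) (simp_all add: last)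
    then show ?thesis using * by blast
  qed simp
  have R: "(\<exists>a a'. sR = Some a \<and> tR = Some a' \<and> (\<forall>r. junction_ok A r a \<longleftrightarrow> junction_ok A r a')) \<or> (empty_or_inv sR \<and> empty_or_dir tR)"
    using ends(2) unfolding right_end_ok_def
  proof (elim disjE exE conjE)
    fix p h assume *: "sR = Some (Dir (pcomp p h))" "tR = Some (Dir p)"
    then have "nontrivial p" using ok(4) by auto
    then have "junction_ok A r (Dir (pcomp p h)) \<longleftrightarrow> junction_ok A r (Dir p)" for r by (cases r) (simp_all add: last)
    then show ?thesis using * by blast
  next
    fix p h assume *: "sR = Some (Inv p)" "tR = Some (Inv (pcomp h p))"
    then have "nontrivial p" using ok(3) by auto
    then have "junction_ok A r (Inv p) \<longleftrightarrow> junction_ok A r (Inv (pcomp h p))" for r by (cases r) (simp_all add: hd)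
    then show ?thesis using * by blast
  qed simp
  show "junction_ok A a a'" if a: "tL = Some a" "sR = Some a'"
  proof (cases "(empty_or_dir sL \<and> empty_or_inv tL) \<and> (empty_or_inv sR \<and> empty_or_dir tR)")
    case True
    then obtain p q where pq: "a = Inv p" "a' = Inv q" using a by (auto simp: empty_or_inv_def)
    have "pend A q = y" "pstart q = v" "pend A p = v" "p \<in> nzpaths A" "nontrivial p" "q \<in> nzpaths A" "nontrivial q"
      using ok(2)[OF a(1)] ok(3)[OF a(2)] pq by auto
    then show ?thesis using vanishing_product[of p q, where 'k = 'k] z1 a pq by simp
  next
    case False then show ?thesis using L R s t a by fastforce
  qed
  show "junction_ok A a a'" if a: "sL = Some a" "tR = Some a'"
  proof (cases "(empty_or_dir sL \<and> empty_or_inv tL) \<and> (empty_or_inv sR \<and> empty_or_dir tR)")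
    case True
    then obtain p q where pq: "a = Dir p" "a' = Dir q" using a by (auto simp: empty_or_dir_def)
    have "pend A p = x" "pstart p = v" "pend A q = v" "p \<in> nzpaths A" "nontrivial p" "q \<in> nzpaths A" "nontrivial q"
      using ok(1)[OF a(1)] ok(4)[OF a(2)] pq by auto
    then show ?thesis using vanishing_product[of q p, where 'k = 'k] z2 a pq by simp
  next
    case False then show ?thesis using L R s t a by fastforce
  qed
qed

lemma crossed_junctions_of_words:
  assumes w: "is_hword A w1" "is_hword A w2" and v: "wvtx w2 k2 = wvtx w1 k1"
    and ends: "left_end_ok A (olt w1 (k1 - 1)) (olt w2 (k2 - 1))" "right_end_ok A (olt w1 k1) (olt w2 k2)"
    and z: "bw w2 (k2 - 1) (bw w1 k1 (path_elt (wvtx w1 (k1 + 1), []))) = (0 :: ('v, 'a, 'k::field) algelt)"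
      "fw w2 k2 (fw w1 (k1 - 1) (path_elt (wvtx w1 (k1 - 1), []))) = (0 :: ('v, 'a, 'k) algelt)"
  shows "olt w2 (k2 - 1) = Some a \<Longrightarrow> olt w1 k1 = Some a' \<Longrightarrow> junction_ok A a a'"
    and "olt w1 (k1 - 1) = Some a \<Longrightarrow> olt w2 k2 = Some a' \<Longrightarrow> junction_ok A a a'"
proof -
  note h = hwordD(2)[OF w(1), of "k1 - 1"] hwordD(2)[OF w(1), of k1] hwordD(2)[OF w(2), of "k2 - 1"]
    hwordD(2)[OF w(2), of k2] hwordD(3)[OF w(1), of "k1 - 1"] hwordD(3)[OF w(2), of "k2 - 1"]
  note * = crossed_junctions[OF ends, where x = "wvtx w1 (k1 - 1)" and v = "wvtx w1 k1" and y = "wvtx w1 (k1 + 1)"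
      and x' = "wvtx w2 (k2 - 1)" and y' = "wvtx w2 (k2 + 1)", OF _ _ _ _ _ _ z]
  show "junction_ok A a a'" if "olt w2 (k2 - 1) = Some a" "olt w1 k1 = Some a'"
    using h v by (intro *(1)[OF _ _ _ _ _ _ that]) simp_all
  show "junction_ok A a a'" if "olt w1 (k1 - 1) = Some a" "olt w2 k2 = Some a'"
    using h v by (intro *(2)[OF _ _ _ _ _ _ that]) simp_all
qed

lemma unit_at_oix:
  assumes X: "pre_hobj A X" shows "unit_at X (oix X k) (oix X m) = (if oix X m = oix X k then path_elt (wvtx (oword X) k, []) else 0)"
  using hobj_oix(3)[OF X] by (simp add: unit_at_def)

text \<open>
  The vanishing products are the components of \<open>f\<^sub>0 d = d f\<^sub>0\<close> at the vertices next to the left end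
  of the overlap, evaluated at the generators of the two vertices next to it in the band.
\<close>

lemma band_to_string_products:
  fixes X Y :: "('v, 'a, 'k::field) hobj"
  assumes X: "X = HBnd \<sigma> d\<sigma> lam k0" "pre_hobj A X" and Y: "Y = HStr t dt" "pre_hobj A Y" and j: "j \<in> wpos t"
    and chain: "\<And>n x. x \<in> car X n \<Longrightarrow> left_end_map A X Y i j (Qdif A X x) = Qdif A Y (left_end_map A X Y i j x)"
  shows "bw t (j - 1) (bw (unroll \<sigma>) i (path_elt (wvtx (unroll \<sigma>) (i + 1), []))) = (0 :: ('v, 'a, 'k) algelt)"
    and "fw t j (fw (unroll \<sigma>) (i - 1) (path_elt (wvtx (unroll \<sigma>) (i - 1), []))) = (0 :: ('v, 'a, 'k) algelt)"
proof -
  let ?g = "left_end_map A X Y i j" and ?b = "unroll \<sigma>"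
  have ow: "oword X = ?b" "oword Y = t" "oix Y = (\<lambda>k. k)" "\<And>k. ocoef Y k = 1" using X Y by auto
  have kap: "ocoef X k \<noteq> 0" for k using X by auto
  have iX: "k \<in> wpos (oword X)" and jY: "j \<in> wpos (oword Y)" for k using ow j by auto
  have g: "?g u v = (if v = j then scl (ocoef X (oix X (i - 1))) (fw ?b (i - 1) (u (oix X (i - 1)))) else 0) +
      (if v = j - 1 then bw t (j - 1) (u (oix X i)) else 0)" for u v
    unfolding left_end_map_eq[OF iX jY] ow by simp
  have dY: "Qdif A Y = sdif t" using Qdif_sdif[OF Y(2)[unfolded Y(1)]] by (auto simp: Y(1))
  show "bw t (j - 1) (bw ?b i (path_elt (wvtx ?b (i + 1), []))) = (0 :: ('v, 'a, 'k) algelt)"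
  proof -
    let ?x = "unit_at X (oix X (i + 1))"
    have "?g (Qdif A X ?x) (j - 1) = Qdif A Y (?g ?x) (j - 1)"
      using chain[OF unit_at_car[OF X(2) hobj_oix(1)[OF X(2) iX]]] by simp
    then have "bw t (j - 1) (Qdif A X ?x (oix X i)) = bw t (j - 1) (scl (ocoef X (oix X (i - 1))) (fw ?b (i - 1) (?x (oix X (i - 1)))))"
      by (simp add: g dY sdif_def)
    then have "scl (ocoef X (oix X i)) (bw t (j - 1) (bw ?b i (?x (oix X (i + 1))))) = 0"
      unfolding Qdif_line[OF X(2) iX] ow by (simp add: lin_add[OF lin_bwo] lin_scl[OF lin_bwo])
    then show ?thesis using kap unit_at_oix[OF X(2), of "i + 1" "i + 1"] ow by simp
  qed
  show "fw t j (fw ?b (i - 1) (path_elt (wvtx ?b (i - 1), []))) = (0 :: ('v, 'a, 'k) algelt)"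
  proof -
    let ?x = "unit_at X (oix X (i - 1))"
    have "?g (Qdif A X ?x) (j + 1) = Qdif A Y (?g ?x) (j + 1)"
      using chain[OF unit_at_car[OF X(2) hobj_oix(1)[OF X(2) iX]]] by simp
    then have "fw t j (scl (ocoef X (oix X (i - 1))) (fw ?b (i - 1) (?x (oix X (i - 1))))) = 0"
      by (simp add: g dY sdif_def)
    then show ?thesis using kap unit_at_oix[OF X(2), of "i - 1" "i - 1"] ow by (simp add: lin_scl[OF lin_fwo])
  qed
qed

text \<open>
  The same for a map into a band. If the band has only two letters, the two neighbours of a vertex
  coincide, and two further terms appear, which cancel.
\<close>

lemma string_to_band_products:
  fixes X Y :: "('v, 'a, 'k::field) hobj"
  assumes X: "X = HStr t d0" "pre_hobj A X" and Y: "Y = HBnd \<tau> d\<tau> mu k0" "pre_hobj A Y" and i: "i \<in> wpos t"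
    and chain: "\<And>n x. x \<in> car X n \<Longrightarrow> left_end_map A X Y i j (Qdif A X x) = Qdif A Y (left_end_map A X Y i j x)"
  shows "bw (unroll \<tau>) (j - 1) (bw t i (path_elt (wvtx t (i + 1), []))) = (0 :: ('v, 'a, 'k) algelt)"
    and "fw (unroll \<tau>) j (fw t (i - 1) (path_elt (wvtx t (i - 1), []))) = (0 :: ('v, 'a, 'k) algelt)"
proof -
  let ?g = "left_end_map A X Y i j" and ?b = "unroll \<tau>" and ?L = "wlen \<tau>"
  have ow: "oword X = t" "oword Y = ?b" "oix X = (\<lambda>k. k)" "\<And>k. ocoef X k = 1" "overts X = wpos t" "oix Y = (\<lambda>k. k mod ?L)" using X Y by auto
  have kap: "ocoef Y k \<noteq> 0" for k using Y by auto
  have "is_band A \<tau>" using Y by simp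
  then have L2: "?L \<ge> 2" by (rule band_wlen_ge_2)
  have iX: "i \<in> wpos (oword X)" and jY: "k \<in> wpos (oword Y)" for k using ow i by auto
  have ne: "(k - 1) mod ?L \<noteq> k mod ?L" for k
    using mod_Suc_cases[of ?L "k - 1"] L2 by auto
  have g: "?g u v = (if v = oix Y j then fw t (i - 1) (u (i - 1)) else 0) +
      (if v = oix Y (j - 1) then scl (ocoef Y (oix Y (j - 1))) (bw ?b (j - 1) (u i)) else 0)" for u v
    unfolding left_end_map_eq[OF iX jY] ow by simp
  have dX: "Qdif A X = sdif t" using Qdif_sdif[OF X(2)[unfolded X(1)]] by (auto simp: X(1))
  have u: "unit_at X k m = (if m = k then path_elt (wvtx t k, []) else 0)" for k m
    by (simp add: unit_at_def ow)
  show "bw ?b (j - 1) (bw t i (path_elt (wvtx t (i + 1), []))) = (0 :: ('v, 'a, 'k) algelt)"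
  proof (cases "i + 1 \<in> wpos t")
    case True
    let ?x = "unit_at X (i + 1)"
    have "?g (Qdif A X ?x) (oix Y (j - 1)) = Qdif A Y (?g ?x) (oix Y (j - 1))"
      using chain[OF unit_at_car[OF X(2), of "i + 1"]] True ow by simp
    moreover have "?g ?x = 0" by (rule ext) (simp add: g u)
    moreover have "Qdif A Y 0 = 0" using Qdif_add[OF Y(2), of 0 0] by simp
    ultimately have "?g (Qdif A X ?x) (oix Y (j - 1)) = 0" by simp
    then show ?thesis
      unfolding g dX using ne[of j] kap by (simp add: ow sdif_def u)
  qed (simp add: olt_None)
  show "fw ?b j (fw t (i - 1) (path_elt (wvtx t (i - 1), []))) = (0 :: ('v, 'a, 'k) algelt)"
  proof (cases "i - 1 \<in> wpos t")
    case True
    let ?x = "unit_at X (i - 1)" and ?a = "fw t (i - 1) (path_elt (wvtx t (i - 1), [])) :: ('v, 'a, 'k) algelt"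
    have gx: "?g ?x v = (if v = oix Y j then ?a else 0)" for v by (simp add: g u)
    have dxi: "Qdif A X ?x i = ?a" "Qdif A X ?x (i - 1) = 0" by (simp_all add: dX sdif_def u)
    have "?g (Qdif A X ?x) (oix Y (j + 1)) = Qdif A Y (?g ?x) (oix Y (j + 1))"
      using chain[OF unit_at_car[OF X(2), of "i - 1"]] True ow by simp
    moreover have "?g (Qdif A X ?x) (oix Y (j + 1)) =
        (if oix Y (j + 1) = oix Y (j - 1) then scl (ocoef Y (oix Y (j - 1))) (bw ?b (j - 1) ?a) else 0)"
      unfolding g dxi by simp
    moreover have "Qdif A Y (?g ?x) (oix Y (j + 1)) = scl (ocoef Y (oix Y j)) (fw ?b j ?a) +
        (if oix Y (j + 2) = oix Y j then scl (ocoef Y (oix Y (j + 1))) (bw ?b (j + 1) ?a) else 0)"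
      unfolding Qdif_line[OF Y(2) jY] gx by (simp add: ow add.commute)
    moreover have "oix Y (j + 1) = oix Y (j - 1) \<longleftrightarrow> oix Y (j + 2) = oix Y j"
    proof -
      have "(j + 1) mod ?L = (j - 1) mod ?L \<longleftrightarrow> (j + 2) mod ?L = j mod ?L"
        using mod_eq_dvd_iff[of "j + 1" ?L "j - 1"] mod_eq_dvd_iff[of "j + 2" ?L j] by simp
      then show ?thesis by (simp add: ow)
    qed
    moreover have "olt ?b (j + 1) = olt ?b (j - 1)" if "oix Y (j + 1) = oix Y (j - 1)"
      using that by (simp add: ow olt_unroll)
    ultimately have "scl (ocoef Y (oix Y j)) (fw ?b j ?a) = 0" by (auto split: if_splits)
    then show ?thesis using kap by simp
  qed (simp add: olt_None)
qed

lemma left_end_map_chain: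
  fixes X Y :: "('v, 'a, 'k::field) hobj"
  assumes X: "pre_hobj A X" and Y: "pre_hobj A Y" and f: "chain_map A (Qcx A X) (Qcx A Y) f" and c0: "c0 \<noteq> 0"
    and h: "homotopic A (Qcx A X) (Qcx A Y) f (\<lambda>n u v p. c0 * left_end_map A X Y i j u v p)" and x: "x \<in> car X n"
  shows "left_end_map A X Y i j (Qdif A X x) = Qdif A Y (left_end_map A X Y i j x)"
proof -
  have e: "(\<lambda>v p. c0 * left_end_map A X Y i j u v p) = (\<lambda>v. scl c0 (left_end_map A X Y i j u v))" for u
    by (simp add: scl_def)
  have "(\<lambda>v. scl c0 (left_end_map A X Y i j (Qdif A X x) v)) = (\<lambda>v. scl c0 (Qdif A Y (left_end_map A X Y i j x) v))"
    using homotopic_chain_map[OF Qcx_is_complex[OF X] Qcx_is_complex[OF Y] f h x]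
    unfolding e Qcx_simps Qdif_scl[OF Y] .
  then have "scl (1 / c0) (scl c0 (left_end_map A X Y i j (Qdif A X x) v)) = scl (1 / c0) (scl c0 (Qdif A Y (left_end_map A X Y i j x) v))" for v
    by metis
  then show ?thesis using c0 by auto
qed

text \<open>
  From the model \<open>g\<close> of the homotopy set to any of its representatives \<open>f\<close>.
\<close>

lemma cone_Db_iso:
  fixes X Y Z :: "('v, 'a, 'k::field) hobj"
  assumes X: "is_hobj A X" and Y: "is_hobj A Y" and f: "chain_map A (Qcx A X) (Qcx A Y) f"
    and h: "homotopic A (Qcx A X) (Qcx A Y) f g" and Z: "pre_hobj A Z"
    and iso: "chain_iso A (cone (Qcx A X) (Qcx A Y) g) (Qcx A Z) \<psi>"
  shows "is_hobj A Z \<and> Db_iso A (cone (Qcx A X) (Qcx A Y) f) (Qcx A Z)"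
proof -
  let ?M = "cone (Qcx A X) (Qcx A Y) f"
  note cX = Qcx_is_complex[OF hobj_pre[OF X]] and cY = Qcx_is_complex[OF hobj_pre[OF Y]] and cZ = Qcx_is_complex[OF Z]
  have cM: "is_complex A ?M" by (rule cone_is_complex[OF cX cY f])
  obtain \<phi> where "chain_iso A ?M (cone (Qcx A X) (Qcx A Y) g) \<phi>" using cone_homotopic[OF cX cY h] by blast
  from chain_iso_trans[OF this iso] obtain \<chi> where \<chi>: "chain_iso A ?M (Qcx A Z) \<chi>" by blast
  have "bounded_cohomology (Qcx A Z)"
    using chain_iso_bounded_cohomology[OF cM cZ \<chi> cone_bounded_cohomology[OF cX cY f hobj_bounded[OF X] hobj_bounded[OF Y]]] .
  then have hZ: "is_hobj A Z" by (rule pre_hobj_is_hobj[OF Z])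
  have "in_Db A ?M" by (rule chain_iso_in_Db[OF cM chain_iso_sym[OF cM \<chi>] hobj_in_Db[OF hZ]])
  then show ?thesis using hZ chain_iso_Db_iso[OF _ hobj_in_Db[OF hZ] \<chi>] by blast
qed

lemma band_to_string_insertion:
  fixes X Y :: "('v, 'a, 'k::field) hobj"
  assumes X: "is_hobj A X" "X = HBnd \<sigma> d\<sigma> lam k0" and Y: "is_hobj A Y" "Y = HStr \<tau> d\<tau>"
    and q: "quasi_graph_map A X Y S s" and r: "represents A X Y S s f" and S: "S = {i..i + l}" "0 \<le> l"
  shows "insertion A \<tau> (unroll \<sigma>) (i + s) (- s) (wlen \<sigma>) l d\<tau> (\<lambda>k. odeg X k - 1)"
    and "piece (wsub (oword X) S) \<tau> {i + s..i + s + l} s"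
    and "piece w (ins \<tau> (i + s) (unroll \<sigma>) (- s) (wlen \<sigma>)) (wpos (ins \<tau> (i + s) (unroll \<sigma>) (- s) (wlen \<sigma>))) 0 \<Longrightarrow>
      \<exists>dc. (\<forall>k \<in> wpos (wsub \<tau> {..i + s}). dc k = d\<tau> k) \<and> is_hobj A (HStr w dc :: ('v, 'a, 'k) hobj) \<and>
        Db_iso A (cone (Qcx A X) (Qcx A Y) f) (Qcx A (HStr w dc :: ('v, 'a, 'k) hobj))"
proof -
  let ?b = "unroll \<sigma>" and ?L = "wlen \<sigma>" and ?j = "i + s" and ?db = "\<lambda>k. odeg X k - 1"
  have ow: "oword X = ?b" "oword Y = \<tau>" "odeg Y = d\<tau>" using X Y by auto
  have band: "is_band A \<sigma>" using X by simp
  have S_inf: "Inf S = i" "Sup S = i + l" "bdd_below S" "bdd_above S" "i \<in> S" "i + l \<in> S" using S by auto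
  have ov: "overlap X Y S s" and deg: "\<And>k. k \<in> S \<Longrightarrow> odeg Y (k + s) = odeg X k - 1"
    and left: "left_end_ok A (ltr_left ?b i) (ltr_left \<tau> ?j)"
    and right: "right_end_ok A (ltr_right ?b (i + l)) (ltr_right \<tau> (i + l + s))"
    using q S_inf unfolding quasi_graph_map_def maximal_overlap_def ow by auto
  have pos: "(\<lambda>k. k + s) ` S \<subseteq> wpos \<tau>" and vtx: "\<And>k. k \<in> S \<Longrightarrow> wvtx \<tau> (k + s) = wvtx ?b k"
    and ltr: "\<And>k. k \<in> S \<Longrightarrow> k + 1 \<in> S \<Longrightarrow> wltr \<tau> (k + s) = wltr ?b k"
    using ov unfolding overlap_def ow by auto
  have tp: "x \<in> wpos \<tau>" if "?j \<le> x" "x \<le> ?j + l" for x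
  proof -
    have "x - s \<in> S" using that S by auto
    then show ?thesis using pos by force
  qed
  obtain c0 where c0: "c0 \<noteq> 0" and f: "chain_map A (Qcx A X) (Qcx A Y) f"
    and h: "homotopic A (Qcx A X) (Qcx A Y) f (\<lambda>n u v p. c0 * left_end_map A X Y i ?j u v p)"
    using r unfolding represents_def S_inf by blast
  note pX = hobj_pre[OF X(1)] and pY = hobj_pre[OF Y(1)]
  have tw: "is_hword A \<tau>" and bw: "is_hword A ?b" using hobj_hword[OF pY] hobj_hword[OF pX] by (simp_all add: ow)
  have jt: "?j \<in> wpos \<tau>" using tp S(2) by simp
  have chain: "left_end_map A X Y i ?j (Qdif A X x) = Qdif A Y (left_end_map A X Y i ?j x)" if "x \<in> car X n" for n x
    using left_end_map_chain[OF pX pY f c0 h that] .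
  have products: "bw \<tau> (?j - 1) (bw ?b i (path_elt (wvtx ?b (i + 1), []))) = (0 :: ('v, 'a, 'k) algelt)"
    "fw \<tau> ?j (fw ?b (i - 1) (path_elt (wvtx ?b (i - 1), []))) = (0 :: ('v, 'a, 'k) algelt)"
    by (rule band_to_string_products[OF X(2) pX Y(2) pY jt], erule chain)+
  \<comment> \<open>the two junctions at which letters of the string and of the band meet\<close>
  have meet: "(\<forall>a. olt \<tau> (?j - 1) = Some a \<longrightarrow> junction_ok A a (wltr ?b i)) \<and>
      (\<forall>a. olt \<tau> ?j = Some a \<longrightarrow> junction_ok A (wltr ?b (i - 1)) a)" if l0: "l = 0"
  proof -
    have ends: "left_end_ok A (olt ?b (i - 1)) (olt \<tau> (?j - 1))" "right_end_ok A (olt ?b i) (olt \<tau> ?j)"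
      using left right l0 jt by (simp_all add: ltr_left_olt ltr_right_olt)
    have v: "wvtx \<tau> ?j = wvtx ?b i" using vtx S_inf by simp
    have olt_b: "olt ?b k = Some (wltr ?b k)" for k by (simp add: olt_def)
    show ?thesis using crossed_junctions_of_words[OF bw tw v ends products] olt_b by blast
  qed
  show ins: "insertion A \<tau> ?b ?j (- s) ?L l d\<tau> ?db"
  proof unfold_locales
    show "is_hword A \<tau>" "is_hword A ?b" by (rule tw, rule bw)
    show "wpos ?b = UNIV" by simp
    show "grading \<tau> d\<tau>" using hobj_grading[OF pY] by (simp add: ow)
    show "grading ?b ?db" using hobj_grading[OF pX] unfolding ow grading_def by auto
    show "(\<exists>n. \<forall>k \<in> wpos \<tau>. d\<tau> k \<le> n) \<and> (\<forall>i. finite {k \<in> wpos \<tau>. d\<tau> k = i})" if "infinite (wpos \<tau>)"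
      using Y(1) that unfolding Y(2) is_hobj.simps by blast
    show "?L > 0" by (rule band_wpos(1)[OF band])
    show "0 \<le> l" by (rule S(2))
    show "wvtx ?b (k + ?L) = wvtx ?b k" "wltr ?b (k + ?L) = wltr ?b k" "?db (k + ?L) = ?db k" for k
      by (simp_all add: X(2))
    show "{?j..?j + l} \<subseteq> wpos \<tau>" using tp by auto
    show "wvtx \<tau> k = wvtx ?b (k + - s)" "d\<tau> k = ?db (k + - s)" if "?j \<le> k" "k \<le> ?j + l" for k
    proof -
      have "k - s \<in> S" using that S by auto
      then show "wvtx \<tau> k = wvtx ?b (k + - s)" "d\<tau> k = ?db (k + - s)"
        using vtx[of "k - s"] deg[of "k - s"] ow by simp_all
    qed
    show "wltr \<tau> k = wltr ?b (k + - s)" if "?j \<le> k" "k < ?j + l" for k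
    proof -
      have "k - s \<in> S" "k - s + 1 \<in> S" using that S by auto
      then show ?thesis using ltr[of "k - s"] by simp
    qed
    show "junction_ok A a (wltr ?b (?j + - s))" if "l = 0" "olt \<tau> (?j - 1) = Some a" for a
      using meet that by simp
    show "junction_ok A (wltr ?b (?j + - s - 1)) a" if "l = 0" "olt \<tau> ?j = Some a" for a
      using meet that by simp
  qed
  show "piece (wsub (oword X) S) \<tau> {?j..?j + l} s"
    using vtx ltr unfolding ow piece_def S(1) by (auto simp: wsub_def)
  interpret I: insertion A \<tau> ?b ?j "- s" ?L l d\<tau> ?db by (rule ins)
  let ?Z = "ins \<tau> ?j ?b (- s) ?L"
  assume w: "piece w ?Z (wpos ?Z) 0"
  have ends: "right_end_ok A (ltr_right ?b (?j + l + - s)) (ltr_right \<tau> (?j + l))" "left_end_ok A (ltr_left ?b (?j + - s)) (ltr_left \<tau> ?j)"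
    using left right by (simp_all add: algebra_simps)
  obtain \<psi> where \<psi>: "chain_iso A (cone (Qcx A X) (Qcx A Y) (\<lambda>n u v p. c0 * left_end_map A X Y (?j + - s) ?j u v p)) (Qcx A (HStr ?Z I.dc)) \<psi>"
    using I.band_to_string_iso[OF X(2) pX Y(2) pY refl refl refl c0 ends] by blast
  have Z: "is_hobj A (HStr ?Z I.dc :: ('v, 'a, 'k) hobj) \<and> Db_iso A (cone (Qcx A X) (Qcx A Y) f) (Qcx A (HStr ?Z I.dc :: ('v, 'a, 'k) hobj))"
    using h by (intro cone_Db_iso[OF X(1) Y(1) f _ I.pre_hobj_c \<psi>]) simp
  have "\<forall>k \<in> wpos (wsub \<tau> {..?j}). I.dc k = d\<tau> k"
    using I.c_left(3) S(2) by (auto simp: wsub_def)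
  then show "\<exists>dc. (\<forall>k \<in> wpos (wsub \<tau> {..?j}). dc k = d\<tau> k) \<and> is_hobj A (HStr w dc :: ('v, 'a, 'k) hobj) \<and>
        Db_iso A (cone (Qcx A X) (Qcx A Y) f) (Qcx A (HStr w dc :: ('v, 'a, 'k) hobj))"
    using Z is_hobj_piece[OF w] unfolding Qcx_piece[OF w] by blast
qed

lemma string_to_band_insertion:
  fixes X Y :: "('v, 'a, 'k::field) hobj"
  assumes X: "is_hobj A X" "X = HStr \<sigma> d\<sigma>" and Y: "is_hobj A Y" "Y = HBnd \<tau> d\<tau> mu k0"
    and q: "quasi_graph_map A X Y S s" and r: "represents A X Y S s f" and S: "S = {i..i + l}" "0 \<le> l"
  shows "insertion A \<sigma> (unroll \<tau>) i s (wlen \<tau>) l (\<lambda>k. d\<sigma> k - 1) (odeg Y)"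
    and "piece (wsub (oword X) S) \<sigma> {i..i + l} 0"
    and "piece w (ins \<sigma> i (unroll \<tau>) s (wlen \<tau>)) (wpos (ins \<sigma> i (unroll \<tau>) s (wlen \<tau>))) 0 \<Longrightarrow>
      \<exists>dc. (\<forall>k \<in> wpos (wsub \<sigma> {..i}). dc k = d\<sigma> k - 1) \<and> is_hobj A (HStr w dc :: ('v, 'a, 'k) hobj) \<and>
        Db_iso A (cone (Qcx A X) (Qcx A Y) f) (Qcx A (HStr w dc :: ('v, 'a, 'k) hobj))"
proof -
  let ?b = "unroll \<tau>" and ?L = "wlen \<tau>" and ?j = "i + s" and ?dt = "\<lambda>k. d\<sigma> k - 1"
  have ow: "oword X = \<sigma>" "oword Y = ?b" "odeg X = d\<sigma>" using X Y by auto
  have band: "is_band A \<tau>" using Y by simp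
  have S_inf: "Inf S = i" "Sup S = i + l" "bdd_below S" "bdd_above S" "i \<in> S" "i + l \<in> S" using S by auto
  have ov: "overlap X Y S s" and deg: "\<And>k. k \<in> S \<Longrightarrow> odeg Y (k + s) = odeg X k - 1"
    and left: "left_end_ok A (ltr_left \<sigma> i) (ltr_left ?b ?j)"
    and right: "right_end_ok A (ltr_right \<sigma> (i + l)) (ltr_right ?b (i + l + s))"
    using q S_inf unfolding quasi_graph_map_def maximal_overlap_def ow by auto
  have pos: "S \<subseteq> wpos \<sigma>" and vtx: "\<And>k. k \<in> S \<Longrightarrow> wvtx ?b (k + s) = wvtx \<sigma> k"
    and ltr: "\<And>k. k \<in> S \<Longrightarrow> k + 1 \<in> S \<Longrightarrow> wltr ?b (k + s) = wltr \<sigma> k"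
    using ov unfolding overlap_def ow by auto
  obtain c0 where c0: "c0 \<noteq> 0" and f: "chain_map A (Qcx A X) (Qcx A Y) f"
    and h: "homotopic A (Qcx A X) (Qcx A Y) f (\<lambda>n u v p. c0 * left_end_map A X Y i ?j u v p)"
    using r unfolding represents_def S_inf by blast
  note pX = hobj_pre[OF X(1)] and pY = hobj_pre[OF Y(1)]
  have tw: "is_hword A \<sigma>" and bw: "is_hword A ?b" using hobj_hword[OF pX] hobj_hword[OF pY] by (simp_all add: ow)
  have it: "i \<in> wpos \<sigma>" using pos S_inf by blast
  have chain: "left_end_map A X Y i ?j (Qdif A X x) = Qdif A Y (left_end_map A X Y i ?j x)" if "x \<in> car X n" for n x
    using left_end_map_chain[OF pX pY f c0 h that] .
  have products: "bw ?b (?j - 1) (bw \<sigma> i (path_elt (wvtx \<sigma> (i + 1), []))) = (0 :: ('v, 'a, 'k) algelt)"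
    "fw ?b ?j (fw \<sigma> (i - 1) (path_elt (wvtx \<sigma> (i - 1), []))) = (0 :: ('v, 'a, 'k) algelt)"
    by (rule string_to_band_products[OF X(2) pX Y(2) pY it], erule chain)+
  \<comment> \<open>the two junctions at which letters of the string and of the band meet\<close>
  have meet: "(\<forall>a. olt \<sigma> (i - 1) = Some a \<longrightarrow> junction_ok A a (wltr ?b ?j)) \<and>
      (\<forall>a. olt \<sigma> i = Some a \<longrightarrow> junction_ok A (wltr ?b (?j - 1)) a)" if l0: "l = 0"
  proof -
    have ends: "left_end_ok A (olt \<sigma> (i - 1)) (olt ?b (?j - 1))" "right_end_ok A (olt \<sigma> i) (olt ?b ?j)"
      using left right l0 it by (simp_all add: ltr_left_olt ltr_right_olt)
    have v: "wvtx ?b ?j = wvtx \<sigma> i" using vtx S_inf by simp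
    have olt_b: "olt ?b k = Some (wltr ?b k)" for k by (simp add: olt_def)
    show ?thesis using crossed_junctions_of_words[OF tw bw v ends products] olt_b by blast
  qed
  show ins: "insertion A \<sigma> ?b i s ?L l ?dt (odeg Y)"
  proof unfold_locales
    show "is_hword A \<sigma>" "is_hword A ?b" by (rule tw, rule bw)
    show "wpos ?b = UNIV" by simp
    show "grading \<sigma> ?dt" using hobj_grading[OF pX] unfolding ow grading_def by auto
    show "grading ?b (odeg Y)" using hobj_grading[OF pY] unfolding ow .
    show "(\<exists>n. \<forall>k \<in> wpos \<sigma>. ?dt k \<le> n) \<and> (\<forall>m. finite {k \<in> wpos \<sigma>. ?dt k = m})" if "infinite (wpos \<sigma>)"
    proof -
      have "\<exists>n. \<forall>k \<in> wpos \<sigma>. d\<sigma> k \<le> n" and fin: "\<forall>m. finite {k \<in> wpos \<sigma>. d\<sigma> k = m}"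
        using X(1) that unfolding X(2) is_hobj.simps by blast+
      then obtain n where n: "\<forall>k \<in> wpos \<sigma>. d\<sigma> k \<le> n" by blast
      have e: "{k \<in> wpos \<sigma>. ?dt k = m} = {k \<in> wpos \<sigma>. d\<sigma> k = m + 1}" for m by auto
      have "\<forall>k \<in> wpos \<sigma>. ?dt k \<le> n" using n by auto
      then show ?thesis unfolding e using fin by blast
    qed
    show "?L > 0" by (rule band_wpos(1)[OF band])
    show "0 \<le> l" by (rule S(2))
    show "wvtx ?b (k + ?L) = wvtx ?b k" "wltr ?b (k + ?L) = wltr ?b k" "odeg Y (k + ?L) = odeg Y k" for k
      by (simp_all add: Y(2))
    show "{i..i + l} \<subseteq> wpos \<sigma>" using pos S by simp
    show "wvtx \<sigma> k = wvtx ?b (k + s)" "?dt k = odeg Y (k + s)" if "i \<le> k" "k \<le> i + l" for k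
      using that vtx[of k] deg[of k] ow S by simp_all
    show "wltr \<sigma> k = wltr ?b (k + s)" if "i \<le> k" "k < i + l" for k
      using that ltr[of k] S by simp
    show "junction_ok A a (wltr ?b (i + s))" if "l = 0" "olt \<sigma> (i - 1) = Some a" for a
      using meet that by simp
    show "junction_ok A (wltr ?b (i + s - 1)) a" if "l = 0" "olt \<sigma> i = Some a" for a
      using meet that by simp
  qed
  show "piece (wsub (oword X) S) \<sigma> {i..i + l} 0"
    using pos unfolding ow S(1) by (intro piece_wsub[OF piece_self]) auto
  interpret I: insertion A \<sigma> ?b i s ?L l ?dt "odeg Y" by (rule ins)
  let ?Z = "ins \<sigma> i ?b s ?L"
  assume w: "piece w ?Z (wpos ?Z) 0"
  have ends: "right_end_ok A (ltr_right \<sigma> (i + l)) (ltr_right ?b (i + l + s))" "left_end_ok A (ltr_left \<sigma> i) (ltr_left ?b (i + s))"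
    using left right by simp_all
  obtain \<phi> where \<phi>: "chain_iso A (Qcx A (HStr ?Z I.dc)) (cone (Qcx A X) (Qcx A Y) (\<lambda>n u v p. c0 * left_end_map A X Y i ?j u v p)) \<phi>"
    using I.string_to_band_iso[OF X(2) pX Y(2) pY refl refl refl refl c0 ends] by blast
  note \<psi> = chain_iso_sym[OF Qcx_is_complex[OF I.pre_hobj_c] \<phi>]
  have Z: "is_hobj A (HStr ?Z I.dc :: ('v, 'a, 'k) hobj) \<and> Db_iso A (cone (Qcx A X) (Qcx A Y) f) (Qcx A (HStr ?Z I.dc :: ('v, 'a, 'k) hobj))"
    by (rule cone_Db_iso[OF X(1) Y(1) f h I.pre_hobj_c \<psi>])
  have "\<forall>k \<in> wpos (wsub \<sigma> {..i}). I.dc k = d\<sigma> k - 1"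
    using I.c_left(3) S(2) by (auto simp: wsub_def)
  then show "\<exists>dc. (\<forall>k \<in> wpos (wsub \<sigma> {..i}). dc k = d\<sigma> k - 1) \<and> is_hobj A (HStr w dc :: ('v, 'a, 'k) hobj) \<and>
        Db_iso A (cone (Qcx A X) (Qcx A Y) f) (Qcx A (HStr w dc :: ('v, 'a, 'k) hobj))"
    using Z is_hobj_piece[OF w] unfolding Qcx_piece[OF w] by blast
qed

end

section \<open>The cone formula\<close>

lemma overlap_word_bounds:
  assumes S: "S \<subseteq> wpos w"
    and pr: "proper_subword (wsub w S) v" and v: "wpos v = {0..N}"
  obtains i l where "S = {i..i + l}" "0 \<le> l" "l < N"
proof -
  have sub: "subword (wsub w S) v" and ne: "\<not> wsame (wsub w S) v" using pr by (simp_all add: proper_subword_def)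
  have "wpos (wsub w S) = S" using S by (auto simp: wsub_def)
  then obtain i l where il: "S = {i..i + l}" "0 \<le> l" "l \<le> N - 0" "l = N - 0 \<Longrightarrow> wsame (wsub w S) v"
    using subword_length[OF sub v] by metis
  then show thesis using that[of i l] ne by (cases "l = N") auto
qed

lemma power_length:
  assumes sub: "subword u (wsub w S)" and u: "wpos u = {0..n}" "0 \<le> n" and S: "S \<subseteq> wpos w" "S = {i..i + l}"
  shows "n \<le> l"
proof -
  have "wpos (wsub w S) = {i..i + l}" using S by (auto simp: wsub_def)
  then obtain i' l' where "wpos u = {i'..i' + l'}" "0 \<le> l'" "l' \<le> i + l - i" using subword_length[OF sub] by metis
  then show ?thesis using u by (auto simp: atLeastatMost_empty_iff2 Icc_eq_Icc)
qed

context gentle_algebra begin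

text \<open>
  The common form of the two halves of the theorem: \<open>t\<close> is the string, \<open>w\<close> the band, \<open>jf i\<close> the vertex
  of \<open>t\<close> at which an overlap beginning at the vertex \<open>i\<close> of the source begins, and \<open>P\<close> what is claimed of the
  word of the cone. The conditions on \<open>\<rho>\<close> are used to see that the overlap is finite, and how
  its length compares with that of the band.
\<close>

lemma band_insertion_words:
  fixes t v w :: "('v, 'a) word" and jf :: "int \<Rightarrow> int" and P :: "('v, 'a) word \<Rightarrow> bool"
  assumes S: "S \<subseteq> wpos v" and L: "wlen w > 0"
    and ins: "\<And>i l. S = {i..i + l} \<Longrightarrow> 0 \<le> l \<Longrightarrow> \<exists>a dt db. piece (wsub v S) t {jf i..jf i + l} a \<and>
      insertion A t (unroll w) (jf i) e (wlen w) l dt db"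
    and P: "\<And>i l u. S = {i..i + l} \<Longrightarrow> 0 \<le> l \<Longrightarrow>
      piece u (ins t (jf i) (unroll w) e (wlen w)) (wpos (ins t (jf i) (unroll w) e (wlen w))) 0 \<Longrightarrow> P u"
    and rot: "jf (Inf S) + e = rot" and j: "jf (Inf S) = j" and l: "wlen (wsub v S) = l"
  defines "\<rho> \<equiv> wsub v S" and "\<sigma>' \<equiv> wrot rot w" and "\<delta> \<equiv> wsub t {..j}" and "\<gamma> \<equiv> wsub t {j + l..}"
  shows "\<exists>r. proper_subword \<rho> (wrot r w) \<Longrightarrow>
      wsame \<sigma>' (\<rho> \<cdot> wsub \<sigma>' {l..wlen w}) \<and> wsame t (\<delta> \<cdot> \<rho> \<cdot> \<gamma>) \<and> P (\<delta> \<cdot> \<rho> \<cdot> wsub \<sigma>' {l..wlen w} \<cdot> \<rho> \<cdot> \<gamma>)"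
    and "\<exists>r. proper_subword \<rho> (wpow (wrot r w) (m + 1)) \<Longrightarrow> \<exists>r. subword (wpow (wrot r w) m) \<rho> \<Longrightarrow>
      wsame \<sigma>' (wsub \<sigma>' {0..l - int m * wlen w} \<cdot> wsub \<sigma>' {l - int m * wlen w..wlen w}) \<and>
      wsame \<rho> (wpow \<sigma>' m \<cdot> wsub \<sigma>' {0..l - int m * wlen w}) \<and>
      wsame t (\<delta> \<cdot> wpow \<sigma>' m \<cdot> wsub \<sigma>' {0..l - int m * wlen w} \<cdot> \<gamma>) \<and>
      P (\<delta> \<cdot> wpow \<sigma>' (m + 1) \<cdot> wsub \<sigma>' {0..l - int m * wlen w} \<cdot> \<gamma>)"
proof -
  have pos: "wpos (wrot r w) = {0..wlen w}" "wpos (wpow (wrot r w) m) = {0..int m * wlen w}" for r m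
    using L by simp_all
  have bounds: "jf i + e = rot" "jf i = j" "l' = l" if il: "S = {i..i + l'}" "0 \<le> l'" for i l'
  proof -
    have "Inf S = i" using il by simp
    then show "jf i + e = rot" "jf i = j" using rot j by auto
    have "wpos (wsub v S) = {i..i + l'}" using S il by (auto simp: wsub_def)
    then show "l' = l" using wlen_interval[of "wsub v S" i "i + l'"] il(2) l by simp
  qed
  show "wsame \<sigma>' (\<rho> \<cdot> wsub \<sigma>' {l..wlen w}) \<and> wsame t (\<delta> \<cdot> \<rho> \<cdot> \<gamma>) \<and> P (\<delta> \<cdot> \<rho> \<cdot> wsub \<sigma>' {l..wlen w} \<cdot> \<rho> \<cdot> \<gamma>)"
    if pr: "\<exists>r. proper_subword \<rho> (wrot r w)"
  proof -
    obtain i l' where il: "S = {i..i + l'}" "0 \<le> l'" "l' < wlen w"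
      using pr overlap_word_bounds[OF S _ pos(1)] unfolding \<rho>_def by metis
    note b = bounds[OF il(1,2)]
    obtain a dt db where r: "piece \<rho> t {j..j + l} a" and "insertion A t (unroll w) j e (wlen w) l dt db"
      using ins[OF il(1,2)] unfolding b \<rho>_def by blast
    then interpret I: insertion A t "unroll w" j e "wlen w" l dt db by blast
    have "l \<le> wlen w" using il b by simp
    note * = I.ins_words(1)[OF refl refl r this refl]
    show ?thesis using * P[OF il(1,2)] b unfolding \<sigma>'_def \<delta>_def \<gamma>_def by simp
  qed
  show "wsame \<sigma>' (wsub \<sigma>' {0..l - int m * wlen w} \<cdot> wsub \<sigma>' {l - int m * wlen w..wlen w}) \<and>
      wsame \<rho> (wpow \<sigma>' m \<cdot> wsub \<sigma>' {0..l - int m * wlen w}) \<and>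
      wsame t (\<delta> \<cdot> wpow \<sigma>' m \<cdot> wsub \<sigma>' {0..l - int m * wlen w} \<cdot> \<gamma>) \<and>
      P (\<delta> \<cdot> wpow \<sigma>' (m + 1) \<cdot> wsub \<sigma>' {0..l - int m * wlen w} \<cdot> \<gamma>)"
    if pr: "\<exists>r. proper_subword \<rho> (wpow (wrot r w) (m + 1))" and sub: "\<exists>r. subword (wpow (wrot r w) m) \<rho>"
  proof -
    obtain i l' where il: "S = {i..i + l'}" "0 \<le> l'" "l' < int (m + 1) * wlen w"
      using pr overlap_word_bounds[OF S _ pos(2)] unfolding \<rho>_def by metis
    note b = bounds[OF il(1,2)]
    have ml: "int m * wlen w \<le> l" using sub power_length[OF _ pos(2) _ S il(1)] L b unfolding \<rho>_def by fastforce
    have pL: "l - int m * wlen w \<le> wlen w" using il(3) b by (simp add: algebra_simps)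
    obtain a dt db where r: "piece \<rho> t {j..j + l} a" and "insertion A t (unroll w) j e (wlen w) l dt db"
      using ins[OF il(1,2)] unfolding b \<rho>_def by blast
    then interpret I: insertion A t "unroll w" j e "wlen w" l dt db by blast
    note * = I.ins_words(2)[OF refl refl r ml refl pL refl refl]
    show ?thesis using * P[OF il(1,2)] b unfolding \<sigma>'_def \<delta>_def \<gamma>_def by simp
  qed
qed

end

theorem proposition3p1:
  fixes A :: "('v, 'a) bound_quiver"
    and X Y :: "('v, 'a, 'k::field) hobj"
    and S :: "int set" and s :: int
    and f :: "int \<Rightarrow> ('v, 'a, 'k) dsum \<Rightarrow> ('v, 'a, 'k) dsum"
  assumes "gentle A"
    and "is_hobj A X"
    and "is_hobj A Y"
    and "quasi_graph_map A X Y S s"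
    and "represents A X Y S s f"
  shows
    "(let \<rho> = wsub (oword X) S; l = wlen \<rho>; i = Inf S; j = Inf S + s;
          M = cone (Qcx A X) (Qcx A Y) f in
       (\<forall>\<sigma> d\<sigma> lam k0 \<tau> d\<tau>. X = HBnd \<sigma> d\<sigma> lam k0 \<and> Y = HStr \<tau> d\<tau> \<longrightarrow>
          ((\<exists>r. proper_subword \<rho> (wrot r \<sigma>)) \<longrightarrow>
             (let \<sigma>' = wrot i \<sigma>;
                  \<alpha> = wsub \<sigma>' {l..wlen \<sigma>};
                  \<delta> = wsub \<tau> {..j};
                  \<gamma> = wsub \<tau> {j + l..};
                  c = \<delta> \<cdot> \<rho> \<cdot> \<alpha> \<cdot> \<rho> \<cdot> \<gamma> in
                wsame \<sigma>' (\<rho> \<cdot> \<alpha>) \<and> wsame \<tau> (\<delta> \<cdot> \<rho> \<cdot> \<gamma>) \<and>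
                (\<exists>dc. (\<forall>k \<in> wpos \<delta>. dc k = d\<tau> k) \<and>
                   (let C = (HStr c dc :: ('v, 'a, 'k) hobj) in
                      is_hobj A C \<and> Db_iso A M (Qcx A C))))) \<and>
          (\<forall>m \<ge> 1. (\<exists>r. proper_subword \<rho> (wpow (wrot r \<sigma>) (m + 1))) \<and>
                   (\<exists>r. subword (wpow (wrot r \<sigma>) m) \<rho>) \<longrightarrow>
             (let \<sigma>' = wrot i \<sigma>;
                  b = l - int m * wlen \<sigma>;
                  \<beta> = wsub \<sigma>' {0..b};
                  \<alpha> = wsub \<sigma>' {b..wlen \<sigma>};
                  \<delta> = wsub \<tau> {..j};
                  \<gamma> = wsub \<tau> {j + l..};
                  c = \<delta> \<cdot> wpow \<sigma>' (m + 1) \<cdot> \<beta> \<cdot> \<gamma> in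
                wsame \<sigma>' (\<beta> \<cdot> \<alpha>) \<and> wsame \<rho> (wpow \<sigma>' m \<cdot> \<beta>) \<and>
                wsame \<tau> (\<delta> \<cdot> wpow \<sigma>' m \<cdot> \<beta> \<cdot> \<gamma>) \<and>
                (\<exists>dc. (\<forall>k \<in> wpos \<delta>. dc k = d\<tau> k) \<and>
                   (let C = (HStr c dc :: ('v, 'a, 'k) hobj) in
                      is_hobj A C \<and> Db_iso A M (Qcx A C)))))) \<and>
       (\<forall>\<sigma> d\<sigma> \<tau> d\<tau> \<mu> k0. X = HStr \<sigma> d\<sigma> \<and> Y = HBnd \<tau> d\<tau> \<mu> k0 \<longrightarrow>
          ((\<exists>r. proper_subword \<rho> (wrot r \<tau>)) \<longrightarrow>
             (let \<tau>' = wrot j \<tau>;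
                  \<gamma> = wsub \<tau>' {l..wlen \<tau>};
                  \<beta> = wsub \<sigma> {..i};
                  \<alpha> = wsub \<sigma> {i + l..};
                  c = \<beta> \<cdot> \<rho> \<cdot> \<gamma> \<cdot> \<rho> \<cdot> \<alpha> in
                wsame \<tau>' (\<rho> \<cdot> \<gamma>) \<and> wsame \<sigma> (\<beta> \<cdot> \<rho> \<cdot> \<alpha>) \<and>
                (\<exists>dc. (\<forall>k \<in> wpos \<beta>. dc k = d\<sigma> k - 1) \<and>
                   (let C = (HStr c dc :: ('v, 'a, 'k) hobj) in
                      is_hobj A C \<and> Db_iso A M (Qcx A C))))) \<and>
          (\<forall>n \<ge> 1. (\<exists>r. proper_subword \<rho> (wpow (wrot r \<tau>) (n + 1))) \<and>
                   (\<exists>r. subword (wpow (wrot r \<tau>) n) \<rho>) \<longrightarrow>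
             (let \<tau>' = wrot j \<tau>;
                  b = l - int n * wlen \<tau>;
                  \<delta> = wsub \<tau>' {0..b};
                  \<gamma> = wsub \<tau>' {b..wlen \<tau>};
                  \<beta> = wsub \<sigma> {..i};
                  \<alpha> = wsub \<sigma> {i + l..};
                  c = \<beta> \<cdot> wpow \<tau>' (n + 1) \<cdot> \<delta> \<cdot> \<alpha> in
                wsame \<tau>' (\<delta> \<cdot> \<gamma>) \<and> wsame \<rho> (wpow \<tau>' n \<cdot> \<delta>) \<and>
                wsame \<sigma> (\<beta> \<cdot> wpow \<tau>' n \<cdot> \<delta> \<cdot> \<alpha>) \<and>
                (\<exists>dc. (\<forall>k \<in> wpos \<beta>. dc k = d\<sigma> k - 1) \<and>
                   (let C = (HStr c dc :: ('v, 'a, 'k) hobj) in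
                      is_hobj A C \<and> Db_iso A M (Qcx A C)))))))"
proof -
  interpret gentle_algebra A by unfold_locales (rule assms(1))
  note X = assms(2) and Y = assms(3) and q = assms(4) and r = assms(5)
  have S: "S \<subseteq> wpos (oword X)"
    using q by (simp add: quasi_graph_map_def maximal_overlap_def overlap_def)
  let ?M = "cone (Qcx A X) (Qcx A Y) f"
  { fix \<sigma> \<tau> d\<sigma> d\<tau> lam k0 assume X': "X = HBnd \<sigma> d\<sigma> lam k0" and Y': "Y = HStr \<tau> d\<tau>"
    let ?P = "\<lambda>c. \<exists>dc. (\<forall>k \<in> wpos (wsub \<tau> {..Inf S + s}). dc k = d\<tau> k) \<and>
      is_hobj A (HStr c dc :: ('v, 'a, 'k) hobj) \<and> Db_iso A ?M (Qcx A (HStr c dc :: ('v, 'a, 'k) hobj))"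
    have L: "wlen \<sigma> > 0" using X X' band_wpos by simp
    have ins: "\<exists>a dt db. piece (wsub (oword X) S) \<tau> {i + s..i + s + l} a \<and>
        insertion A \<tau> (unroll \<sigma>) (i + s) (- s) (wlen \<sigma>) l dt db" if "S = {i..i + l}" "0 \<le> l" for i l
      using band_to_string_insertion(1,2)[OF X X' Y Y' q r that] by blast
    have P: "?P u" if "S = {i..i + l}" "0 \<le> l"
        "piece u (ins \<tau> (i + s) (unroll \<sigma>) (- s) (wlen \<sigma>)) (wpos (ins \<tau> (i + s) (unroll \<sigma>) (- s) (wlen \<sigma>))) 0" for i l u
    proof -
      have "Inf S = i" using that by simp
      then show ?thesis using band_to_string_insertion(3)[OF X X' Y Y' q r that] by simp
    qed
    note band_insertion_words[where P = ?P and jf = "\<lambda>i. i + s" and rot = "Inf S", OF S L ins P _ refl refl]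
  } note case_1 = this
  { fix \<sigma> \<tau> d\<sigma> d\<tau> \<mu> k0 assume X': "X = HStr \<sigma> d\<sigma>" and Y': "Y = HBnd \<tau> d\<tau> \<mu> k0"
    let ?P = "\<lambda>c. \<exists>dc. (\<forall>k \<in> wpos (wsub \<sigma> {..Inf S}). dc k = d\<sigma> k - 1) \<and>
      is_hobj A (HStr c dc :: ('v, 'a, 'k) hobj) \<and> Db_iso A ?M (Qcx A (HStr c dc :: ('v, 'a, 'k) hobj))"
    have L: "wlen \<tau> > 0" using Y Y' band_wpos by simp
    have ins: "\<exists>a dt db. piece (wsub (oword X) S) \<sigma> {i..i + l} a \<and>
        insertion A \<sigma> (unroll \<tau>) i s (wlen \<tau>) l dt db" if "S = {i..i + l}" "0 \<le> l" for i l
      using string_to_band_insertion(1,2)[OF X X' Y Y' q r that] by blast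
    have P: "?P u" if "S = {i..i + l}" "0 \<le> l"
        "piece u (ins \<sigma> i (unroll \<tau>) s (wlen \<tau>)) (wpos (ins \<sigma> i (unroll \<tau>) s (wlen \<tau>))) 0" for i l u
    proof -
      have "Inf S = i" using that by simp
      then show ?thesis using string_to_band_insertion(3)[OF X X' Y Y' q r that] by simp
    qed
    note band_insertion_words[where P = ?P and jf = "\<lambda>i. i", OF S L ins P refl refl refl]
  } note case_2 = this
  show ?thesis
    unfolding Let_def
    by (rule conjI; intro allI impI; elim conjE; rule conjI; intro allI impI; (elim conjE)?;
      rule case_1 case_2; simp)
qed

end
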